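(* Let $f,v\in W_0^{1,p}(\Omega)\setminus\{0\}$ satisfy $$\int_\Omega|\nabla v|^{p-2}\langle\nabla v,\nabla\psi\rangle\,dx=\int_\Omega\big[(f^+)^{p-1}-(f^-)^{p-1}\big]\psi\,dx\quad\text{for any }\psi\in W_0^{1,p}(\Omega),$$ and let $v$ be sign-constant in $\Omega$. Then $R[v]\leqslant R^+[f]$ if $v\geqslant0$, and $R[v]\leqslant R^-[f]$ if $v\leqslant0$. Moreover, the equality is achieved if and only if $v=\lambda_1^{1/(1-p)}(\Omega,p)\cdot f$ is the first eigenfunction.
   Context: $1<p<\infty$ and $\Omega\subset\mathbb{R}^D$, $D\geqslant1$, is a domain of finite measure. Write $u^+=\max\{0,u\}$, $u^-=\max\{0,-u\}$, so $u=u^+-u^-$. Sign-constant means $v\geqslant0$ a.e. in $\Omega$ or $v\leqslant0$ a.e. in $\Omega$. The Rayleigh quotient of $u\in W_0^{1,p}(\Omega)\setminus\{0\}$ is $R[u]=\int_\Omega|\nabla u|^p\,dx/\int_\Omega|u|^p\,dx$, and $R^\pm[u]=R[u^\pm]$ whenever $u^\pm\neq0$. A function $u\in W_0^{1,p}(\Omega)\setminus\{0\}$ is an eigenfunction with eigenvalue $\lambda\in\mathbb{R}$ if $\int_\Omega|\nabla u|^{p-2}\langle\nabla u,\nabla\psi\rangle\,dx=\lambda\int_\Omega|u|^{p-2}u\,\psi\,dx$ for all $\psi\in W_0^{1,p}(\Omega)$. The smallest eigenvalue is $\lambda_1(\Omega,p)=\inf\{R[u]:u\in W_0^{1,p}(\Omega)\setminus\{0\}\}>0$;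 a corresponding eigenfunction is called the first eigenfunction and is unique up to a nonzero constant multiple. *)

theory Defs
  imports "HOL-Analysis.Analysis"
begin

text \<open>Functions on \<open>\<Omega>\<close> are represented by total functions; only their class modulo equality
  almost everywhere in \<open>\<Omega>\<close> matters.\<close>

definition Lp_on :: "'a::euclidean_space set \<Rightarrow> real \<Rightarrow> ('a \<Rightarrow> 'b::euclidean_space) \<Rightarrow> bool" where
  "Lp_on \<Omega> p u \<longleftrightarrow> u \<in> borel_measurable (lebesgue_on \<Omega>) \<and>
     integrable (lebesgue_on \<Omega>) (\<lambda>x. norm (u x) powr p)"

definition zero_on :: "'a::euclidean_space set \<Rightarrow> ('a \<Rightarrow> real) \<Rightarrow> bool" where
  "zero_on \<Omega> u \<longleftrightarrow> (AE x in lebesgue_on \<Omega>. u x = 0)"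

definition nonneg_on :: "'a::euclidean_space set \<Rightarrow> ('a \<Rightarrow> real) \<Rightarrow> bool" where
  "nonneg_on \<Omega> u \<longleftrightarrow> (AE x in lebesgue_on \<Omega>. u x \<ge> 0)"

definition nonpos_on :: "'a::euclidean_space set \<Rightarrow> ('a \<Rightarrow> real) \<Rightarrow> bool" where
  "nonpos_on \<Omega> u \<longleftrightarrow> (AE x in lebesgue_on \<Omega>. u x \<le> 0)"

definition sign_constant_on :: "'a::euclidean_space set \<Rightarrow> ('a \<Rightarrow> real) \<Rightarrow> bool" where
  "sign_constant_on \<Omega> u \<longleftrightarrow> nonneg_on \<Omega> u \<or> nonpos_on \<Omega> u"

definition pos_part :: "('a \<Rightarrow> real) \<Rightarrow> 'a \<Rightarrow> real" where
  "pos_part u = (\<lambda>x. max 0 (u x))"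

definition neg_part :: "('a \<Rightarrow> real) \<Rightarrow> 'a \<Rightarrow> real" where
  "neg_part u = (\<lambda>x. max 0 (- u x))"

subsection \<open>Sobolev spaces\<close>

definition partial_deriv :: "'a::euclidean_space \<Rightarrow> ('a \<Rightarrow> real) \<Rightarrow> 'a \<Rightarrow> real" where
  "partial_deriv b \<phi> = (\<lambda>x. frechet_derivative \<phi> (at x) b)"

text \<open>For \<open>k > 0\<close>: \<open>\<phi>\<close> is differentiable everywhere with partial derivatives of class
  \<open>C\<^sup>k\<^sup>-\<^sup>1\<close>; this is equivalent to \<open>\<phi>\<close> being of class \<open>C\<^sup>k\<close>.\<close>

primrec Ck :: "nat \<Rightarrow> ('a::euclidean_space \<Rightarrow> real) \<Rightarrow> bool" where
  "Ck 0 \<phi> \<longleftrightarrow> continuous_on UNIV \<phi>"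
| "Ck (Suc k) \<phi> \<longleftrightarrow> (\<forall>x. \<phi> differentiable (at x)) \<and> (\<forall>b\<in>Basis. Ck k (partial_deriv b \<phi>))"

definition test_functions :: "'a::euclidean_space set \<Rightarrow> ('a \<Rightarrow> real) set" where
  "test_functions \<Omega> = {\<phi>. (\<forall>k. Ck k \<phi>) \<and> compact (closure {x. \<phi> x \<noteq> 0}) \<and>
     closure {x. \<phi> x \<noteq> 0} \<subseteq> \<Omega>}"

definition loc_integrable_on :: "('a::euclidean_space \<Rightarrow> 'b::euclidean_space) \<Rightarrow> 'a set \<Rightarrow> bool" where
  "loc_integrable_on u \<Omega> \<longleftrightarrow> (\<forall>K. compact K \<and> K \<subseteq> \<Omega> \<longrightarrow> u absolutely_integrable_on K)"

definition has_weak_gradient ::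
    "'a::euclidean_space set \<Rightarrow> ('a \<Rightarrow> real) \<Rightarrow> ('a \<Rightarrow> 'a) \<Rightarrow> bool" where
  "has_weak_gradient \<Omega> u G \<longleftrightarrow> loc_integrable_on u \<Omega> \<and> loc_integrable_on G \<Omega> \<and>
     (\<forall>\<phi>\<in>test_functions \<Omega>. \<forall>b\<in>Basis.
        (\<integral>x. u x * partial_deriv b \<phi> x \<partial>lebesgue_on \<Omega>) = - (\<integral>x. (G x \<bullet> b) * \<phi> x \<partial>lebesgue_on \<Omega>))"

text \<open>The weak gradient is unique up to null sets; \<open>weak_grad\<close> selects a representative.\<close>

definition weak_grad :: "'a::euclidean_space set \<Rightarrow> ('a \<Rightarrow> real) \<Rightarrow> 'a \<Rightarrow> 'a" where
  "weak_grad \<Omega> u = (SOME G. has_weak_gradient \<Omega> u G)"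

definition W1p :: "'a::euclidean_space set \<Rightarrow> real \<Rightarrow> ('a \<Rightarrow> real) set" where
  "W1p \<Omega> p = {u. Lp_on \<Omega> p u \<and> (\<exists>G. has_weak_gradient \<Omega> u G \<and> Lp_on \<Omega> p G)}"

definition W1p_norm :: "'a::euclidean_space set \<Rightarrow> real \<Rightarrow> ('a \<Rightarrow> real) \<Rightarrow> real" where
  "W1p_norm \<Omega> p u = ((\<integral>x. \<bar>u x\<bar> powr p \<partial>lebesgue_on \<Omega>)
     + (\<integral>x. norm (weak_grad \<Omega> u x) powr p \<partial>lebesgue_on \<Omega>)) powr (1 / p)"

definition W01p :: "'a::euclidean_space set \<Rightarrow> real \<Rightarrow> ('a \<Rightarrow> real) set" where
  "W01p \<Omega> p = {u \<in> W1p \<Omega> p. \<exists>\<phi>. (\<forall>n. \<phi> n \<in> test_functions \<Omega>) \<and>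
     (\<lambda>n::nat. W1p_norm \<Omega> p (\<lambda>x. \<phi> n x - u x)) \<longlonglongrightarrow> 0}"

subsection \<open>Rayleigh quotient and eigenfunctions of the \<open>p\<close>-Laplacian\<close>

definition rayleigh :: "'a::euclidean_space set \<Rightarrow> real \<Rightarrow> ('a \<Rightarrow> real) \<Rightarrow> real" where
  "rayleigh \<Omega> p u = (\<integral>x. norm (weak_grad \<Omega> u x) powr p \<partial>lebesgue_on \<Omega>)
     / (\<integral>x. \<bar>u x\<bar> powr p \<partial>lebesgue_on \<Omega>)"

definition plap_form :: "'a::euclidean_space set \<Rightarrow> real \<Rightarrow> ('a \<Rightarrow> real) \<Rightarrow> ('a \<Rightarrow> real) \<Rightarrow> real" where
  "plap_form \<Omega> p u \<psi> = (\<integral>x. norm (weak_grad \<Omega> u x) powr (p - 2) *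
     (weak_grad \<Omega> u x \<bullet> weak_grad \<Omega> \<psi> x) \<partial>lebesgue_on \<Omega>)"

definition eigenfunction :: "'a::euclidean_space set \<Rightarrow> real \<Rightarrow> real \<Rightarrow> ('a \<Rightarrow> real) \<Rightarrow> bool" where
  "eigenfunction \<Omega> p \<mu> u \<longleftrightarrow> u \<in> W01p \<Omega> p \<and> \<not> zero_on \<Omega> u \<and>
     (\<forall>\<psi>\<in>W01p \<Omega> p. plap_form \<Omega> p u \<psi> =
        \<mu> * (\<integral>x. \<bar>u x\<bar> powr (p - 2) * u x * \<psi> x \<partial>lebesgue_on \<Omega>))"

definition first_eigenvalue :: "'a::euclidean_space set \<Rightarrow> real \<Rightarrow> real" where
  "first_eigenvalue \<Omega> p = Inf {rayleigh \<Omega> p u |u. u \<in> W01p \<Omega> p \<and> \<not> zero_on \<Omega> u}"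

definition first_eigenfunction :: "'a::euclidean_space set \<Rightarrow> real \<Rightarrow> ('a \<Rightarrow> real) \<Rightarrow> bool" where
  "first_eigenfunction \<Omega> p u \<longleftrightarrow> eigenfunction \<Omega> p (first_eigenvalue \<Omega> p) u"

end

(* Test the equation with v and with the positive part f^+. By Hoelder's inequality the first test gives
   |Dv|_p^p <= |f^+|_p^(p-1) |v|_p and the second one |f^+|_p^p <= |Dv|_p^(p-1) |Df^+|_p; together they yield
   R[v] <= R[f^+]. In the case of equality both Hoelder inequalities are equalities, so v is a positive
   multiple of f^+; testing with f^- then shows f^- = 0, since Dv and Df^- have disjoint supports.
   Hence v is a nonnegative eigenfunction. By the strong maximum principle it is positive, and Picone's
   inequality with the test functions |phi|^p / (v + eps)^(p-1) identifies its eigenvalue as the first one.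
   The case v <= 0 follows by passing to -f and -v. *)

theory Submission
  imports Defs
begin

section \<open>Smooth functions with compact support\<close>

text \<open>The bottleneck is the strong maximum principle. In Picone's inequality the factor
  \<open>v powr (p - 1) * (v + \<epsilon>) powr (1 - p)\<close> tends to 1 only where
  \<open>v\<close> is positive, so zeros of \<open>v\<close> on a set of positive measure would
  spoil the bound. As \<open>v\<close> is merely a Sobolev function, positivity is obtained by an
  integral argument: the same Picone test functions bound the gradient of
  \<open>ln (v + \<epsilon>)\<close> uniformly in \<open>\<epsilon>\<close>, and a Poincare
  inequality turns this into an alternative on each small box, \<open>v = 0\<close> a.e. or
  \<open>v \<noteq> 0\<close> a.e.; connectedness makes the alternative global. Picone's test
  functions are admissible because \<open>\<epsilon> > 0\<close> makes
  \<open>(v + \<epsilon>) powr (1 - p)\<close> a Lipschitz function of \<open>v \<ge> 0\<close> and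
  \<open>\<phi>\<close> is a test function; the bound is then carried to the whole space by density,
  with constants tending to 1 so that it stays sharp. The constant in the equality case comes from
  homogeneity: if \<open>v = \<kappa> * f\<close> with \<open>f \<ge> 0\<close>, the right-hand side
  of the equation is \<open>\<kappa> powr (1 - p) * v powr (p - 1)\<close>, so
  \<open>\<kappa> powr (1 - p)\<close> is the first eigenvalue.\<close>

lemma Ck_Suc_imp: "Ck (Suc k) f \<Longrightarrow> Ck k f"
proof (induction k arbitrary: f)
  case 0
  then show ?case
    by (auto intro!: continuous_at_imp_continuous_on differentiable_imp_continuous_within)
next
  case (Suc k)
  then show ?case by (auto simp del: Ck.simps(1))
qed

lemma partial_deriv_eqI: "(f has_derivative f') (at x) \<Longrightarrow> partial_deriv b f x = f' b"
  unfolding partial_deriv_def by (metis frechet_derivative_at)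

lemma partial_deriv_const: "partial_deriv b (\<lambda>x. c) = (\<lambda>x. 0)"
  by (rule ext, rule partial_deriv_eqI) (rule has_derivative_const)

lemma Ck_const: "Ck k (\<lambda>x. c)"
  by (induction k arbitrary: c) (simp_all add: partial_deriv_const)

lemma partial_deriv_add:
  assumes "f differentiable (at x)" "g differentiable (at x)"
  shows "partial_deriv b (\<lambda>x. f x + g x) x = partial_deriv b f x + partial_deriv b g x"
  by (rule partial_deriv_eqI[THEN trans])
     (use assms in \<open>auto intro!: has_derivative_add simp: frechet_derivative_works partial_deriv_def\<close>)

lemma Ck_add: "Ck k f \<Longrightarrow> Ck k g \<Longrightarrow> Ck k (\<lambda>x. f x + g x)"
proof (induction k arbitrary: f g)
  case 0
  then show ?case by (auto intro: continuous_on_add)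
next
  case (Suc k)
  then have "partial_deriv b (\<lambda>x. f x + g x) = (\<lambda>x. partial_deriv b f x + partial_deriv b g x)" for b
    by (intro ext partial_deriv_add) auto
  with Suc show ?case by auto
qed

lemma partial_deriv_mult:
  assumes "f differentiable (at x)" "g differentiable (at x)"
  shows "partial_deriv b (\<lambda>x. f x * g x) x = f x * partial_deriv b g x + partial_deriv b f x * g x"
  by (rule partial_deriv_eqI[THEN trans])
     (use assms in \<open>auto intro!: has_derivative_mult simp: frechet_derivative_works partial_deriv_def\<close>)

lemma Ck_mult: "Ck k f \<Longrightarrow> Ck k g \<Longrightarrow> Ck k (\<lambda>x. f x * g x)"
proof (induction k arbitrary: f g)
  case 0
  then show ?case by (auto intro: continuous_on_mult)
next
  case (Suc k)
  have "partial_deriv b (\<lambda>x. f x * g x) = (\<lambda>x. f x * partial_deriv b g x + partial_deriv b f x * g x)" for b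
    using Suc.prems by (intro ext partial_deriv_mult) auto
  moreover have "Ck k f" "Ck k g"
    using Suc.prems by (simp_all add: Ck_Suc_imp)
  ultimately show ?case
    using Suc.prems by (auto intro!: Ck_add Suc.IH)
qed

lemma Ck_inner: "Ck k (\<lambda>x. x \<bullet> e - c)"
proof (cases k)
  case 0
  then show ?thesis by (auto intro!: continuous_on_diff continuous_on_inner)
next
  case (Suc n)
  have d: "((\<lambda>x. x \<bullet> e - c) has_derivative (\<lambda>h. h \<bullet> e)) (at x)" for x
    by (auto intro!: derivative_eq_intros)
  then have "partial_deriv b (\<lambda>x. x \<bullet> e - c) = (\<lambda>x. b \<bullet> e)" for b
    by (intro ext partial_deriv_eqI)
  then show ?thesis
    using Suc d by (auto simp: Ck_const differentiable_def)
qed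

lemma Ck_prod:
  assumes "\<And>i. i \<in> I \<Longrightarrow> Ck k (f i)"
  shows "Ck k (\<lambda>x. \<Prod>i\<in>I. f i x)"
  using assms by (induction I rule: infinite_finite_induct) (auto intro!: Ck_mult Ck_const)

text \<open>The span of these functions is closed under differentiation, so that smoothness can be proved
  by induction without computing higher derivatives.\<close>

definition bump_deriv :: "nat \<Rightarrow> real \<Rightarrow> real" where
  "bump_deriv n t = (if 0 < t then (1 / t) ^ n * exp (- (1 / t)) else 0)"

text \<open>Substituting \<open>1 / t\<close> for the variable reduces this to the decay of
  \<open>t ^ n / exp t\<close> at infinity.\<close>

lemma tendsto_bump_0: "((\<lambda>t::real. (1 / t) ^ n * exp (- (1 / t))) \<longlongrightarrow> 0) (at_right 0)"
proof -
  have "((\<lambda>t::real. t ^ n / exp t) \<longlongrightarrow> 0) at_top"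
    by (rule tendsto_power_div_exp_0)
  from filterlim_compose[OF this filterlim_inverse_at_top_right]
  show ?thesis by (simp add: exp_minus field_simps)
qed

lemma bump_deriv_has_derivative:
  "(bump_deriv n has_real_derivative (bump_deriv (n + 2) t - real n * bump_deriv (n + 1) t)) (at t)"
proof -
  consider "t > 0" | "t < 0" | "t = 0" by linarith
  then show ?thesis
  proof cases
    case 1
    have y: "((\<lambda>t. 1 / t) has_real_derivative - ((1 / t)\<^sup>2)) (at t)"
      using 1 by (auto intro!: derivative_eq_intros simp: power2_eq_square)
    have "((\<lambda>t. (1 / t) ^ n * exp (- (1 / t))) has_real_derivative
        (bump_deriv (n + 2) t - real n * bump_deriv (n + 1) t)) (at t)"
      by (rule DERIV_cong[OF DERIV_mult[OF DERIV_power[OF y] DERIV_fun_exp[OF DERIV_minus[OF y]]]],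
          use 1 in \<open>cases n\<close>) (auto simp: bump_deriv_def algebra_simps power2_eq_square)
    moreover have "\<forall>\<^sub>F s in nhds t. bump_deriv n s = (1 / s) ^ n * exp (- (1 / s))"
      using eventually_nhds_in_open[of "{0<..}" t] 1
      by (auto simp: bump_deriv_def elim!: eventually_mono)
    ultimately show ?thesis
      by (subst DERIV_cong_ev) auto
  next
    case 2
    have "\<forall>\<^sub>F s in nhds t. bump_deriv n s = 0"
      using eventually_nhds_in_open[of "{..<0}" t] 2
      by (auto simp: bump_deriv_def elim!: eventually_mono)
    then show ?thesis
      using 2 by (subst DERIV_cong_ev[OF refl _ refl]) (auto simp: bump_deriv_def)
  next
    case 3
    \<comment> \<open>The difference quotient at 0 from the right is the same kind of function with
      exponent \<open>Suc n\<close>; from the left it is 0.\<close>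
    have "((\<lambda>h. (bump_deriv n (0 + h) - bump_deriv n 0) / h) \<longlongrightarrow> 0) (at_right 0)"
      by (rule Lim_transform_eventually[OF tendsto_bump_0[of "Suc n"]])
         (auto simp: bump_deriv_def eventually_at_right_less intro!: eventually_at_rightI[of 0 1])
    moreover have "((\<lambda>h. (bump_deriv n (0 + h) - bump_deriv n 0) / h) \<longlongrightarrow> 0) (at_left 0)"
      by (rule Lim_transform_eventually[of "\<lambda>_. 0"])
         (auto simp: bump_deriv_def intro!: eventually_at_leftI[of "-1" 0])
    ultimately show ?thesis
      using 3 by (simp add: DERIV_def filterlim_split_at bump_deriv_def)
  qed
qed

text \<open>All \<open>n\<close> are treated together, because one differentiation raises the index
  by one or two. Smoothness of \<open>f\<close> is assumed for every order, since each step consumes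
  one more derivative of \<open>f\<close>.\<close>

lemma Ck_bump_deriv:
  assumes "\<And>k. Ck k f"
  shows "Ck k (\<lambda>x. bump_deriv n (f x))"
proof (induction k arbitrary: n)
  case 0
  have "continuous_on UNIV (bump_deriv n)"
    by (meson DERIV_isCont bump_deriv_has_derivative continuous_at_imp_continuous_on)
  moreover have "continuous_on UNIV f"
    using assms[of 0] by simp
  ultimately show ?case
    using continuous_on_compose2[of UNIV "bump_deriv n" UNIV f] by auto
next
  case (Suc k)
  have fd: "f differentiable (at x)" for x
    using assms[of 1] by simp
  then have d: "((\<lambda>x. bump_deriv n (f x)) has_derivative
      (\<lambda>h. (bump_deriv (n + 2) (f x) - real n * bump_deriv (n + 1) (f x)) * frechet_derivative f (at x) h)) (at x)" for x
    using DERIV_compose_FDERIV[OF bump_deriv_has_derivative, of f _ x]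
    by (simp add: frechet_derivative_works mult.commute)
  then have "partial_deriv b (\<lambda>x. bump_deriv n (f x)) = (\<lambda>x. (bump_deriv (n + 2) (f x)
      + (- real n) * bump_deriv (n + 1) (f x)) * partial_deriv b f x)" for b
    unfolding partial_deriv_def[of b f] by (intro ext trans[OF partial_deriv_eqI]) auto
  moreover have "Ck k (\<lambda>x. (bump_deriv (n + 2) (f x)
      + (- real n) * bump_deriv (n + 1) (f x)) * partial_deriv b f x)" if "b \<in> Basis" for b
    using assms[of "Suc k"] that by (intro Ck_mult Ck_add Ck_const Suc.IH) auto
  ultimately show ?case
    using d by (auto simp: differentiable_def)
qed

section \<open>Algebra of test functions\<close>

lemma test_functionsI:
  assumes "\<And>k. Ck k f" "compact K" "K \<subseteq> \<Omega>" "\<And>x. x \<notin> K \<Longrightarrow> f x = 0"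
  shows "f \<in> test_functions \<Omega>"
proof -
  have "closure {x. f x \<noteq> 0} \<subseteq> K"
    using assms by (intro closure_minimal compact_imp_closed) auto
  then show ?thesis
    using assms unfolding test_functions_def
    using bounded_subset[OF compact_imp_bounded[OF assms(2)], of "{x. f x \<noteq> 0}"] by auto
qed

lemma test_functionsE:
  assumes "f \<in> test_functions \<Omega>"
  obtains K where "compact K" "K \<subseteq> \<Omega>" "\<And>x. x \<notin> K \<Longrightarrow> f x = 0"
  using assms closure_subset[of "{x. f x \<noteq> 0}"]
  by (intro that[of "closure {x. f x \<noteq> 0}"]) (auto simp: test_functions_def)

lemma test_functions_Ck: "f \<in> test_functions \<Omega> \<Longrightarrow> Ck k f"
  by (simp add: test_functions_def)

lemma test_functions_add:
  assumes "f \<in> test_functions \<Omega>" "g \<in> test_functions \<Omega>"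
  shows "(\<lambda>x. f x + g x) \<in> test_functions \<Omega>"
proof -
  obtain K where K: "compact K" "K \<subseteq> \<Omega>" "\<And>x. x \<notin> K \<Longrightarrow> f x = 0"
    using assms(1) by (rule test_functionsE) blast
  obtain L where L: "compact L" "L \<subseteq> \<Omega>" "\<And>x. x \<notin> L \<Longrightarrow> g x = 0"
    using assms(2) by (rule test_functionsE) blast
  show ?thesis
    by (rule test_functionsI[of _ "K \<union> L"])
       (use K L in \<open>auto intro!: Ck_add assms[THEN test_functions_Ck]\<close>)
qed

lemma test_functions_mult:
  assumes "f \<in> test_functions \<Omega>" "\<And>k. Ck k g"
  shows "(\<lambda>x. f x * g x) \<in> test_functions \<Omega>"
proof -
  obtain K where K: "compact K" "K \<subseteq> \<Omega>" "\<And>x. x \<notin> K \<Longrightarrow> f x = 0"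
    using assms(1) by (rule test_functionsE) blast
  show ?thesis
    by (rule test_functionsI[of _ K])
       (use K assms(2) in \<open>auto intro!: Ck_mult test_functions_Ck[OF assms(1)]\<close>)
qed

lemma test_functions_zero: "(\<lambda>x. 0) \<in> test_functions \<Omega>"
  by (rule test_functionsI[of _ "{}"]) (auto simp: Ck_const)

lemma test_functions_cmult:
  "f \<in> test_functions \<Omega> \<Longrightarrow> (\<lambda>x. c * f x) \<in> test_functions \<Omega>"
  using test_functions_mult[OF _ Ck_const, of f \<Omega> c] by (simp add: mult.commute)

lemma test_functions_sum:
  "(\<And>i. i \<in> I \<Longrightarrow> f i \<in> test_functions \<Omega>) \<Longrightarrow> (\<lambda>x. \<Sum>i\<in>I. f i x) \<in> test_functions \<Omega>"
  by (induction I rule: infinite_finite_induct) (auto intro!: test_functions_add test_functions_zero)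

lemma test_functions_power:
  "f \<in> test_functions \<Omega> \<Longrightarrow> (\<lambda>x. f x ^ Suc n) \<in> test_functions \<Omega>"
proof (induction n)
  case (Suc n)
  then show ?case
    using test_functions_mult[of f \<Omega> "\<lambda>x. f x ^ Suc n"] by (simp add: test_functions_Ck)
qed simp

lemma partial_deriv_test_function:
  assumes f: "f \<in> test_functions \<Omega>" and b: "b \<in> Basis"
  shows "partial_deriv b f \<in> test_functions \<Omega>"
proof -
  obtain K where K: "compact K" "K \<subseteq> \<Omega>" "\<And>x. x \<notin> K \<Longrightarrow> f x = 0"
    using f by (rule test_functionsE) blast
  have "partial_deriv b f x = 0" if "x \<notin> K" for x
  proof -
    have "open (- K)" using K by (simp add: compact_imp_closed open_Compl)
    then have "(f has_derivative (\<lambda>h. 0)) (at x)"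
      by (rule has_derivative_transform_within_open[OF has_derivative_const[of 0]])
         (use K that in auto)
    then show ?thesis by (rule partial_deriv_eqI)
  qed
  then show ?thesis
    using test_functions_Ck[OF f, of "Suc _"] K b
    by (intro test_functionsI[of _ K]) auto
qed

text \<open>A product of factors \<open>exp (- 1 / t)\<close>, where \<open>t\<close> runs through
  the signed distances to the faces of the box; it is therefore smooth, at most 1, and positive
  exactly on the open box.\<close>

definition box_bump :: "'a::euclidean_space \<Rightarrow> 'a \<Rightarrow> 'a \<Rightarrow> real" where
  "box_bump l u x = (\<Prod>b\<in>Basis. bump_deriv 0 (x \<bullet> b - l \<bullet> b) * bump_deriv 0 (- (x \<bullet> b - u \<bullet> b)))"

lemma bump_deriv_0_bounds: "0 \<le> bump_deriv 0 t" "bump_deriv 0 t \<le> 1"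
  by (auto simp: bump_deriv_def)

lemma box_bump_bounds: "0 \<le> box_bump l u x" "box_bump l u x \<le> 1"
  unfolding box_bump_def
  by (auto intro!: prod_nonneg prod_le_1 mult_nonneg_nonneg mult_le_one bump_deriv_0_bounds)

lemma box_bump_pos: "x \<in> box l u \<Longrightarrow> 0 < box_bump l u x"
  unfolding box_bump_def
  by (auto intro!: prod_pos mult_pos_pos simp: bump_deriv_def mem_box inner_diff_left)

lemma box_bump_eq_0: "x \<notin> box l u \<Longrightarrow> box_bump l u x = 0"
  unfolding box_bump_def
  by (auto intro!: prod_zero simp: bump_deriv_def mem_box) 

lemma box_bump_Ck: "Ck k (box_bump l u)"
proof -
  have "Ck k (\<lambda>x::'a. - (x \<bullet> b - c))" for k b c
    using Ck_mult[OF Ck_const Ck_inner, of k "-1" b c] by simp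
  then show ?thesis
    unfolding box_bump_def by (intro Ck_prod Ck_mult Ck_bump_deriv Ck_inner)
qed

lemma box_bump_test_function: "cbox l u \<subseteq> \<Omega> \<Longrightarrow> box_bump l u \<in> test_functions \<Omega>"
  by (rule test_functionsI[of _ "cbox l u"])
     (auto intro!: box_bump_Ck box_bump_eq_0 dest: subsetD[OF box_subset_cbox])

section \<open>Classical gradients of test functions\<close>

definition grad :: "('a::euclidean_space \<Rightarrow> real) \<Rightarrow> 'a \<Rightarrow> 'a" where
  "grad f x = (\<Sum>b\<in>Basis. partial_deriv b f x *\<^sub>R b)"

lemma grad_inner: "b \<in> Basis \<Longrightarrow> grad f x \<bullet> b = partial_deriv b f x"
  by (simp add: grad_def inner_sum_left inner_Basis if_distrib comm_monoid_add_class.sum.delta cong: if_cong)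

lemma has_derivative_grad:
  assumes "f differentiable (at x)"
  shows "(f has_derivative (\<lambda>h. grad f x \<bullet> h)) (at x)"
proof -
  have l: "linear (frechet_derivative f (at x))"
    using assms by (rule linear_frechet_derivative)
  have "frechet_derivative f (at x) h = grad f x \<bullet> h" for h
  proof -
    have "frechet_derivative f (at x) h = frechet_derivative f (at x) (\<Sum>b\<in>Basis. (h \<bullet> b) *\<^sub>R b)"
      by (simp add: euclidean_representation)
    also have "\<dots> = (\<Sum>b\<in>Basis. (h \<bullet> b) * partial_deriv b f x)"
      by (simp add: linear_sum[OF l] linear_scale[OF l] partial_deriv_def)
    also have "\<dots> = grad f x \<bullet> h"
      by (simp add: grad_def inner_sum_left inner_sum_right inner_commute mult.commute)
    finally show ?thesis .
  qed
  then show ?thesis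
    using assms by (metis (no_types, lifting) ext frechet_derivative_works)
qed

lemma grad_eqI:
  assumes "(f has_derivative (\<lambda>h. v \<bullet> h)) (at x)"
  shows "grad f x = v"
  by (rule euclidean_eqI) (simp add: grad_inner partial_deriv_eqI[OF assms])

lemma test_functions_has_derivative:
  "f \<in> test_functions \<Omega> \<Longrightarrow> (f has_derivative (\<lambda>h. grad f x \<bullet> h)) (at x)"
  using test_functions_Ck[of f \<Omega> 1] by (intro has_derivative_grad) auto

lemma test_functions_continuous: "f \<in> test_functions \<Omega> \<Longrightarrow> continuous_on UNIV f"
  using test_functions_Ck[of f \<Omega> 0] by simp

lemma continuous_compact_support_bounded:
  fixes f :: "'a::euclidean_space \<Rightarrow> 'b::real_normed_vector"
  assumes "continuous_on UNIV f" "compact K" "\<And>x. x \<notin> K \<Longrightarrow> f x = 0"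
  obtains M where "M > 0" "\<And>x. norm (f x) \<le> M"
proof -
  have "bounded (f ` K)"
    using assms by (meson compact_continuous_image compact_imp_bounded continuous_on_subset subset_UNIV)
  then obtain M where "M > 0" "\<And>x. x \<in> K \<Longrightarrow> norm (f x) \<le> M"
    unfolding bounded_pos by auto
  then have "norm (f x) \<le> M" for x
    using assms(3)[of x] by (cases "x \<in> K") auto
  with \<open>M > 0\<close> that show ?thesis by blast
qed

lemma grad_test_function:
  assumes "f \<in> test_functions \<Omega>"
  shows "continuous_on UNIV (grad f)"
    and "\<exists>K. compact K \<and> K \<subseteq> \<Omega> \<and> (\<forall>x. x \<notin> K \<longrightarrow> f x = 0 \<and> grad f x = 0)"
    and "\<exists>M>0. (\<forall>x. \<bar>f x\<bar> \<le> M) \<and> (\<forall>x. norm (grad f x) \<le> M)"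
proof -
  show c: "continuous_on UNIV (grad f)"
    unfolding grad_def
    by (intro continuous_on_sum continuous_on_scaleR continuous_on_const test_functions_continuous)
       (auto intro: partial_deriv_test_function[OF assms])
  obtain K where K: "compact K" "K \<subseteq> \<Omega>" "\<And>x. x \<notin> K \<Longrightarrow> f x = 0"
    using assms by (rule test_functionsE) blast
  have g: "grad f x = 0" if "x \<notin> K" for x
  proof -
    have "open (- K)" using K by (simp add: compact_imp_closed open_Compl)
    then have "(f has_derivative (\<lambda>h. 0)) (at x)"
      by (rule has_derivative_transform_within_open[OF has_derivative_const[of 0]])
         (use K that in auto)
    then show ?thesis by (intro grad_eqI) simp
  qed
  show "\<exists>K. compact K \<and> K \<subseteq> \<Omega> \<and> (\<forall>x. x \<notin> K \<longrightarrow> f x = 0 \<and> grad f x = 0)"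
    using K g by blast
  obtain M1 where "M1 > 0" "\<And>x. norm (f x) \<le> M1"
    using continuous_compact_support_bounded[OF test_functions_continuous[OF assms] K(1,3)] by blast
  moreover obtain M2 where "M2 > 0" "\<And>x. norm (grad f x) \<le> M2"
    using continuous_compact_support_bounded[OF c K(1) g] by blast
  ultimately show "\<exists>M>0. (\<forall>x. \<bar>f x\<bar> \<le> M) \<and> (\<forall>x. norm (grad f x) \<le> M)"
    by (intro exI[of _ "max M1 M2"]) (auto simp: max.coboundedI1 max.coboundedI2 less_max_iff_disj)
qed

lemma grad_add_test:
  assumes "f \<in> test_functions \<Omega>" "g \<in> test_functions \<Omega>"
  shows "grad (\<lambda>x. f x + g x) x = grad f x + grad g x"
  using has_derivative_add[OF assms[THEN test_functions_has_derivative]]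
  by (intro grad_eqI) (simp add: inner_add_left)

lemma grad_mult_test:
  assumes "f \<in> test_functions \<Omega>" "g \<in> test_functions \<Omega>"
  shows "grad (\<lambda>x. f x * g x) x = f x *\<^sub>R grad g x + g x *\<^sub>R grad f x"
  using has_derivative_mult[OF assms[THEN test_functions_has_derivative]]
  by (intro grad_eqI) (simp add: inner_add_left mult.commute)

lemma grad_cmult_test:
  assumes "f \<in> test_functions \<Omega>"
  shows "grad (\<lambda>x. c * f x) x = c *\<^sub>R grad f x"
  using has_derivative_mult_right[OF test_functions_has_derivative[OF assms], of c]
  by (intro grad_eqI) simp

section \<open>Uniqueness of weak gradients\<close>

lemma integral_lebesgue_on_support:
  fixes F :: "'a::euclidean_space \<Rightarrow> 'b::{banach, second_countable_topology}"
  assumes "\<Omega> \<in> sets lebesgue" "\<And>x. x \<notin> \<Omega> \<Longrightarrow> F x = 0"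
  shows "integral\<^sup>L (lebesgue_on \<Omega>) F = integral\<^sup>L lebesgue F"
proof -
  have "(\<lambda>x. indicator \<Omega> x *\<^sub>R F x) = F"
    using assms(2) by (auto simp: indicator_def)
  then show ?thesis
    using assms(1) by (subst integral_restrict_space) auto
qed

lemma integrable_lebesgue_on_support:
  fixes F :: "'a::euclidean_space \<Rightarrow> 'b::{banach, second_countable_topology}"
  assumes "\<Omega> \<in> sets lebesgue" "\<And>x. x \<notin> \<Omega> \<Longrightarrow> F x = 0"
  shows "integrable (lebesgue_on \<Omega>) F \<longleftrightarrow> integrable lebesgue F"
proof -
  have "(\<lambda>x. indicator \<Omega> x *\<^sub>R F x) = F"
    using assms(2) by (auto simp: indicator_def)
  then show ?thesis
    using assms(1) by (subst integrable_restrict_space) auto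
qed

text \<open>Boxes form an intersection-stable generator of the Borel sets, and the sets over which
  \<open>h\<close> integrates to 0 form a Dynkin system; the hypothesis on the total integral serves
  the complements. So \<open>h\<close> integrates to 0 over every Borel set.\<close>

lemma AE_zero_if_box_integrals_zero:
  fixes h :: "'a::euclidean_space \<Rightarrow> real"
  assumes h: "integrable lborel h"
    and boxes: "\<And>l u. (LINT x:box l u|lborel. h x) = 0"
    and total: "(LINT x|lborel. h x) = 0"
  shows "AE x in lborel. h x = 0"
proof (rule sigma_finite_measure.density_zero[OF sigma_finite_lborel h])
  fix A :: "'a set" assume "A \<in> sets lborel"
  then have A: "A \<in> sigma_sets UNIV (range (\<lambda>(a, b). box a b :: 'a set))"
    by (simp add: borel_eq_box)
  have sets: "B \<in> sets lborel" if "B \<in> sigma_sets UNIV (range (\<lambda>(a, b). box a b :: 'a set))" for B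
    using that by (simp add: borel_eq_box)
  have si: "set_integrable lborel B h" if "B \<in> sets lborel" for B
    using integrable_mult_indicator[OF that h] by (simp add: set_integrable_def)
  have stable: "Int_stable (range (\<lambda>(a, b). box a b :: 'a set))"
  proof (rule Int_stableI)
    fix A B :: "'a set"
    assume "A \<in> range (\<lambda>(a, b). box a b)" "B \<in> range (\<lambda>(a, b). box a b)"
    then obtain a b c d where "A = box a b" "B = box c d" by auto
    then obtain e f where "A \<inter> B = box e f" by (simp add: box_Int_box)
    then show "A \<inter> B \<in> range (\<lambda>(a, b). box a b)"
      by (metis (mono_tags, lifting) case_prod_conv rangeI)
  qed
  have "range (\<lambda>(a, b). box a b :: 'a set) \<subseteq> Pow UNIV" by simp
  with stable show "(LINT x:A|lborel. h x) = 0"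
    using A
  proof (induction rule: sigma_sets_induct_disjoint)
    case (basic A)
    then show ?case using boxes by auto
  next
    case empty
    then show ?case by (simp add: set_lebesgue_integral_def)
  next
    case (compl A)
    have "(LINT x:A \<union> (UNIV - A)|lborel. h x) = (LINT x:A|lborel. h x) + (LINT x:UNIV - A|lborel. h x)"
      using sets[OF compl.hyps] by (intro set_integral_Un si) auto
    moreover have "A \<union> (UNIV - A) = UNIV" by auto
    ultimately show ?case
      using compl.IH total by (simp add: set_lebesgue_integral_def)
  next
    case (union A)
    have *: "A i \<in> sets lborel" for i
      using union.hyps(2) by (intro sets) auto
    have "(LINT x:(\<Union>i. A i)|lborel. h x) = (\<Sum>i. (LINT x:A i|lborel. h x))"
      using union.hyps(1) * by (intro lebesgue_integral_countable_add si) (auto simp: disjoint_family_on_def)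
    then show ?case using union by simp
  qed
qed

text \<open>With \<open>b\<close> the bump of the box, take \<open>1 - (1 - b) ^ n\<close>. Since
  \<open>0 < b \<le> 1\<close> inside the box, it tends to 1 there; as a polynomial in
  \<open>b\<close> without constant term it is again a test function.\<close>

lemma test_functions_tendsto_indicator_box:
  fixes l u :: "'a::euclidean_space"
  assumes "cbox l u \<subseteq> \<Omega>"
  obtains \<phi> where "\<And>n::nat. \<phi> n \<in> test_functions \<Omega>" "\<And>n x. \<bar>\<phi> n x\<bar> \<le> indicator (box l u) x"
    "\<And>x. (\<lambda>n. \<phi> n x) \<longlonglongrightarrow> indicator (box l u) x"
proof -
  define \<phi> where "\<phi> n x = 1 - (1 - box_bump l u x) ^ n" for n x
  note b = box_bump_bounds[of l u]
  have 1: "\<phi> n \<in> test_functions \<Omega>" for n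
  proof (induction n)
    case 0
    then show ?case by (simp add: \<phi>_def test_functions_zero)
  next
    case (Suc n)
    have "\<phi> (Suc n) = (\<lambda>x. \<phi> n x + (box_bump l u x + (-1) * (\<phi> n x * box_bump l u x)))"
      by (simp add: fun_eq_iff \<phi>_def algebra_simps)
    also have "\<dots> \<in> test_functions \<Omega>"
      by (rule test_functions_add[OF Suc test_functions_add[OF box_bump_test_function[OF assms]
          test_functions_cmult[OF test_functions_mult[OF Suc box_bump_Ck]]]])
    finally show ?case .
  qed
  have 2: "\<bar>\<phi> n x\<bar> \<le> indicator (box l u) x" for n x
  proof (cases "x \<in> box l u")
    case True
    have "0 \<le> (1 - box_bump l u x) ^ n" "(1 - box_bump l u x) ^ n \<le> 1"
      using b[of x] by (auto intro!: power_le_one)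
    then show ?thesis using True by (simp add: \<phi>_def)
  qed (simp add: \<phi>_def box_bump_eq_0)
  have 3: "(\<lambda>n. \<phi> n x) \<longlonglongrightarrow> indicator (box l u) x" for x
  proof (cases "x \<in> box l u")
    case True
    have "(\<lambda>n. (1 - box_bump l u x) ^ n) \<longlonglongrightarrow> 0"
      using b[of x] box_bump_pos[OF True] by (intro LIMSEQ_power_zero) auto
    from tendsto_diff[OF tendsto_const[of 1] this] True show ?thesis
      by (simp add: \<phi>_def)
  qed (simp add: \<phi>_def box_bump_eq_0)
  from 1 2 3 show ?thesis by (rule that)
qed

text \<open>Test with functions tending to the indicator of the box and pass to the limit;
  \<open>g\<close> restricted to the box dominates.\<close>

lemma fundamental_lemma_box:
  fixes g :: "'a::euclidean_space \<Rightarrow> real"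
  assumes \<Omega>: "open \<Omega>" and g: "loc_integrable_on g \<Omega>"
    and zero: "\<And>\<phi>. \<phi> \<in> test_functions \<Omega> \<Longrightarrow> (\<integral>x. g x * \<phi> x \<partial>lebesgue_on \<Omega>) = 0"
    and sub: "cbox l u \<subseteq> \<Omega>"
  shows "(LINT x:box l u|lebesgue. g x) = 0"
proof -
  obtain \<phi> where \<phi>: "\<And>n::nat. \<phi> n \<in> test_functions \<Omega>" "\<And>n x. \<bar>\<phi> n x\<bar> \<le> indicator (box l u) x"
    "\<And>x. (\<lambda>n. \<phi> n x) \<longlonglongrightarrow> indicator (box l u) x"
    by (rule test_functions_tendsto_indicator_box[OF sub]) blast
  have "set_integrable lebesgue (cbox l u) g"
    using g sub by (auto simp: loc_integrable_on_def)
  then have gi: "set_integrable lebesgue (box l u) g"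
    by (rule set_integrable_subset) (auto simp: box_subset_cbox)
  have m: "\<phi> n \<in> borel_measurable lebesgue" for n
    using test_functions_continuous[OF \<phi>(1)] 
    by (intro measurable_completion) (simp add: borel_measurable_continuous_onI)
  have z: "\<phi> n x = 0" if "x \<notin> box l u" for n x
    using \<phi>(2)[of n x] that by simp
  have e: "g x * \<phi> n x = (indicator (box l u) x *\<^sub>R g x) * \<phi> n x" for n x
    using z[of x n] by (cases "x \<in> box l u") auto
  have "(\<lambda>n. \<integral>x. (indicator (box l u) x *\<^sub>R g x) * \<phi> n x \<partial>lebesgue)
      \<longlonglongrightarrow> (\<integral>x. indicator (box l u) x *\<^sub>R g x \<partial>lebesgue)"
  proof (rule integral_dominated_convergence)
    show "integrable lebesgue (\<lambda>x. norm (indicator (box l u) x *\<^sub>R g x))"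
      using gi by (simp add: set_integrable_def)
    show "(\<lambda>x. indicator (box l u) x *\<^sub>R g x * \<phi> n x) \<in> borel_measurable lebesgue" for n
      using gi m by (auto simp: set_integrable_def)
    show "(\<lambda>x. indicator (box l u) x *\<^sub>R g x) \<in> borel_measurable lebesgue"
      using gi by (auto simp: set_integrable_def)
    show "AE x in lebesgue. (\<lambda>n. indicator (box l u) x *\<^sub>R g x * \<phi> n x) \<longlonglongrightarrow> indicator (box l u) x *\<^sub>R g x"
    proof (rule AE_I2)
      fix x
      have "(\<lambda>n. indicator (box l u) x *\<^sub>R g x * \<phi> n x) \<longlonglongrightarrow> indicator (box l u) x *\<^sub>R g x * indicator (box l u) x"
        by (intro tendsto_intros \<phi>(3))
      also have "indicator (box l u) x *\<^sub>R g x * indicator (box l u) x = indicator (box l u) x *\<^sub>R g x"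
        by (simp add: indicator_def)
      finally show "(\<lambda>n. indicator (box l u) x *\<^sub>R g x * \<phi> n x) \<longlonglongrightarrow> indicator (box l u) x *\<^sub>R g x" .
    qed
    show "AE x in lebesgue. norm (indicator (box l u) x *\<^sub>R g x * \<phi> n x) \<le> norm (indicator (box l u) x *\<^sub>R g x)" for n
    proof (rule AE_I2)
      fix x
      have "\<bar>\<phi> n x\<bar> \<le> 1"
        using \<phi>(2)[of n x] by (cases "x \<in> box l u") auto
      then show "norm (indicator (box l u) x *\<^sub>R g x * \<phi> n x) \<le> norm (indicator (box l u) x *\<^sub>R g x)"
        by (auto simp: abs_mult intro!: mult_left_le)
    qed
  qed
  moreover have "(\<integral>x. (indicator (box l u) x *\<^sub>R g x) * \<phi> n x \<partial>lebesgue) = 0" for n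
  proof -
    have "x \<notin> \<Omega> \<Longrightarrow> \<phi> n x = 0" for x
      using z sub box_subset_cbox by blast
    then have "(\<integral>x. g x * \<phi> n x \<partial>lebesgue) = 0"
      using zero[OF \<phi>(1)[of n]] \<Omega> by (subst (asm) integral_lebesgue_on_support) auto
    then show ?thesis by (simp only: e)
  qed
  ultimately show ?thesis
    by (simp add: LIMSEQ_const_iff set_lebesgue_integral_def)
qed

text \<open>The Dynkin argument works with Borel sets, whereas \<open>g\<close> is only Lebesgue
  measurable; hence the detour through a Borel function \<open>h\<close> that agrees a.e. with
  \<open>g\<close> on the box and with 0 outside. Intersections of boxes are boxes, so the
  hypothesis on subboxes covers all box integrals of \<open>h\<close>.\<close>

lemma AE_zero_if_box_integrals_zero_lebesgue:
  fixes g :: "'a::euclidean_space \<Rightarrow> real"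
  assumes gi: "set_integrable lebesgue (box l u) g"
    and zero: "\<And>l' u'. box l' u' \<subseteq> box l u \<Longrightarrow> (LINT x:box l' u'|lebesgue. g x) = 0"
  shows "AE x in lebesgue. x \<in> box l u \<longrightarrow> g x = 0"
proof -
  let ?g = "\<lambda>x. indicator (box l u) x *\<^sub>R g x"
  have "?g \<in> borel_measurable lebesgue"
    using gi by (auto simp: set_integrable_def)
  then obtain h where h[measurable]: "h \<in> borel_measurable lborel" and gh: "AE x in lborel. ?g x = h x"
    using completion_ex_borel_measurable_real by blast
  then have gh': "AE x in lebesgue. ?g x = h x"
    by (simp add: AE_completion)
  have hi: "integrable lebesgue h"
    using gi gh' unfolding set_integrable_def
    by (intro integrable_cong_AE_imp[of lebesgue ?g h]) (auto intro: measurable_completion)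
  then have hi': "integrable lborel h"
    by (subst (asm) integrable_completion) auto
  have eq: "(\<integral>x. indicator A x *\<^sub>R h x \<partial>lborel) = (LINT x:A \<inter> box l u|lebesgue. g x)"
    if [measurable]: "A \<in> sets borel" for A
  proof -
    have "(\<integral>x. indicator A x *\<^sub>R h x \<partial>lborel) = (\<integral>x. indicator A x *\<^sub>R h x \<partial>lebesgue)"
      by (rule integral_completion[symmetric]) measurable
    also have "\<dots> = (\<integral>x. indicator A x *\<^sub>R ?g x \<partial>lebesgue)"
    proof (rule integral_cong_AE)
      show "(\<lambda>x. indicator A x *\<^sub>R h x) \<in> borel_measurable lebesgue"
        by (rule measurable_completion) measurable
      show "(\<lambda>x. indicator A x *\<^sub>R ?g x) \<in> borel_measurable lebesgue"
        using gi that unfolding set_integrable_def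
        by (intro borel_measurable_scaleR borel_measurable_indicator borel_measurable_integrable) auto
      show "AE x in lebesgue. indicator A x *\<^sub>R h x = indicator A x *\<^sub>R ?g x"
        using gh' by eventually_elim simp
    qed
    finally show ?thesis
      by (simp add: set_lebesgue_integral_def indicator_inter_arith mult.assoc)
  qed
  have "AE x in lborel. h x = 0"
  proof (rule AE_zero_if_box_integrals_zero[OF hi'])
    show "(LINT x:box l' u'|lborel. h x) = 0" for l' u'
      unfolding set_lebesgue_integral_def
      by (subst eq, simp, subst box_Int_box, rule zero, subst box_Int_box[symmetric]) auto
    show "(LINT x|lborel. h x) = 0"
      using eq[of UNIV] zero[of l u] by simp
  qed
  then have "AE x in lebesgue. h x = 0"
    by (rule AE_completion)
  with gh' show ?thesis
    by eventually_elim (auto simp: indicator_def split: if_splits)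
qed

lemma AE_lebesgue_on_iff_negligible:
  assumes "\<Omega> \<in> sets lebesgue"
  shows "(AE x in lebesgue_on \<Omega>. P x) \<longleftrightarrow> negligible {x \<in> \<Omega>. \<not> P x}"
proof -
  have "(AE x in lebesgue_on \<Omega>. P x) \<longleftrightarrow> (AE x in lebesgue. x \<in> \<Omega> \<longrightarrow> P x)"
    using assms by (simp add: AE_restrict_space_iff)
  also have "\<dots> \<longleftrightarrow> negligible {x. \<not> (x \<in> \<Omega> \<longrightarrow> P x)}"
    by (simp add: completion.AE_iff_null_sets negligible_iff_null_sets)
  also have "{x. \<not> (x \<in> \<Omega> \<longrightarrow> P x)} = {x \<in> \<Omega>. \<not> P x}" by auto
  finally show ?thesis .
qed

text \<open>A locally null set is null, by the Lindelof property of Euclidean space. This permits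
  proving a.e. statements on \<open>\<Omega>\<close> box by box.\<close>

lemma AE_lebesgue_onI_cover:
  assumes \<Omega>: "open \<Omega>"
    and cover: "\<And>x. x \<in> \<Omega> \<Longrightarrow> \<exists>U. open U \<and> x \<in> U \<and> negligible {y \<in> \<Omega> \<inter> U. \<not> P y}"
  shows "AE x in lebesgue_on \<Omega>. P x"
proof -
  have "negligible {x \<in> \<Omega>. \<not> P x}"
    unfolding locally_negligible_alt[of "{x \<in> \<Omega>. \<not> P x}"]
  proof
    fix x assume x: "x \<in> {x \<in> \<Omega>. \<not> P x}"
    then obtain U where U: "open U" "x \<in> U" "negligible {y \<in> \<Omega> \<inter> U. \<not> P y}"
      using cover by auto
    moreover have "{x \<in> \<Omega>. \<not> P x} \<inter> U = {y \<in> \<Omega> \<inter> U. \<not> P y}" by auto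
    ultimately show "\<exists>U. openin (top_of_set {x \<in> \<Omega>. \<not> P x}) U \<and> x \<in> U \<and> negligible U"
      using x openin_open_Int[OF U(1), of "{x \<in> \<Omega>. \<not> P x}"]
      by (intro exI[of _ "{x \<in> \<Omega>. \<not> P x} \<inter> U"]) simp
  qed
  then show ?thesis
    using \<Omega> by (subst AE_lebesgue_on_iff_negligible) auto
qed

lemma fundamental_lemma:
  fixes g :: "'a::euclidean_space \<Rightarrow> real"
  assumes \<Omega>: "open \<Omega>" and g: "loc_integrable_on g \<Omega>"
    and zero: "\<And>\<phi>. \<phi> \<in> test_functions \<Omega> \<Longrightarrow> (\<integral>x. g x * \<phi> x \<partial>lebesgue_on \<Omega>) = 0"
  shows "AE x in lebesgue_on \<Omega>. g x = 0"
proof (rule AE_lebesgue_onI_cover[OF \<Omega>])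
  fix x assume "x \<in> \<Omega>"
  then obtain l u where sub: "cbox l u \<subseteq> \<Omega>" and x: "x \<in> box l u"
    using open_contains_cbox[OF \<Omega>] by blast
  have "set_integrable lebesgue (cbox l u) g"
    using g sub by (auto simp: loc_integrable_on_def)
  then have "set_integrable lebesgue (box l u) g"
    by (rule set_integrable_subset) (auto simp: box_subset_cbox)
  then have "AE x in lebesgue. x \<in> box l u \<longrightarrow> g x = 0"
  proof (rule AE_zero_if_box_integrals_zero_lebesgue)
    fix l' u' assume "box l' u' \<subseteq> box l u"
    \<comment> \<open>Taking closures turns the inclusion of open boxes into one of closed boxes,
      which places \<open>cbox l' u'\<close> inside \<open>\<Omega>\<close>.\<close>
    then have "box l' u' = {} \<or> cbox l' u' \<subseteq> cbox l u"
      by (metis closure_box closure_mono closure_empty subset_empty)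
    then show "(LINT x:box l' u'|lebesgue. g x) = 0"
      using fundamental_lemma_box[OF \<Omega> g zero, of l' u'] sub
      by (auto simp: set_lebesgue_integral_def)
  qed
  then have "negligible {x \<in> box l u. g x \<noteq> 0}"
    by (simp add: completion.AE_iff_null_sets negligible_iff_null_sets)
  then have "negligible {y \<in> \<Omega> \<inter> box l u. g y \<noteq> 0}"
    by (rule negligible_subset) auto
  then show "\<exists>U. open U \<and> x \<in> U \<and> negligible {y \<in> \<Omega> \<inter> U. g y \<noteq> 0}"
    using x by (intro exI[of _ "box l u"]) auto
qed

section \<open>Uniqueness of weak gradients, and those of test functions\<close>

lemma test_functions_measurable:
  fixes f :: "'a::euclidean_space \<Rightarrow> real"
  assumes "f \<in> test_functions \<Omega>"
  shows "f \<in> borel_measurable (lebesgue_on S)" "grad f \<in> borel_measurable (lebesgue_on S)"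
  using test_functions_continuous[OF assms] grad_test_function(1)[OF assms]
  by (auto intro!: measurable_restrict_space1 measurable_completion borel_measurable_continuous_onI)

lemma loc_integrable_bounded_mult:
  fixes g \<phi> :: "'a::euclidean_space \<Rightarrow> real"
  assumes \<Omega>: "open \<Omega>" and g: "loc_integrable_on g \<Omega>" and \<phi>: "\<phi> \<in> test_functions \<Omega>"
  shows "integrable (lebesgue_on \<Omega>) (\<lambda>x. g x * \<phi> x)"
proof -
  obtain K where K: "compact K" "K \<subseteq> \<Omega>" "\<And>x. x \<notin> K \<Longrightarrow> \<phi> x = 0"
    using \<phi> by (rule test_functionsE) blast
  obtain M where M: "M > 0" "\<And>x. \<bar>\<phi> x\<bar> \<le> M"
    using grad_test_function(3)[OF \<phi>] by blast
  have gi: "integrable lebesgue (\<lambda>x. indicator K x *\<^sub>R g x)"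
    using g K by (auto simp: loc_integrable_on_def set_integrable_def)
  have "integrable lebesgue (\<lambda>x. (indicator K x *\<^sub>R g x) * \<phi> x)"
  proof (rule Bochner_Integration.integrable_bound)
    show "integrable lebesgue (\<lambda>x. M * norm (indicator K x *\<^sub>R g x))"
      using gi by auto
    show "(\<lambda>x. indicator K x *\<^sub>R g x * \<phi> x) \<in> borel_measurable lebesgue"
      using test_functions_measurable(1)[OF \<phi>, of UNIV] gi by auto
    show "AE x in lebesgue. norm (indicator K x *\<^sub>R g x * \<phi> x) \<le> norm (M * norm (indicator K x *\<^sub>R g x))"
      using M by (intro AE_I2) (auto simp: abs_mult mult.commute intro!: mult_mono)
  qed
  also have "(\<lambda>x. (indicator K x *\<^sub>R g x) * \<phi> x) = (\<lambda>x. g x * \<phi> x)"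
  proof
    show "(indicator K x *\<^sub>R g x) * \<phi> x = g x * \<phi> x" for x
      using K(3)[of x] by (cases "x \<in> K") auto
  qed
  finally show ?thesis
    using K \<Omega> by (subst integrable_lebesgue_on_support) auto
qed

text \<open>Apply the fundamental lemma to each component of \<open>G - H\<close>. This is what
  makes the representative chosen in \<open>weak_grad\<close> interchangeable with any explicit weak
  gradient.\<close>

lemma weak_gradient_unique:
  assumes \<Omega>: "open \<Omega>" and G: "has_weak_gradient \<Omega> u G" and H: "has_weak_gradient \<Omega> v H"
    and uv: "AE x in lebesgue_on \<Omega>. u x = v x"
  shows "AE x in lebesgue_on \<Omega>. G x = H x"
proof -
  have "AE x in lebesgue_on \<Omega>. (G x - H x) \<bullet> b = 0" if b: "b \<in> Basis" for b
  proof (rule fundamental_lemma[OF \<Omega>])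
    have comp: "loc_integrable_on (\<lambda>x. F x \<bullet> b) \<Omega>" if "loc_integrable_on F \<Omega>" for F :: "'a \<Rightarrow> 'a"
      using that unfolding loc_integrable_on_def
      by (auto intro!: absolutely_integrable_component)
    have "loc_integrable_on G \<Omega>" "loc_integrable_on H \<Omega>"
      using G H by (simp_all add: has_weak_gradient_def)
    then show "loc_integrable_on (\<lambda>x. (G x - H x) \<bullet> b) \<Omega>"
      unfolding inner_diff_left loc_integrable_on_def
      using comp[of G] comp[of H] unfolding loc_integrable_on_def
      by (auto intro!: set_integral_diff(1))
    fix \<phi> assume \<phi>: "\<phi> \<in> test_functions \<Omega>"
    have "loc_integrable_on u \<Omega>" "loc_integrable_on v \<Omega>"
      using G H by (simp_all add: has_weak_gradient_def)
    note i = this[THEN loc_integrable_bounded_mult[OF \<Omega> _ partial_deriv_test_function[OF \<phi> b]]]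
    have "(\<integral>x. u x * partial_deriv b \<phi> x \<partial>lebesgue_on \<Omega>) = (\<integral>x. v x * partial_deriv b \<phi> x \<partial>lebesgue_on \<Omega>)"
      using uv i by (intro integral_cong_AE borel_measurable_integrable) auto
    then have "(\<integral>x. (G x \<bullet> b) * \<phi> x \<partial>lebesgue_on \<Omega>) = (\<integral>x. (H x \<bullet> b) * \<phi> x \<partial>lebesgue_on \<Omega>)"
      using G H \<phi> b by (simp add: has_weak_gradient_def)
    moreover have "integrable (lebesgue_on \<Omega>) (\<lambda>x. (G x \<bullet> b) * \<phi> x)"
      "integrable (lebesgue_on \<Omega>) (\<lambda>x. (H x \<bullet> b) * \<phi> x)"
      using \<open>loc_integrable_on G \<Omega>\<close> \<open>loc_integrable_on H \<Omega>\<close>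
      by (auto intro!: loc_integrable_bounded_mult[OF \<Omega> _ \<phi>] comp)
    ultimately show "(\<integral>x. ((G x - H x) \<bullet> b) * \<phi> x \<partial>lebesgue_on \<Omega>) = 0"
      by (simp add: inner_diff_left left_diff_distrib)
  qed
  then have "AE x in lebesgue_on \<Omega>. \<forall>b\<in>Basis. (G x - H x) \<bullet> b = 0"
    by (intro AE_finite_allI) auto
  then show ?thesis
    by eventually_elim (metis euclidean_all_zero_iff eq_iff_diff_eq_0)
qed

text \<open>By translation invariance of Lebesgue measure every difference quotient of
  \<open>f\<close> has integral 0, and the quotients converge boundedly to the partial
  derivative.\<close>

lemma integral_partial_deriv_test:
  fixes f :: "'a::euclidean_space \<Rightarrow> real"
  assumes \<Omega>: "open \<Omega>" and f: "f \<in> test_functions \<Omega>" and b: "b \<in> Basis"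
  shows "(\<integral>x. partial_deriv b f x \<partial>lebesgue_on \<Omega>) = 0"
proof -
  define q where "q n x = real (Suc n) * (f (x + (1 / real (Suc n)) *\<^sub>R b) - f x)" for n x
  have fm[measurable]: "f \<in> borel_measurable borel"
    using test_functions_continuous[OF f] by (rule borel_measurable_continuous_onI)
  have pf: "partial_deriv b f \<in> test_functions \<Omega>"
    by (rule partial_deriv_test_function[OF f b])
  obtain K where K: "compact K" "K \<subseteq> \<Omega>" "\<And>x. x \<notin> K \<Longrightarrow> f x = 0"
    using f by (rule test_functionsE) blast
  obtain M where M: "M > 0" "\<And>x. norm (grad f x) \<le> M"
    using grad_test_function(3)[OF f] by blast
  obtain R where R: "\<And>x. x \<in> K \<Longrightarrow> norm x \<le> R"
    using K(1) by (meson bounded_iff compact_imp_bounded)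
  have lip: "\<bar>f y - f x\<bar> \<le> M * norm (y - x)" for x y
  proof -
    have "onorm (\<lambda>h. grad f z \<bullet> h) \<le> M" for z
      using M(2)[of z] order_trans[OF Cauchy_Schwarz_ineq2 mult_right_mono[of "norm (grad f z)" M "norm _"]]
      by (intro onorm_le) auto
    then show ?thesis
      using differentiable_bound[of UNIV f "\<lambda>z h. grad f z \<bullet> h" M y x]
        test_functions_has_derivative[OF f] by simp
  qed
  have fi: "integrable lborel f"
  proof -
    have "integrable lborel (\<lambda>x. indicator K x *\<^sub>R f x)"
      using K(1) test_functions_continuous[OF f]
      by (intro borel_integrable_compact) (auto intro: continuous_on_subset)
    also have "(\<lambda>x. indicator K x *\<^sub>R f x) = f"
    proof
      show "indicator K x *\<^sub>R f x = f x" for x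
        using K(3)[of x] by (cases "x \<in> K") auto
    qed
    finally show ?thesis .
  qed
  have shift: "integrable lborel (\<lambda>x. f (x + c))" "(\<integral>x. f (x + c) \<partial>lborel) = (\<integral>x. f x \<partial>lborel)" for c
  proof -
    have d: "distr lborel borel ((+) c) = lborel" by (rule lborel_distr_plus)
    show "integrable lborel (\<lambda>x. f (x + c))"
      using fi integrable_distr_eq[of "(+) c" lborel borel f] d by (simp add: add.commute)
    show "(\<integral>x. f (x + c) \<partial>lborel) = (\<integral>x. f x \<partial>lborel)"
      using integral_distr[of "(+) c" lborel borel f] d by (simp add: add.commute)
  qed
  have "(\<lambda>n. \<integral>x. q n x \<partial>lborel) \<longlonglongrightarrow> (\<integral>x. partial_deriv b f x \<partial>lborel)"
  proof (rule integral_dominated_convergence)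
    show "partial_deriv b f \<in> borel_measurable lborel"
      using test_functions_continuous[OF pf] by (simp add: borel_measurable_continuous_onI)
    show "q n \<in> borel_measurable lborel" for n
      unfolding q_def by measurable
    \<comment> \<open>The quotient at \<open>x\<close> is nonzero only if \<open>x\<close> or its
      translate lies in \<open>K\<close>. The shift has length at most 1, so \<open>x\<close> then
      lies in the ball of radius \<open>R + 1\<close>, and the Lipschitz constant \<open>M\<close>
      of \<open>f\<close> bounds the quotient.\<close>
    show "integrable lborel (\<lambda>x. indicator (cball (0::'a) (R + 1)) x *\<^sub>R M)"
      by (rule borel_integrable_compact) auto
    show "AE x in lborel. (\<lambda>n. q n x) \<longlonglongrightarrow> partial_deriv b f x"
    proof (rule AE_I2)
      fix x
      have "((\<lambda>t. f (x + t *\<^sub>R b)) has_derivative (\<lambda>t. grad f (x + 0 *\<^sub>R b) \<bullet> (t *\<^sub>R b))) (at 0)"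
        by (rule has_derivative_compose[OF _ test_functions_has_derivative[OF f]])
           (auto intro!: derivative_eq_intros)
      then have "((\<lambda>t. f (x + t *\<^sub>R b)) has_real_derivative partial_deriv b f x) (at 0)"
        using b by (simp add: has_field_derivative_def grad_inner mult_commute_abs)
      then have l: "((\<lambda>t. (f (x + t *\<^sub>R b) - f x) / t) \<longlongrightarrow> partial_deriv b f x) (at 0)"
        by (simp add: DERIV_def)
      have "filterlim (\<lambda>n. 1 / real (Suc n)) (at 0) sequentially"
        unfolding filterlim_at by (use LIMSEQ_Suc[OF lim_1_over_n] in simp_all)
      from filterlim_compose[OF l this] show "(\<lambda>n. q n x) \<longlonglongrightarrow> partial_deriv b f x"
        by (simp add: q_def mult.commute)
    qed
    show "AE x in lborel. norm (q n x) \<le> indicator (cball (0::'a) (R + 1)) x *\<^sub>R M" for n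
    proof (rule AE_I2)
      fix x :: 'a
      let ?y = "x + (1 / real (Suc n)) *\<^sub>R b"
      show "norm (q n x) \<le> indicator (cball (0::'a) (R + 1)) x *\<^sub>R M"
      proof (cases "x \<in> K \<or> ?y \<in> K")
        case True
        have d: "norm (?y - x) = 1 / real (Suc n)" "norm (?y - x) \<le> 1"
          using b by simp_all
        have "norm x \<le> norm ?y + norm (?y - x)"
          using norm_triangle_ineq4[of ?y "?y - x"] by simp
        then have "norm x \<le> R + 1"
          using True R[of x] R[of ?y] d(2) by linarith
        moreover have "norm (q n x) \<le> M"
          using mult_left_mono[OF lip[of ?y x], of "real (Suc n)"] d(1)
          by (simp add: q_def abs_mult)
        ultimately show ?thesis by simp
      next
        case False
        then show ?thesis
          using K(3)[of x] K(3)[of ?y] M(1) by (simp add: q_def)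
      qed
    qed
  qed
  moreover have "(\<integral>x. q n x \<partial>lborel) = 0" for n
    unfolding q_def using shift fi by (simp del: of_nat_Suc)
  ultimately have "(\<integral>x. partial_deriv b f x \<partial>lborel) = 0"
    by (simp add: LIMSEQ_const_iff)
  moreover have "(\<integral>x. partial_deriv b f x \<partial>lebesgue) = (\<integral>x. partial_deriv b f x \<partial>lborel)"
    using test_functions_continuous[OF pf] by (intro integral_completion) (simp add: borel_measurable_continuous_onI)
  moreover have "(\<integral>x. partial_deriv b f x \<partial>lebesgue_on \<Omega>) = (\<integral>x. partial_deriv b f x \<partial>lebesgue)"
    using \<Omega> pf by (intro integral_lebesgue_on_support) (auto elim!: test_functionsE)
  ultimately show ?thesis by simp
qed

lemma loc_integrable_continuous:
  "continuous_on UNIV f \<Longrightarrow> loc_integrable_on f \<Omega>"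
  unfolding loc_integrable_on_def set_integrable_def
  by (auto intro!: integrable_completion[THEN iffD2] borel_integrable_compact
      intro: continuous_on_subset borel_measurable_integrable)

text \<open>Integration by parts: the product \<open>f * \<phi>\<close> is itself a test function,
  so its partial derivatives have integral 0.\<close>

lemma has_weak_gradient_test_function:
  assumes \<Omega>: "open \<Omega>" and f: "f \<in> test_functions \<Omega>"
  shows "has_weak_gradient \<Omega> f (grad f)"
  unfolding has_weak_gradient_def
proof (intro conjI ballI)
  show "loc_integrable_on f \<Omega>" "loc_integrable_on (grad f) \<Omega>"
    using f by (auto intro!: loc_integrable_continuous test_functions_continuous grad_test_function(1))
  fix \<phi> :: "'a \<Rightarrow> real" and b :: 'a assume \<phi>: "\<phi> \<in> test_functions \<Omega>" and b: "b \<in> Basis"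
  note i1 = loc_integrable_bounded_mult[OF \<Omega> loc_integrable_continuous[OF test_functions_continuous[OF f]] partial_deriv_test_function[OF \<phi> b]]
  note i2 = loc_integrable_bounded_mult[OF \<Omega> loc_integrable_continuous[OF test_functions_continuous[OF partial_deriv_test_function[OF f b]]] \<phi>]
  have "0 = (\<integral>x. partial_deriv b (\<lambda>x. f x * \<phi> x) x \<partial>lebesgue_on \<Omega>)"
    using \<Omega> f \<phi> b by (intro integral_partial_deriv_test[symmetric] test_functions_mult) (auto simp: test_functions_Ck)
  also have "\<dots> = (\<integral>x. f x * partial_deriv b \<phi> x + partial_deriv b f x * \<phi> x \<partial>lebesgue_on \<Omega>)"
    using test_functions_has_derivative[OF f] test_functions_has_derivative[OF \<phi>]
    by (subst partial_deriv_mult) (auto simp: differentiable_def)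
  also have "\<dots> = (\<integral>x. f x * partial_deriv b \<phi> x \<partial>lebesgue_on \<Omega>) + (\<integral>x. (grad f x \<bullet> b) * \<phi> x \<partial>lebesgue_on \<Omega>)"
    using i1 i2 b by (simp add: grad_inner)
  finally show "(\<integral>x. f x * partial_deriv b \<phi> x \<partial>lebesgue_on \<Omega>) = - (\<integral>x. (grad f x \<bullet> b) * \<phi> x \<partial>lebesgue_on \<Omega>)"
    by linarith
qed

section \<open>Approximation by test functions in the Sobolev norm\<close>

lemma norm_add_powr_le:
  fixes x y :: "'a::real_normed_vector"
  assumes "0 \<le> p"
  shows "norm (x + y) powr p \<le> 2 powr p * (norm x powr p + norm y powr p)"
proof -
  have "norm (x + y) powr p \<le> (2 * max (norm x) (norm y)) powr p"
    using assms norm_triangle_ineq[of x y] by (intro powr_mono2) auto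
  also have "\<dots> = 2 powr p * max (norm x) (norm y) powr p"
    by (simp add: powr_mult)
  also have "\<dots> \<le> 2 powr p * (norm x powr p + norm y powr p)"
    by (auto simp: max_def)
  finally show ?thesis .
qed

text \<open>The \<open>p\<close>-th power of the L^p distance. Without the root, the triangle
  inequality holds only up to the factor \<open>2 powr p\<close> from
  \<open>norm_add_powr_le\<close>, which is enough for convergence.\<close>

definition Lp_dist :: "'a::euclidean_space set \<Rightarrow> real \<Rightarrow> ('a \<Rightarrow> 'b::euclidean_space) \<Rightarrow> ('a \<Rightarrow> 'b) \<Rightarrow> real" where
  "Lp_dist \<Omega> p u v = (\<integral>x. norm (u x - v x) powr p \<partial>lebesgue_on \<Omega>)"

lemma Lp_dist_nonneg: "0 \<le> Lp_dist \<Omega> p u v"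
  by (simp add: Lp_dist_def)

lemma Lp_dist_commute: "Lp_dist \<Omega> p u v = Lp_dist \<Omega> p v u"
  by (simp add: Lp_dist_def norm_minus_commute)

text \<open>Carrying the gradient \<open>G\<close> along avoids the choice of a representative hidden in
  \<^const>\<open>weak_grad\<close>.\<close>

definition sobolev_pair :: "'a::euclidean_space set \<Rightarrow> real \<Rightarrow> ('a \<Rightarrow> real) \<Rightarrow> ('a \<Rightarrow> 'a) \<Rightarrow> bool" where
  "sobolev_pair \<Omega> p u G \<longleftrightarrow> Lp_on \<Omega> p u \<and> Lp_on \<Omega> p G \<and>
     (\<forall>e>0. \<exists>\<phi>\<in>test_functions \<Omega>. Lp_dist \<Omega> p \<phi> u < e \<and> Lp_dist \<Omega> p (grad \<phi>) G < e)"

locale sobolev_domain =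
  fixes \<Omega> :: "'a::euclidean_space set" and p :: real
  assumes p: "1 < p" and open_\<Omega>: "open \<Omega>" and finite_\<Omega>: "emeasure lebesgue \<Omega> < \<infinity>"
begin

abbreviation \<Lambda> :: "'a measure" where "\<Lambda> \<equiv> lebesgue_on \<Omega>"

abbreviation \<D> :: "('a \<Rightarrow> real) set" where "\<D> \<equiv> test_functions \<Omega>"

abbreviation Lp :: "('a \<Rightarrow> 'b::euclidean_space) \<Rightarrow> bool" where "Lp \<equiv> Lp_on \<Omega> p"

abbreviation dist_Lp :: "('a \<Rightarrow> 'b::euclidean_space) \<Rightarrow> ('a \<Rightarrow> 'b) \<Rightarrow> real" where "dist_Lp \<equiv> Lp_dist \<Omega> p"

abbreviation pair :: "('a \<Rightarrow> real) \<Rightarrow> ('a \<Rightarrow> 'a) \<Rightarrow> bool" where "pair \<equiv> sobolev_pair \<Omega> p"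

abbreviation energy :: "('a \<Rightarrow> 'b::euclidean_space) \<Rightarrow> real" where
  "energy F \<equiv> (\<integral>x. norm (F x) powr p \<partial>\<Lambda>)"

text \<open>The form \<open>plap_form\<close> written for explicit gradients;
  \<open>plap_form_eq\<close> connects the two.\<close>

abbreviation flux :: "('a \<Rightarrow> 'a) \<Rightarrow> ('a \<Rightarrow> 'a) \<Rightarrow> real" where
  "flux G H \<equiv> (\<integral>x. norm (G x) powr (p - 2) * (G x \<bullet> H x) \<partial>\<Lambda>)"

lemma \<Omega>_sets: "\<Omega> \<in> sets lebesgue"
  using open_\<Omega> by auto

sublocale finite_measure "lebesgue_on \<Omega>"
  using finite_\<Omega> \<Omega>_sets by (intro finite_measureI) (auto simp: emeasure_restrict_space)

section \<open>The space L^p over a set of finite measure\<close>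

lemma Lp_on_measurable: "Lp f \<Longrightarrow> f \<in> borel_measurable \<Lambda>"
  by (simp add: Lp_on_def)

lemma Lp_on_bound:
  assumes g: "Lp g" and f: "f \<in> borel_measurable \<Lambda>"
    and le: "AE x in \<Lambda>. norm (f x) \<le> C * norm (g x)"
  shows "Lp f"
  unfolding Lp_on_def
proof
  show "integrable \<Lambda> (\<lambda>x. norm (f x) powr p)"
  proof (rule Bochner_Integration.integrable_bound)
    show "integrable \<Lambda> (\<lambda>x. \<bar>C\<bar> powr p * norm (g x) powr p)"
      using g by (simp add: Lp_on_def)
    show "(\<lambda>x. norm (f x) powr p) \<in> borel_measurable \<Lambda>"
      using f by measurable
    show "AE x in \<Lambda>. norm (norm (f x) powr p) \<le> norm (\<bar>C\<bar> powr p * norm (g x) powr p)"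
      using le
    proof eventually_elim
      case (elim x)
      have "C * norm (g x) \<le> \<bar>C\<bar> * norm (g x)"
        by (intro mult_right_mono) auto
      then have "norm (f x) powr p \<le> (\<bar>C\<bar> * norm (g x)) powr p"
        using elim p by (intro powr_mono2) auto
      then show ?case by (simp add: powr_mult)
    qed
  qed
qed (rule f)

lemma Lp_on_const: "Lp (\<lambda>x. c)"
  by (simp add: Lp_on_def)

lemma Lp_on_bounded:
  assumes "f \<in> borel_measurable \<Lambda>" "\<And>x. norm (f x) \<le> C"
  shows "Lp f"
  by (rule Lp_on_bound[OF Lp_on_const[of "1::real"] assms(1), of C]) (use assms(2) in auto)

lemma Lp_on_add:
  assumes f: "Lp f" and g: "Lp g"
  shows "Lp (\<lambda>x. f x + g x)"
  unfolding Lp_on_def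
proof
  show m: "(\<lambda>x. f x + g x) \<in> borel_measurable \<Lambda>"
    using f g by (auto simp: Lp_on_def)
  show "integrable \<Lambda> (\<lambda>x. norm (f x + g x) powr p)"
  proof (rule Bochner_Integration.integrable_bound)
    show "integrable \<Lambda> (\<lambda>x. 2 powr p * (norm (f x) powr p + norm (g x) powr p))"
      using f g by (auto simp: Lp_on_def)
    show "(\<lambda>x. norm (f x + g x) powr p) \<in> borel_measurable \<Lambda>"
      using m by measurable
  qed (use p norm_add_powr_le[of p] in \<open>auto intro!: AE_I2 simp: abs_of_nonneg\<close>)
qed

lemma Lp_on_scaleR: "Lp f \<Longrightarrow> Lp (\<lambda>x. c *\<^sub>R f x)"
  by (rule Lp_on_bound[of f _ "\<bar>c\<bar>"]) (auto simp: Lp_on_def)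

lemma Lp_on_diff: "Lp f \<Longrightarrow> Lp g \<Longrightarrow> Lp (\<lambda>x. f x - g x)"
  using Lp_on_add[OF _ Lp_on_scaleR[of g "-1"], of f] by simp

lemma Lp_on_norm: "Lp f \<Longrightarrow> Lp (\<lambda>x. norm (f x))"
  by (auto simp: Lp_on_def)

lemma Lp_on_integrable_powr: "Lp f \<Longrightarrow> integrable \<Lambda> (\<lambda>x. norm (f x) powr p)"
  by (simp add: Lp_on_def)

text \<open>The bound \<open>norm y \<le> 1 + norm y powr p\<close> suffices because constants are
  integrable over a set of finite measure.\<close>

lemma Lp_on_integrable:
  assumes "Lp f" shows "integrable \<Lambda> f"
proof (rule Bochner_Integration.integrable_bound)
  show "integrable \<Lambda> (\<lambda>x. 1 + norm (f x) powr p)"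
    using assms by (auto simp: Lp_on_def)
  have "norm y \<le> 1 + norm y powr p" for y :: 'b
  proof (cases "norm y \<le> 1")
    case True
    then show ?thesis by (simp add: add_increasing2)
  next
    case False
    then show ?thesis using p powr_mono[of 1 p "norm y"] by simp
  qed
  then show "AE x in \<Lambda>. norm (f x) \<le> norm (1 + norm (f x) powr p)"
    by (intro AE_I2) (simp add: abs_of_nonneg add_nonneg_nonneg)
qed (use assms in \<open>simp add: Lp_on_def\<close>)

lemma integrable_Lp_dist:
  "Lp f \<Longrightarrow> Lp g \<Longrightarrow> integrable \<Lambda> (\<lambda>x. norm (f x - g x) powr p)"
  using Lp_on_diff[of f g] by (simp add: Lp_on_def)

lemma Lp_dist_triangle:
  assumes "Lp f" "Lp g" "Lp h"
  shows "dist_Lp f h \<le> 2 powr p * (dist_Lp f g + dist_Lp g h)"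
proof -
  have "dist_Lp f h \<le> (\<integral>x. 2 powr p * (norm (f x - g x) powr p + norm (g x - h x) powr p) \<partial>\<Lambda>)"
    unfolding Lp_dist_def
  proof (rule integral_mono)
    show "norm (f x - h x) powr p \<le> 2 powr p * (norm (f x - g x) powr p + norm (g x - h x) powr p)" for x
      using norm_add_powr_le[of p "f x - g x" "g x - h x"] p by simp
  qed (use assms in \<open>auto intro!: integrable_Lp_dist\<close>)
  also have "\<dots> = 2 powr p * (dist_Lp f g + dist_Lp g h)"
    unfolding Lp_dist_def using assms by (simp add: integrable_Lp_dist)
  finally show ?thesis .
qed

lemma Lp_dist_bound:
  assumes "Lp f" "Lp g" "f' \<in> borel_measurable \<Lambda>" "g' \<in> borel_measurable \<Lambda>"
    and "0 \<le> C" and le: "\<And>x. norm (f' x - g' x) \<le> C * norm (f x - g x)"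
  shows "dist_Lp f' g' \<le> C powr p * dist_Lp f g"
proof -
  have fg: "Lp (\<lambda>x. f x - g x)"
    using assms by (intro Lp_on_diff)
  have fg': "Lp (\<lambda>x. f' x - g' x)"
    using assms by (intro Lp_on_bound[OF fg, of _ C]) auto
  have "dist_Lp f' g' \<le> (\<integral>x. C powr p * norm (f x - g x) powr p \<partial>\<Lambda>)"
    unfolding Lp_dist_def
  proof (rule integral_mono)
    show "norm (f' x - g' x) powr p \<le> C powr p * norm (f x - g x) powr p" for x
      using le[of x] p \<open>0 \<le> C\<close> powr_mono2[of p "norm (f' x - g' x)" "C * norm (f x - g x)"]
      by (simp add: powr_mult)
  qed (use fg fg' in \<open>auto simp: Lp_on_def\<close>)
  then show ?thesis by (simp add: Lp_dist_def)
qed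

lemma Lp_dist_dominated:
  assumes "\<And>n. f n \<in> borel_measurable \<Lambda>" "h \<in> borel_measurable \<Lambda>"
    and g: "Lp g"
    and lim: "AE x in \<Lambda>. (\<lambda>n. f n x) \<longlonglongrightarrow> h x"
    and le: "\<And>n. AE x in \<Lambda>. norm (f n x - h x) \<le> C * norm (g x)"
  shows "(\<lambda>n. dist_Lp (f n) h) \<longlonglongrightarrow> 0"
proof -
  have "(\<lambda>n. \<integral>x. norm (f n x - h x) powr p \<partial>\<Lambda>) \<longlonglongrightarrow> (\<integral>x. 0 \<partial>\<Lambda>)"
  proof (rule integral_dominated_convergence)
    show "integrable \<Lambda> (\<lambda>x. norm (C *\<^sub>R g x) powr p)"
      using Lp_on_scaleR[OF g, of C] by (simp add: Lp_on_def)
    show "(\<lambda>x. norm (f n x - h x) powr p) \<in> borel_measurable \<Lambda>" for n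
      using assms(1,2) by measurable
    show "AE x in \<Lambda>. (\<lambda>n. norm (f n x - h x) powr p) \<longlonglongrightarrow> 0"
      using lim
    proof eventually_elim
      case (elim x)
      then have "(\<lambda>n. norm (f n x - h x)) \<longlonglongrightarrow> 0"
        by (simp add: tendsto_norm_zero_iff LIM_zero_iff)
      then have "(\<lambda>n. norm (f n x - h x) powr p) \<longlonglongrightarrow> 0 powr p"
        using p by (intro tendsto_powr') auto
      then show ?case by simp
    qed
    show "AE x in \<Lambda>. norm (norm (f n x - h x) powr p) \<le> norm (C *\<^sub>R g x) powr p" for n
      using le[of n]
    proof eventually_elim
      case (elim x)
      have "C * norm (g x) \<le> norm (C *\<^sub>R g x)"
        by (simp add: mult_right_mono)
      then have "norm (f n x - h x) \<le> norm (C *\<^sub>R g x)"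
        using elim by linarith
      then show ?case using p by (auto intro!: powr_mono2)
    qed
  qed simp
  then show ?thesis by (simp add: Lp_dist_def)
qed

text \<open>A split at the height \<open>d\<close>: a value of norm at most \<open>d\<close> is
  bounded by \<open>d\<close>, a larger one by \<open>d powr (1 - p)\<close> times its
  \<open>p\<close>-th power. The free parameter \<open>d\<close> later makes the first term
  small.\<close>

lemma L1_dist_le:
  assumes "Lp f" "Lp g" "d > 0"
  shows "(\<integral>x. norm (f x - g x) \<partial>\<Lambda>)
    \<le> d * measure \<Lambda> \<Omega> + d powr (1 - p) * dist_Lp f g"
proof -
  have i: "integrable \<Lambda> (\<lambda>x. norm (f x - g x))"
    using Lp_on_integrable[OF Lp_on_diff[OF assms(1,2)]] by simp
  have "norm y \<le> d + d powr (1 - p) * norm y powr p" for y :: 'b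
  proof (cases "norm y \<le> d")
    case True
    then show ?thesis by (simp add: add_increasing2)
  next
    case False
    then have "1 \<le> (norm y / d) powr (p - 1)"
      using p \<open>d > 0\<close> by (intro ge_one_powr_ge_zero) auto
    also have "(norm y / d) powr (p - 1) = d powr (1 - p) * norm y powr (p - 1)"
      using False \<open>d > 0\<close> by (simp add: powr_divide powr_diff field_simps)
    finally have "norm y * 1 \<le> norm y * (d powr (1 - p) * norm y powr (p - 1))"
      by (intro mult_left_mono) auto
    also have "norm y * norm y powr (p - 1) = norm y powr p"
      using False \<open>d > 0\<close> by (simp add: powr_diff)
    then have "norm y * (d powr (1 - p) * norm y powr (p - 1)) = d powr (1 - p) * norm y powr p"
      by (simp add: mult.left_commute)
    finally show ?thesis using \<open>d > 0\<close> by simp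
  qed
  then have "(\<integral>x. norm (f x - g x) \<partial>\<Lambda>) \<le> (\<integral>x. d + d powr (1 - p) * norm (f x - g x) powr p \<partial>\<Lambda>)"
    using assms i by (intro integral_mono Bochner_Integration.integrable_add integrable_mult_right integrable_Lp_dist) auto
  also have "\<dots> = d * measure \<Lambda> \<Omega> + d powr (1 - p) * dist_Lp f g"
    unfolding Lp_dist_def using assms by (simp add: integrable_Lp_dist space_restrict_space mult.commute)
  finally show ?thesis .
qed

lemma L1_dist_small:
  assumes "e > 0"
  obtains d where "d > 0" "\<And>f g :: 'a \<Rightarrow> 'b::euclidean_space. Lp f \<Longrightarrow> Lp g \<Longrightarrow> dist_Lp f g < d
    \<Longrightarrow> (\<integral>x. norm (f x - g x) \<partial>\<Lambda>) < e"
proof -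
  define m where "m = measure \<Lambda> \<Omega>"
  have m: "m \<ge> 0" by (simp add: m_def)
  \<comment> \<open>The height \<open>c\<close> keeps the first term of \<open>L1_dist_le\<close>
    below \<open>e / 2\<close>, the summand 1 preventing a division by zero; \<open>d\<close> then
    does the same for the second term.\<close>
  define c where "c = e / (2 * (m + 1))"
  have c: "c > 0" using assms m by (simp add: c_def)
  have cm: "c * m \<le> e / 2"
    using assms m by (simp add: c_def field_simps)
  define d where "d = e / (2 * c powr (1 - p))"
  have d: "d > 0" "c powr (1 - p) * d = e / 2"
    using assms c by (auto simp: d_def)
  show ?thesis
  proof (rule that[OF d(1)])
    fix f g :: "'a \<Rightarrow> 'b" assume fg: "Lp f" "Lp g" "dist_Lp f g < d"
    have "c powr (1 - p) * dist_Lp f g < e / 2"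
      unfolding d(2)[symmetric] using fg(3) c by (intro mult_strict_left_mono) auto
    then show "(\<integral>x. norm (f x - g x) \<partial>\<Lambda>) < e"
      using L1_dist_le[OF fg(1,2) c] cm by (simp add: m_def)
  qed
qed

section \<open>Sobolev pairs as limits of test functions\<close>

lemma Lp_on_test_function:
  assumes "\<phi> \<in> \<D>" shows "Lp \<phi>" "Lp (grad \<phi>)"
  using grad_test_function(3)[OF assms] test_functions_measurable[OF assms]
  by (auto intro!: Lp_on_bounded)

lemma sobolev_pair_Lp:
  assumes "pair u G" shows "Lp u" "Lp G"
  using assms by (auto simp: sobolev_pair_def)

lemma sobolev_pair_test_function:
  "\<phi> \<in> \<D> \<Longrightarrow> pair \<phi> (grad \<phi>)"
  unfolding sobolev_pair_def by (auto simp: Lp_on_test_function Lp_dist_def intro!: bexI[of _ \<phi>])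

text \<open>A diagonal argument: limits of limits of test functions are limits of test functions.
  Products, compositions and positive parts are all reached by approximating and then using this
  closedness.\<close>

lemma sobolev_pair_closed:
  assumes u: "Lp u" and G: "Lp G"
    and lim: "\<And>e. e > 0 \<Longrightarrow> \<exists>w H. pair w H \<and> dist_Lp w u < e \<and> dist_Lp H G < e"
  shows "pair u G"
  unfolding sobolev_pair_def
proof (intro conjI allI impI u G)
  fix e :: real assume "e > 0"
  define d where "d = e / (2 * 2 powr p)"
  have d: "d > 0" "2 powr p * (d + d) = e"
    using \<open>e > 0\<close> by (auto simp: d_def)
  obtain w H where w: "pair w H" "dist_Lp w u < d" "dist_Lp H G < d"
    using lim[OF d(1)] by blast
  obtain \<phi> where \<phi>: "\<phi> \<in> \<D>" "dist_Lp \<phi> w < d" "dist_Lp (grad \<phi>) H < d"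
    using w(1) d(1) unfolding sobolev_pair_def by blast
  have "dist_Lp \<phi> u \<le> 2 powr p * (dist_Lp \<phi> w + dist_Lp w u)"
    using sobolev_pair_Lp[OF w(1)] u Lp_on_test_function[OF \<phi>(1)] by (intro Lp_dist_triangle)
  also have "\<dots> < 2 powr p * (d + d)"
    using \<phi> w by (intro mult_strict_left_mono) auto
  finally have 1: "dist_Lp \<phi> u < e" using d by simp
  have "dist_Lp (grad \<phi>) G \<le> 2 powr p * (dist_Lp (grad \<phi>) H + dist_Lp H G)"
    using sobolev_pair_Lp[OF w(1)] G Lp_on_test_function[OF \<phi>(1)] by (intro Lp_dist_triangle)
  also have "\<dots> < 2 powr p * (d + d)"
    using \<phi> w by (intro mult_strict_left_mono) auto
  finally have "dist_Lp (grad \<phi>) G < e" using d by simp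
  with 1 \<phi> show "\<exists>\<phi>\<in>\<D>. dist_Lp \<phi> u < e \<and> dist_Lp (grad \<phi>) G < e"
    by blast
qed

lemma sobolev_pair_tendsto:
  assumes u: "Lp u" and G: "Lp G"
    and pair: "\<And>n::nat. pair (w n) (H n)"
    and "(\<lambda>n. dist_Lp (w n) u) \<longlonglongrightarrow> 0" "(\<lambda>n. dist_Lp (H n) G) \<longlonglongrightarrow> 0"
  shows "pair u G"
proof (rule sobolev_pair_closed[OF u G])
  fix e :: real assume "e > 0"
  then have "\<forall>\<^sub>F n in sequentially. dist_Lp (w n) u < e \<and> dist_Lp (H n) G < e"
    using assms(4,5) by (intro eventually_conj order_tendstoD(2)) auto
  then obtain n where "dist_Lp (w n) u < e \<and> dist_Lp (H n) G < e"
    by (auto dest: eventually_happens)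
  with pair[of n] show "\<exists>w H. pair w H \<and> dist_Lp w u < e \<and> dist_Lp H G < e"
    by blast
qed

lemma sobolev_pair_cong_AE:
  assumes "pair u G"
    and "w \<in> borel_measurable \<Lambda>" "H \<in> borel_measurable \<Lambda>"
    and "AE x in \<Lambda>. u x = w x" "AE x in \<Lambda>. G x = H x"
  shows "pair w H"
proof (rule sobolev_pair_closed)
  note L = sobolev_pair_Lp[OF assms(1)]
  show "Lp w"
    using assms by (intro Lp_on_bound[OF L(1), of _ 1]) auto
  show "Lp H"
    using assms by (intro Lp_on_bound[OF L(2), of _ 1]) auto
  have "dist_Lp u w = 0" "dist_Lp G H = 0"
    unfolding Lp_dist_def using assms by (auto intro!: integral_eq_zero_AE)
  then show "\<exists>u G. pair u G \<and> dist_Lp u w < e \<and> dist_Lp G H < e" if "e > 0" for e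
    using assms(1) that by metis
qed

lemma sobolev_pair_cmult:
  assumes "pair u G"
  shows "pair (\<lambda>x. c * u x) (\<lambda>x. c *\<^sub>R G x)"
  unfolding sobolev_pair_def
proof (intro conjI allI impI)
  note L = sobolev_pair_Lp[OF assms]
  show L': "Lp (\<lambda>x. c * u x)" "Lp (\<lambda>x. c *\<^sub>R G x)"
    using Lp_on_scaleR[OF L(1)] Lp_on_scaleR[OF L(2)] by simp_all
  fix e :: real assume e: "e > 0"
  \<comment> \<open>The summand 1 keeps \<open>C\<close> positive for \<open>c = 0\<close>, so that
    \<open>e / C\<close> is meaningful.\<close>
  define C where "C = (\<bar>c\<bar> + 1) powr p"
  have C: "C > 0" by (simp add: C_def)
  then obtain \<phi> where \<phi>: "\<phi> \<in> \<D>" "dist_Lp \<phi> u < e / C" "dist_Lp (grad \<phi>) G < e / C"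
    using assms e unfolding sobolev_pair_def by (meson divide_pos_pos)
  have g: "grad (\<lambda>x. c * \<phi> x) = (\<lambda>x. c *\<^sub>R grad \<phi> x)"
    using \<phi> by (auto simp: grad_cmult_test)
  note L\<phi> = Lp_on_test_function[OF \<phi>(1)] Lp_on_test_function[OF test_functions_cmult[OF \<phi>(1), of c]]
  have "dist_Lp (\<lambda>x. c * \<phi> x) (\<lambda>x. c * u x) \<le> C * dist_Lp \<phi> u"
    unfolding C_def using L L' L\<phi>
    by (intro Lp_dist_bound) (auto simp: Lp_on_measurable abs_mult right_diff_distrib[symmetric] intro!: mult_right_mono)
  also have "\<dots> < e" using \<phi> C by (simp add: field_simps)
  finally have 1: "dist_Lp (\<lambda>x. c * \<phi> x) (\<lambda>x. c * u x) < e" .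
  have "dist_Lp (\<lambda>x. c *\<^sub>R grad \<phi> x) (\<lambda>x. c *\<^sub>R G x) \<le> C * dist_Lp (grad \<phi>) G"
    unfolding C_def using L L' L\<phi>
    by (intro Lp_dist_bound) (auto simp: Lp_on_measurable g[symmetric], auto simp: g scaleR_diff_right[symmetric] intro!: mult_right_mono)
  also have "\<dots> < e" using \<phi> C by (simp add: field_simps)
  finally show "\<exists>\<phi>\<in>\<D>. dist_Lp \<phi> (\<lambda>x. c * u x) < e \<and> dist_Lp (grad \<phi>) (\<lambda>x. c *\<^sub>R G x) < e"
    using 1 \<phi>(1) by (intro bexI[of _ "\<lambda>x. c * \<phi> x"]) (auto simp: g test_functions_cmult)
qed

lemma Lp_dist_add:
  assumes "Lp f" "Lp g" "Lp f'" "Lp g'"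
  shows "dist_Lp (\<lambda>x. f x + g x) (\<lambda>x. f' x + g' x) \<le> 2 powr p * (dist_Lp f f' + dist_Lp g g')"
proof -
  have "dist_Lp (\<lambda>x. f x + g x) (\<lambda>x. f' x + g' x)
      \<le> 2 powr p * (dist_Lp (\<lambda>x. f x + g x) (\<lambda>x. f' x + g x) + dist_Lp (\<lambda>x. f' x + g x) (\<lambda>x. f' x + g' x))"
    using assms by (intro Lp_dist_triangle Lp_on_add)
  then show ?thesis by (simp add: Lp_dist_def)
qed

lemma sobolev_pair_add:
  assumes "pair u G" "pair w H"
  shows "pair (\<lambda>x. u x + w x) (\<lambda>x. G x + H x)"
  unfolding sobolev_pair_def
proof (intro conjI allI impI)
  note L = sobolev_pair_Lp[OF assms(1)] sobolev_pair_Lp[OF assms(2)]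
  show L': "Lp (\<lambda>x. u x + w x)" "Lp (\<lambda>x. G x + H x)"
    using L by (auto intro!: Lp_on_add)
  fix e :: real assume "e > 0"
  define d where "d = e / (2 * 2 powr p)"
  have d: "d > 0" "2 powr p * (d + d) = e"
    using \<open>e > 0\<close> by (auto simp: d_def)
  obtain \<phi> where \<phi>: "\<phi> \<in> \<D>" "dist_Lp \<phi> u < d" "dist_Lp (grad \<phi>) G < d"
    using assms(1) d(1) unfolding sobolev_pair_def by blast
  obtain \<psi> where \<psi>: "\<psi> \<in> \<D>" "dist_Lp \<psi> w < d" "dist_Lp (grad \<psi>) H < d"
    using assms(2) d(1) unfolding sobolev_pair_def by blast
  have g: "grad (\<lambda>x. \<phi> x + \<psi> x) = (\<lambda>x. grad \<phi> x + grad \<psi> x)"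
    using \<phi> \<psi> by (auto simp: grad_add_test)
  have "dist_Lp (\<lambda>x. \<phi> x + \<psi> x) (\<lambda>x. u x + w x) \<le> 2 powr p * (dist_Lp \<phi> u + dist_Lp \<psi> w)"
    using L Lp_on_test_function[OF \<phi>(1)] Lp_on_test_function[OF \<psi>(1)] by (intro Lp_dist_add)
  also have "\<dots> < 2 powr p * (d + d)"
    using \<phi> \<psi> by (intro mult_strict_left_mono) auto
  finally have 1: "dist_Lp (\<lambda>x. \<phi> x + \<psi> x) (\<lambda>x. u x + w x) < e" using d by simp
  have "dist_Lp (\<lambda>x. grad \<phi> x + grad \<psi> x) (\<lambda>x. G x + H x) \<le> 2 powr p * (dist_Lp (grad \<phi>) G + dist_Lp (grad \<psi>) H)"
    using L Lp_on_test_function[OF \<phi>(1)] Lp_on_test_function[OF \<psi>(1)] by (intro Lp_dist_add)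
  also have "\<dots> < 2 powr p * (d + d)"
    using \<phi> \<psi> by (intro mult_strict_left_mono) auto
  finally show "\<exists>\<phi>\<in>\<D>. dist_Lp \<phi> (\<lambda>x. u x + w x) < e \<and> dist_Lp (grad \<phi>) (\<lambda>x. G x + H x) < e"
    using 1 d \<phi>(1) \<psi>(1) by (intro bexI[of _ "\<lambda>x. \<phi> x + \<psi> x"]) (auto simp: g test_functions_add)
qed

text \<open>Convergence in the mean of the \<open>p\<close>-th powers gives a subsequence converging
  a.e. The pointwise limit is what lets the chain rule pass to the limit in
  \<open>F' (u x)\<close>.\<close>

lemma sobolev_pair_sequence:
  assumes "pair u G"
  obtains \<phi> where "\<And>n::nat. \<phi> n \<in> \<D>"
    "(\<lambda>n. dist_Lp (\<phi> n) u) \<longlonglongrightarrow> 0" "(\<lambda>n. dist_Lp (grad (\<phi> n)) G) \<longlonglongrightarrow> 0"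
    "AE x in \<Lambda>. (\<lambda>n. \<phi> n x) \<longlonglongrightarrow> u x"
proof -
  note L = sobolev_pair_Lp[OF assms]
  have "\<exists>\<phi>. \<phi> \<in> \<D> \<and> dist_Lp \<phi> u < 1 / real (Suc n) \<and> dist_Lp (grad \<phi>) G < 1 / real (Suc n)" for n
    using assms[unfolded sobolev_pair_def] by (metis divide_pos_pos of_nat_0_less_iff zero_less_Suc zero_less_one)
  then obtain \<psi> where \<psi>: "\<And>n. \<psi> n \<in> \<D>" "\<And>n. dist_Lp (\<psi> n) u < 1 / real (Suc n)"
    "\<And>n. dist_Lp (grad (\<psi> n)) G < 1 / real (Suc n)"
    by metis
  have lim0: "(\<lambda>n. 1 / real (Suc n)) \<longlonglongrightarrow> 0"
    by (rule LIMSEQ_Suc[OF lim_1_over_n])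
  have c1: "(\<lambda>n. dist_Lp (\<psi> n) u) \<longlonglongrightarrow> 0"
    by (rule tendsto_sandwich[OF _ _ tendsto_const lim0])
       (use less_imp_le[OF \<psi>(2)] Lp_dist_nonneg in \<open>auto intro!: always_eventually simp del: of_nat_Suc\<close>)
  have c2: "(\<lambda>n. dist_Lp (grad (\<psi> n)) G) \<longlonglongrightarrow> 0"
    by (rule tendsto_sandwich[OF _ _ tendsto_const lim0])
       (use less_imp_le[OF \<psi>(3)] Lp_dist_nonneg in \<open>auto intro!: always_eventually simp del: of_nat_Suc\<close>)
  have "\<exists>r::nat\<Rightarrow>nat. strict_mono r \<and> (AE x in \<Lambda>. (\<lambda>n. norm (\<psi> (r n) x - u x) powr p) \<longlonglongrightarrow> 0)"
    using c1 integrable_Lp_dist[OF Lp_on_test_function(1)[OF \<psi>(1)] L(1)] unfolding Lp_dist_def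
    by (intro tendsto_L1_AE_subseq) auto
  then obtain r :: "nat \<Rightarrow> nat" where r: "strict_mono r" "AE x in \<Lambda>. (\<lambda>n. norm (\<psi> (r n) x - u x) powr p) \<longlonglongrightarrow> 0"
    by blast
  show ?thesis
  proof (rule that[of "\<psi> \<circ> r"])
    show "(\<lambda>n. dist_Lp ((\<psi> \<circ> r) n) u) \<longlonglongrightarrow> 0"
      using LIMSEQ_subseq_LIMSEQ[OF c1 r(1)] by (simp add: o_def)
    show "(\<lambda>n. dist_Lp (grad ((\<psi> \<circ> r) n)) G) \<longlonglongrightarrow> 0"
      using LIMSEQ_subseq_LIMSEQ[OF c2 r(1)] by (simp add: o_def)
    show "AE x in \<Lambda>. (\<lambda>n. (\<psi> \<circ> r) n x) \<longlonglongrightarrow> u x"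
      using r(2)
    proof eventually_elim
      case (elim x)
      then have "(\<lambda>n. (norm (\<psi> (r n) x - u x) powr p) powr (1 / p)) \<longlonglongrightarrow> 0 powr (1 / p)"
        using p by (intro tendsto_powr') auto
      then have "(\<lambda>n. \<bar>\<psi> (r n) x - u x\<bar>) \<longlonglongrightarrow> 0"
        using p by (simp add: powr_powr)
      then show ?case
        by (simp add: tendsto_rabs_zero_iff LIM_zero_iff)
    qed
  qed (use \<psi> in auto)
qed

section \<open>Weak gradients of Sobolev pairs\<close>

lemma integrable_loc_integrable:
  assumes "integrable \<Lambda> f" shows "loc_integrable_on f \<Omega>"
  unfolding loc_integrable_on_def
proof (intro allI impI)
  fix K assume K: "compact K \<and> K \<subseteq> \<Omega>"
  have "set_integrable lebesgue \<Omega> f"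
    using assms \<Omega>_sets by (simp add: set_integrable_def integrable_restrict_space)
  then show "f absolutely_integrable_on K"
    by (rule set_integrable_subset) (use K in \<open>auto simp: lmeasurable_compact fmeasurableD\<close>)
qed

text \<open>The defect \<open>I\<close> in the integration by parts formula is 0 for test functions.
  For a pair it is at most \<open>M\<close> times the L^1 distances of \<open>u\<close> and
  \<open>G\<close> to an approximating test function and its gradient, and these can be made
  arbitrarily small because L^p closeness implies L^1 closeness here.\<close>

lemma sobolev_pair_has_weak_gradient:
  assumes "pair u G"
  shows "has_weak_gradient \<Omega> u G"
  unfolding has_weak_gradient_def
proof (intro conjI ballI)
  note L = sobolev_pair_Lp[OF assms]
  note iu = Lp_on_integrable[OF L(1)] and iG = Lp_on_integrable[OF L(2)]
  show lu: "loc_integrable_on u \<Omega>" and lG: "loc_integrable_on G \<Omega>"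
    using iu iG by (auto intro: integrable_loc_integrable)
  fix \<psi> :: "'a \<Rightarrow> real" and b :: 'a assume \<psi>: "\<psi> \<in> \<D>" and b: "b \<in> Basis"
  have p\<psi>: "partial_deriv b \<psi> \<in> \<D>" by (rule partial_deriv_test_function[OF \<psi> b])
  have lGb: "loc_integrable_on (\<lambda>x. G x \<bullet> b) \<Omega>"
    using iG by (intro integrable_loc_integrable) auto
  obtain M where M: "M > 0" "\<And>x. \<bar>\<psi> x\<bar> \<le> M" "\<And>x. \<bar>partial_deriv b \<psi> x\<bar> \<le> M"
  proof -
    obtain M where "M > 0" "\<And>x. \<bar>\<psi> x\<bar> \<le> M" "\<And>x. norm (grad \<psi> x) \<le> M"
      using grad_test_function(3)[OF \<psi>] by blast
    moreover have "\<bar>partial_deriv b \<psi> x\<bar> \<le> norm (grad \<psi> x)" for x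
      using Basis_le_norm[OF b, of "grad \<psi> x"] b by (simp add: grad_inner)
    ultimately show ?thesis using that by (meson order_trans)
  qed
  define I where "I = (\<integral>x. u x * partial_deriv b \<psi> x \<partial>\<Lambda>) + (\<integral>x. (G x \<bullet> b) * \<psi> x \<partial>\<Lambda>)"
  have "\<bar>I\<bar> \<le> e" if "e > 0" for e
  proof -
    define e' where "e' = e / (2 * M)"
    have e': "e' > 0" "M * (e' + e') = e" using that M(1) by (auto simp: e'_def)
    obtain d1 where d1: "d1 > 0" "\<And>f g :: 'a \<Rightarrow> real. Lp f \<Longrightarrow> Lp g \<Longrightarrow> dist_Lp f g < d1
        \<Longrightarrow> (\<integral>x. norm (f x - g x) \<partial>\<Lambda>) < e'"
      by (rule L1_dist_small[OF e'(1), where 'b=real]) blast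
    obtain d2 where d2: "d2 > 0" "\<And>f g :: 'a \<Rightarrow> 'a. Lp f \<Longrightarrow> Lp g \<Longrightarrow> dist_Lp f g < d2
        \<Longrightarrow> (\<integral>x. norm (f x - g x) \<partial>\<Lambda>) < e'"
      by (rule L1_dist_small[OF e'(1), where 'b='a]) blast
    obtain \<phi> where \<phi>: "\<phi> \<in> \<D>" "dist_Lp \<phi> u < min d1 d2" "dist_Lp (grad \<phi>) G < min d1 d2"
      using assms d1(1) d2(1) unfolding sobolev_pair_def by (metis min_less_iff_conj)
    note L\<phi> = Lp_on_test_function[OF \<phi>(1)]
    note i\<phi> = L\<phi>[THEN Lp_on_integrable]
    have wg: "(\<integral>x. \<phi> x * partial_deriv b \<psi> x \<partial>\<Lambda>) = - (\<integral>x. (grad \<phi> x \<bullet> b) * \<psi> x \<partial>\<Lambda>)"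
      using has_weak_gradient_test_function[OF open_\<Omega> \<phi>(1)] \<psi> b by (simp add: has_weak_gradient_def)
    note j = loc_integrable_bounded_mult[OF open_\<Omega> lu p\<psi>] loc_integrable_bounded_mult[OF open_\<Omega> lGb \<psi>]
      loc_integrable_bounded_mult[OF open_\<Omega> integrable_loc_integrable[OF i\<phi>(1)] p\<psi>]
      loc_integrable_bounded_mult[OF open_\<Omega> integrable_loc_integrable[OF integrable_inner_left[OF i\<phi>(2), of b]] \<psi>]
    have I: "I = (\<integral>x. (u x - \<phi> x) * partial_deriv b \<psi> x \<partial>\<Lambda>) + (\<integral>x. ((G x - grad \<phi> x) \<bullet> b) * \<psi> x \<partial>\<Lambda>)"
      unfolding I_def using wg j by (simp add: left_diff_distrib inner_diff_left)
    have "\<bar>I\<bar> \<le> \<bar>\<integral>x. (u x - \<phi> x) * partial_deriv b \<psi> x \<partial>\<Lambda>\<bar> + \<bar>\<integral>x. ((G x - grad \<phi> x) \<bullet> b) * \<psi> x \<partial>\<Lambda>\<bar>"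
      unfolding I by (rule abs_triangle_ineq)
    also have "\<dots> \<le> M * (\<integral>x. norm (\<phi> x - u x) \<partial>\<Lambda>) + M * (\<integral>x. norm (grad \<phi> x - G x) \<partial>\<Lambda>)"
    proof (rule add_mono)
      have "norm (\<integral>x. (u x - \<phi> x) * partial_deriv b \<psi> x \<partial>\<Lambda>) \<le> (\<integral>x. M * norm (\<phi> x - u x) \<partial>\<Lambda>)"
      proof (rule Bochner_Integration.integral_norm_bound_integral)
        show "norm ((u x - \<phi> x) * partial_deriv b \<psi> x) \<le> M * norm (\<phi> x - u x)" for x
          using mult_mono[OF M(3)[of x] order_refl, of "\<bar>\<phi> x - u x\<bar>"] M(1)
          by (simp add: abs_mult mult.commute abs_minus_commute)
      qed (use iu i\<phi> j in \<open>auto simp: left_diff_distrib\<close>)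
      then show "\<bar>\<integral>x. (u x - \<phi> x) * partial_deriv b \<psi> x \<partial>\<Lambda>\<bar> \<le> M * (\<integral>x. norm (\<phi> x - u x) \<partial>\<Lambda>)"
        by simp
      have "norm (\<integral>x. ((G x - grad \<phi> x) \<bullet> b) * \<psi> x \<partial>\<Lambda>) \<le> (\<integral>x. M * norm (grad \<phi> x - G x) \<partial>\<Lambda>)"
      proof (rule Bochner_Integration.integral_norm_bound_integral)
        show "norm (((G x - grad \<phi> x) \<bullet> b) * \<psi> x) \<le> M * norm (grad \<phi> x - G x)" for x
          using mult_mono[OF M(2)[of x] Basis_le_norm[OF b, of "G x - grad \<phi> x"]] M(1)
          by (simp add: abs_mult mult.commute norm_minus_commute)
      qed (use iG i\<phi> j in \<open>auto simp: left_diff_distrib inner_diff_left\<close>)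
      then show "\<bar>\<integral>x. ((G x - grad \<phi> x) \<bullet> b) * \<psi> x \<partial>\<Lambda>\<bar> \<le> M * (\<integral>x. norm (grad \<phi> x - G x) \<partial>\<Lambda>)"
        by simp
    qed
    also have "\<dots> \<le> M * e' + M * e'"
      using d1(2)[OF L\<phi>(1) L(1)] d2(2)[OF L\<phi>(2) L(2)] \<phi>(2,3) M(1)
      by (intro add_mono mult_left_mono) auto
    also have "\<dots> = e" using e'(2) by (simp add: distrib_left)
    finally show ?thesis .
  qed
  then have "\<bar>I\<bar> \<le> 0" by (rule field_le_epsilon) simp
  then show "(\<integral>x. u x * partial_deriv b \<psi> x \<partial>\<Lambda>) = - (\<integral>x. (G x \<bullet> b) * \<psi> x \<partial>\<Lambda>)"
    by (simp add: I_def)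
qed

lemma has_weak_gradient_diff:
  assumes u: "has_weak_gradient \<Omega> u G" and w: "has_weak_gradient \<Omega> w H"
  shows "has_weak_gradient \<Omega> (\<lambda>x. u x - w x) (\<lambda>x. G x - H x)"
  unfolding has_weak_gradient_def
proof (intro conjI ballI)
  have l: "loc_integrable_on u \<Omega>" "loc_integrable_on w \<Omega>" "loc_integrable_on G \<Omega>" "loc_integrable_on H \<Omega>"
    using u w by (auto simp: has_weak_gradient_def)
  then show "loc_integrable_on (\<lambda>x. u x - w x) \<Omega>" "loc_integrable_on (\<lambda>x. G x - H x) \<Omega>"
    unfolding loc_integrable_on_def by (auto intro!: set_integral_diff(1))
  fix \<psi> :: "'a \<Rightarrow> real" and b :: 'a assume \<psi>: "\<psi> \<in> \<D>" and b: "b \<in> Basis"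
  have lb: "loc_integrable_on (\<lambda>x. F x \<bullet> b) \<Omega>" if "loc_integrable_on F \<Omega>" for F :: "'a \<Rightarrow> 'a"
    using that unfolding loc_integrable_on_def by (auto intro!: absolutely_integrable_component)
  note j = loc_integrable_bounded_mult[OF open_\<Omega> l(1) partial_deriv_test_function[OF \<psi> b]]
    loc_integrable_bounded_mult[OF open_\<Omega> l(2) partial_deriv_test_function[OF \<psi> b]]
    loc_integrable_bounded_mult[OF open_\<Omega> lb[OF l(3)] \<psi>] loc_integrable_bounded_mult[OF open_\<Omega> lb[OF l(4)] \<psi>]
  have "(\<integral>x. u x * partial_deriv b \<psi> x \<partial>\<Lambda>) = - (\<integral>x. (G x \<bullet> b) * \<psi> x \<partial>\<Lambda>)"
    "(\<integral>x. w x * partial_deriv b \<psi> x \<partial>\<Lambda>) = - (\<integral>x. (H x \<bullet> b) * \<psi> x \<partial>\<Lambda>)"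
    using u w \<psi> b by (auto simp: has_weak_gradient_def)
  then show "(\<integral>x. (u x - w x) * partial_deriv b \<psi> x \<partial>\<Lambda>) = - (\<integral>x. ((G x - H x) \<bullet> b) * \<psi> x \<partial>\<Lambda>)"
    using j by (simp add: left_diff_distrib inner_diff_left)
qed

lemma weak_grad_AE:
  assumes "has_weak_gradient \<Omega> u G"
  shows "AE x in \<Lambda>. weak_grad \<Omega> u x = G x"
proof -
  have "has_weak_gradient \<Omega> u (weak_grad \<Omega> u)"
    unfolding weak_grad_def using someI[of "has_weak_gradient \<Omega> u", OF assms] .
  then show ?thesis
    using weak_gradient_unique[OF open_\<Omega> _ assms] by auto
qed

text \<open>Rests on the completeness of Lebesgue measure. It supplies the measurability of the
  representative selected by \<open>weak_grad\<close>.\<close>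

lemma borel_measurable_cong_AE:
  fixes f g :: "'a \<Rightarrow> 'b::euclidean_space"
  assumes f: "f \<in> borel_measurable \<Lambda>" and "AE x in \<Lambda>. f x = g x"
  shows "g \<in> borel_measurable \<Lambda>"
proof -
  have "AE x in lebesgue. x \<in> \<Omega> \<longrightarrow> f x = g x"
    using assms(2) \<Omega>_sets by (simp add: AE_restrict_space_iff)
  then have "AE x in lebesgue. (if x \<in> \<Omega> then f x else 0) = (if x \<in> \<Omega> then g x else 0)"
    by eventually_elim auto
  moreover have "(\<lambda>x. if x \<in> \<Omega> then f x else 0) \<in> borel_measurable lebesgue"
    using f \<Omega>_sets by (simp add: borel_measurable_if)
  ultimately have "(\<lambda>x. if x \<in> \<Omega> then g x else 0) \<in> borel_measurable lebesgue"
    by (rule borel_measurable_AE[rotated])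
  then show ?thesis
    using \<Omega>_sets by (simp add: borel_measurable_if)
qed

lemma weak_grad_measurable:
  assumes "has_weak_gradient \<Omega> u G" "Lp G"
  shows "weak_grad \<Omega> u \<in> borel_measurable \<Lambda>"
  using weak_grad_AE[OF assms(1)] Lp_on_measurable[OF assms(2)]
  by (auto intro!: borel_measurable_cong_AE[of G])

lemma weak_grad_integral:
  assumes "has_weak_gradient \<Omega> u G" "Lp G"
  shows "(\<integral>x. norm (weak_grad \<Omega> u x) powr p \<partial>\<Lambda>) = energy G"
proof (rule integral_cong_AE)
  have [measurable]: "G \<in> borel_measurable \<Lambda>" "weak_grad \<Omega> u \<in> borel_measurable \<Lambda>"
    using Lp_on_measurable[OF assms(2)] weak_grad_measurable[OF assms] .
  show "(\<lambda>x. norm (weak_grad \<Omega> u x) powr p) \<in> borel_measurable \<Lambda>"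
    "(\<lambda>x. norm (G x) powr p) \<in> borel_measurable \<Lambda>"
    by measurable
qed (use weak_grad_AE[OF assms(1)] in auto)

lemma W1p_norm_diff:
  assumes "Lp u" "Lp G" "has_weak_gradient \<Omega> u G" "\<phi> \<in> \<D>"
  shows "W1p_norm \<Omega> p (\<lambda>x. \<phi> x - u x) = (dist_Lp \<phi> u + dist_Lp (grad \<phi>) G) powr (1 / p)"
proof -
  have "has_weak_gradient \<Omega> (\<lambda>x. \<phi> x - u x) (\<lambda>x. grad \<phi> x - G x)"
    using assms by (intro has_weak_gradient_diff has_weak_gradient_test_function open_\<Omega>)
  moreover have "Lp (\<lambda>x. grad \<phi> x - G x)"
    using assms by (intro Lp_on_diff Lp_on_test_function)
  ultimately show ?thesis
    unfolding W1p_norm_def by (simp add: weak_grad_integral Lp_dist_def)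
qed

text \<open>The bridge between the given definition and the working one: the Sobolev norm of
  \<open>\<phi> n - u\<close> is the \<open>p\<close>-th root of the sum of the two
  \<open>Lp_dist\<close> terms, so both notions of convergence coincide.\<close>

lemma W01p_iff: "u \<in> W01p \<Omega> p \<longleftrightarrow> (\<exists>G. pair u G)"
proof
  assume "u \<in> W01p \<Omega> p"
  then obtain G \<phi> where u: "Lp u" "has_weak_gradient \<Omega> u G" "Lp G"
    and \<phi>: "\<And>n. \<phi> n \<in> \<D>" "(\<lambda>n::nat. W1p_norm \<Omega> p (\<lambda>x. \<phi> n x - u x)) \<longlonglongrightarrow> 0"
    by (auto simp: W01p_def W1p_def)
  have "(\<lambda>n. (W1p_norm \<Omega> p (\<lambda>x. \<phi> n x - u x)) powr p) \<longlonglongrightarrow> 0 powr p"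
    using \<phi>(2) p by (intro tendsto_powr') (auto simp: W1p_norm_def)
  then have lim: "(\<lambda>n. dist_Lp (\<phi> n) u + dist_Lp (grad (\<phi> n)) G) \<longlonglongrightarrow> 0"
    using p u \<phi>(1) by (simp add: W1p_norm_diff powr_powr Lp_dist_nonneg)
  have "pair u G"
  proof (rule sobolev_pair_tendsto[OF u(1,3) sobolev_pair_test_function[OF \<phi>(1)]])
    show "(\<lambda>n. dist_Lp (\<phi> n) u) \<longlonglongrightarrow> 0"
      by (rule tendsto_sandwich[OF _ _ tendsto_const lim]) (simp_all add: Lp_dist_nonneg)
    show "(\<lambda>n. dist_Lp (grad (\<phi> n)) G) \<longlonglongrightarrow> 0"
      by (rule tendsto_sandwich[OF _ _ tendsto_const lim]) (simp_all add: Lp_dist_nonneg)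
  qed
  then show "\<exists>G. pair u G" by blast
next
  assume "\<exists>G. pair u G"
  then obtain G where u: "pair u G" by blast
  note L = sobolev_pair_Lp[OF u]
  note wg = sobolev_pair_has_weak_gradient[OF u]
  obtain \<phi> where \<phi>: "\<And>n::nat. \<phi> n \<in> \<D>"
    "(\<lambda>n. dist_Lp (\<phi> n) u) \<longlonglongrightarrow> 0" "(\<lambda>n. dist_Lp (grad (\<phi> n)) G) \<longlonglongrightarrow> 0"
    using sobolev_pair_sequence[OF u] by blast
  have "(\<lambda>n. (dist_Lp (\<phi> n) u + dist_Lp (grad (\<phi> n)) G) powr (1 / p)) \<longlonglongrightarrow> 0 powr (1 / p)"
    using tendsto_add[OF \<phi>(2,3)] p by (intro tendsto_powr') (auto simp: Lp_dist_nonneg)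
  then have "(\<lambda>n. W1p_norm \<Omega> p (\<lambda>x. \<phi> n x - u x)) \<longlonglongrightarrow> 0"
    using L wg \<phi>(1) by (simp add: W1p_norm_diff)
  then show "u \<in> W01p \<Omega> p"
    using L wg \<phi>(1) by (auto simp: W01p_def W1p_def)
qed

lemma sobolev_pair_unique:
  assumes "pair u G" "pair w H" "AE x in \<Lambda>. u x = w x"
  shows "AE x in \<Lambda>. G x = H x"
  using assms by (blast intro: weak_gradient_unique open_\<Omega> sobolev_pair_has_weak_gradient)

section \<open>Products and the chain rule\<close>


lemma Lp_dist_tendsto_bound:
  assumes "\<And>n. Lp (f n)" "Lp g"
    and "\<And>n. f' n \<in> borel_measurable \<Lambda>" "\<And>n. g' n \<in> borel_measurable \<Lambda>"
    and "0 \<le> C" "\<And>n x. norm (f' n x - g' n x) \<le> C * norm (f n x - g x)"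
    and lim: "(\<lambda>n. dist_Lp (f n) g) \<longlonglongrightarrow> 0"
  shows "(\<lambda>n. dist_Lp (f' n) (g' n)) \<longlonglongrightarrow> 0"
proof (rule tendsto_sandwich[OF _ _ tendsto_const])
  show "(\<lambda>n. C powr p * dist_Lp (f n) g) \<longlonglongrightarrow> 0"
    using tendsto_mult_right_zero[OF lim] .
  show "\<forall>\<^sub>F n in sequentially. dist_Lp (f' n) (g' n) \<le> C powr p * dist_Lp (f n) g"
    using assms by (intro always_eventually allI Lp_dist_bound)
qed (simp add: Lp_dist_nonneg)

lemma Lp_dist_tendsto_trans:
  assumes "\<And>n. Lp (f n)" "\<And>n. Lp (g n)" "Lp h"
    and "(\<lambda>n. dist_Lp (f n) (g n)) \<longlonglongrightarrow> 0" "(\<lambda>n. dist_Lp (g n) h) \<longlonglongrightarrow> 0"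
  shows "(\<lambda>n. dist_Lp (f n) h) \<longlonglongrightarrow> 0"
proof (rule tendsto_sandwich[OF _ _ tendsto_const])
  show "(\<lambda>n. 2 powr p * (dist_Lp (f n) (g n) + dist_Lp (g n) h)) \<longlonglongrightarrow> 0"
    using tendsto_mult_right_zero[OF tendsto_add_zero[OF assms(4,5)]] .
  show "\<forall>\<^sub>F n in sequentially. dist_Lp (f n) h \<le> 2 powr p * (dist_Lp (f n) (g n) + dist_Lp (g n) h)"
    using assms by (intro always_eventually allI Lp_dist_triangle)
qed (simp add: Lp_dist_nonneg)

lemma Lp_dist_tendsto_add:
  assumes "\<And>n. Lp (f n)" "\<And>n. Lp (g n)" "Lp f'" "Lp g'"
    and "(\<lambda>n. dist_Lp (f n) f') \<longlonglongrightarrow> 0" "(\<lambda>n. dist_Lp (g n) g') \<longlonglongrightarrow> 0"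
  shows "(\<lambda>n. dist_Lp (\<lambda>x. f n x + g n x) (\<lambda>x. f' x + g' x)) \<longlonglongrightarrow> 0"
proof (rule tendsto_sandwich[OF _ _ tendsto_const])
  show "(\<lambda>n. 2 powr p * (dist_Lp (f n) f' + dist_Lp (g n) g')) \<longlonglongrightarrow> 0"
    using tendsto_mult_right_zero[OF tendsto_add_zero[OF assms(5,6)]] .
  show "\<forall>\<^sub>F n in sequentially. dist_Lp (\<lambda>x. f n x + g n x) (\<lambda>x. f' x + g' x)
      \<le> 2 powr p * (dist_Lp (f n) f' + dist_Lp (g n) g')"
    using assms by (intro always_eventually allI Lp_dist_add)
qed (simp add: Lp_dist_nonneg)

text \<open>The closure of the test functions in the C^1 supremum norm. It admits functions such as
  \<open>\<bar>\<phi> x\<bar> powr p\<close>, which need not be smooth, and its members are bounded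
  together with their gradients, so they may multiply Sobolev pairs.\<close>

definition C1_limit :: "('a \<Rightarrow> real) \<Rightarrow> ('a \<Rightarrow> 'a) \<Rightarrow> bool" where
  "C1_limit a a' \<longleftrightarrow> a \<in> borel_measurable \<Lambda> \<and> a' \<in> borel_measurable \<Lambda> \<and>
    (\<forall>e>0. \<exists>\<phi>\<in>\<D>. \<forall>x. \<bar>\<phi> x - a x\<bar> \<le> e \<and> norm (grad \<phi> x - a' x) \<le> e)"

lemma C1_limit_sequence:
  assumes "C1_limit a a'"
  obtains \<phi> where "\<And>n::nat. \<phi> n \<in> \<D>"
    "\<And>n x. \<bar>\<phi> n x - a x\<bar> \<le> 1 / real (Suc n)" "\<And>n x. norm (grad (\<phi> n) x - a' x) \<le> 1 / real (Suc n)"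
proof -
  have "\<exists>\<phi>. \<phi> \<in> \<D> \<and> (\<forall>x. \<bar>\<phi> x - a x\<bar> \<le> 1 / real (Suc n) \<and> norm (grad \<phi> x - a' x) \<le> 1 / real (Suc n))" for n
    using assms unfolding C1_limit_def by (meson divide_pos_pos of_nat_0_less_iff zero_less_Suc zero_less_one)
  then obtain \<phi> where "\<And>n. \<phi> n \<in> \<D> \<and> (\<forall>x. \<bar>\<phi> n x - a x\<bar> \<le> 1 / real (Suc n) \<and> norm (grad (\<phi> n) x - a' x) \<le> 1 / real (Suc n))"
    by metis
  then show ?thesis by (intro that[of \<phi>]) auto
qed

lemma tendsto_of_le_inverse_Suc:
  fixes f :: "nat \<Rightarrow> 'b::real_normed_vector"
  assumes "\<And>n. norm (f n - l) \<le> 1 / real (Suc n)"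
  shows "f \<longlonglongrightarrow> l"
proof -
  have "(\<lambda>n. norm (f n - l)) \<longlonglongrightarrow> 0"
    by (rule tendsto_sandwich[OF _ _ tendsto_const LIMSEQ_Suc[OF lim_1_over_n]])
       (use assms in \<open>auto intro!: always_eventually simp del: of_nat_Suc\<close>)
  then show ?thesis by (simp add: tendsto_norm_zero_iff LIM_zero_iff)
qed

lemma one_over_Suc_le_1: "1 / real (Suc n) \<le> 1"
  by simp

lemma C1_limit_sobolev_pair:
  assumes "C1_limit a a'"
  shows "pair a a'"
proof -
  obtain \<phi> where \<phi>: "\<And>n::nat. \<phi> n \<in> \<D>"
    "\<And>n x. \<bar>\<phi> n x - a x\<bar> \<le> 1 / real (Suc n)" "\<And>n x. norm (grad (\<phi> n) x - a' x) \<le> 1 / real (Suc n)"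
    using assms by (rule C1_limit_sequence) blast
  have m: "a \<in> borel_measurable \<Lambda>" "a' \<in> borel_measurable \<Lambda>"
    using assms by (auto simp: C1_limit_def)
  obtain M where M: "\<And>x. \<bar>\<phi> 0 x\<bar> \<le> M" "\<And>x. norm (grad (\<phi> 0) x) \<le> M"
    using grad_test_function(3)[OF \<phi>(1)[of 0]] by blast
  have b: "norm (a x) \<le> M + 1" for x
    using \<phi>(2)[of 0 x] M(1)[of x] by simp
  have b': "norm (a' x) \<le> M + 1" for x
    using \<phi>(3)[of 0 x] M(2)[of x] norm_triangle_ineq2[of "a' x" "grad (\<phi> 0) x"] by (simp add: norm_minus_commute)
  show ?thesis
  proof (rule sobolev_pair_tendsto[OF _ _ sobolev_pair_test_function[OF \<phi>(1)]])
    show "Lp a" using m(1) b by (rule Lp_on_bounded)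
    show "Lp a'" using m(2) b' by (rule Lp_on_bounded)
    show "(\<lambda>n. dist_Lp (\<phi> n) a) \<longlonglongrightarrow> 0"
    proof (rule Lp_dist_dominated[OF test_functions_measurable(1)[OF \<phi>(1)] m(1) Lp_on_const[of "1::real"], where C = 1])
      show "AE x in \<Lambda>. (\<lambda>n. \<phi> n x) \<longlonglongrightarrow> a x"
        using \<phi>(2) by (intro AE_I2 tendsto_of_le_inverse_Suc) simp
      show "AE x in \<Lambda>. norm (\<phi> n x - a x) \<le> 1 * norm (1::real)" for n
        using order_trans[OF \<phi>(2) one_over_Suc_le_1] by (intro AE_I2) simp
    qed
    show "(\<lambda>n. dist_Lp (grad (\<phi> n)) a') \<longlonglongrightarrow> 0"
    proof (rule Lp_dist_dominated[OF test_functions_measurable(2)[OF \<phi>(1)] m(2) Lp_on_const[of "1::real"], where C = 1])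
      show "AE x in \<Lambda>. (\<lambda>n. grad (\<phi> n) x) \<longlonglongrightarrow> a' x"
        using \<phi>(3) by (intro AE_I2 tendsto_of_le_inverse_Suc) simp
      show "AE x in \<Lambda>. norm (grad (\<phi> n) x - a' x) \<le> 1 * norm (1::real)" for n
        using order_trans[OF \<phi>(3) one_over_Suc_le_1] by (intro AE_I2) simp
    qed
  qed
qed

lemma sobolev_pair_mult_test_function:
  assumes \<phi>: "\<phi> \<in> \<D>" and u: "pair u G"
  shows "pair (\<lambda>x. \<phi> x * u x) (\<lambda>x. \<phi> x *\<^sub>R G x + u x *\<^sub>R grad \<phi> x)"
proof -
  note L = sobolev_pair_Lp[OF u]
  note m = L[THEN Lp_on_measurable] test_functions_measurable[OF \<phi>]
  obtain M where M: "M > 0" "\<And>x. \<bar>\<phi> x\<bar> \<le> M" "\<And>x. norm (grad \<phi> x) \<le> M"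
    using grad_test_function(3)[OF \<phi>] by blast
  have L1: "Lp (\<lambda>x. \<phi> x *\<^sub>R F x)" if "Lp F" for F :: "'a \<Rightarrow> 'b::euclidean_space"
    using that M m by (intro Lp_on_bound[OF that, of _ M])
      (auto intro!: AE_I2 mult_right_mono borel_measurable_scaleR simp: Lp_on_measurable)
  have L2: "Lp (\<lambda>x. w x *\<^sub>R grad \<phi> x)" if "Lp w" for w :: "'a \<Rightarrow> real"
    using that M m by (intro Lp_on_bound[OF that, of _ M])
      (auto intro!: AE_I2 mult_left_mono borel_measurable_scaleR simp: Lp_on_measurable mult.commute[of M])
  obtain \<xi> where \<xi>: "\<And>n::nat. \<xi> n \<in> \<D>"
    "(\<lambda>n. dist_Lp (\<xi> n) u) \<longlonglongrightarrow> 0" "(\<lambda>n. dist_Lp (grad (\<xi> n)) G) \<longlonglongrightarrow> 0"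
    using sobolev_pair_sequence[OF u] by blast
  note L\<xi> = Lp_on_test_function[OF \<xi>(1)]
  show ?thesis
  proof (rule sobolev_pair_tendsto)
    show "Lp (\<lambda>x. \<phi> x * u x)" using L1[OF L(1)] by simp
    show "Lp (\<lambda>x. \<phi> x *\<^sub>R G x + u x *\<^sub>R grad \<phi> x)"
      using L by (intro Lp_on_add L1 L2)
    show "pair (\<lambda>x. \<phi> x * \<xi> n x) (\<lambda>x. \<phi> x *\<^sub>R grad (\<xi> n) x + \<xi> n x *\<^sub>R grad \<phi> x)" for n
    proof -
      have "(\<lambda>x. \<phi> x * \<xi> n x) \<in> \<D>"
        using \<phi> \<xi>(1)[of n] by (auto intro!: test_functions_mult test_functions_Ck)
      moreover have "grad (\<lambda>x. \<phi> x * \<xi> n x) = (\<lambda>x. \<phi> x *\<^sub>R grad (\<xi> n) x + \<xi> n x *\<^sub>R grad \<phi> x)"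
        by (rule ext) (rule grad_mult_test[OF \<phi> \<xi>(1)])
      ultimately show ?thesis
        using sobolev_pair_test_function by metis
    qed
    show "(\<lambda>n. dist_Lp (\<lambda>x. \<phi> x * \<xi> n x) (\<lambda>x. \<phi> x * u x)) \<longlonglongrightarrow> 0"
      using L1[OF L\<xi>(1)] L1[OF L(1)] M
      by (intro Lp_dist_tendsto_bound[OF L\<xi>(1) L(1) _ _ _ _ \<xi>(2), where C = M])
         (auto simp: Lp_on_measurable abs_mult right_diff_distrib[symmetric] intro!: mult_right_mono)
    show "(\<lambda>n. dist_Lp (\<lambda>x. \<phi> x *\<^sub>R grad (\<xi> n) x + \<xi> n x *\<^sub>R grad \<phi> x) (\<lambda>x. \<phi> x *\<^sub>R G x + u x *\<^sub>R grad \<phi> x)) \<longlonglongrightarrow> 0"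
    proof (rule Lp_dist_tendsto_add)
      show "(\<lambda>n. dist_Lp (\<lambda>x. \<phi> x *\<^sub>R grad (\<xi> n) x) (\<lambda>x. \<phi> x *\<^sub>R G x)) \<longlonglongrightarrow> 0"
        using L1[OF L\<xi>(2)] L1[OF L(2)] M
        by (intro Lp_dist_tendsto_bound[OF L\<xi>(2) L(2) _ _ _ _ \<xi>(3), where C = M])
           (auto simp: Lp_on_measurable scaleR_diff_right[symmetric] intro!: mult_right_mono)
      show "(\<lambda>n. dist_Lp (\<lambda>x. \<xi> n x *\<^sub>R grad \<phi> x) (\<lambda>x. u x *\<^sub>R grad \<phi> x)) \<longlonglongrightarrow> 0"
        using L2[OF L\<xi>(1)] L2[OF L(1)] M
        by (intro Lp_dist_tendsto_bound[OF L\<xi>(1) L(1) _ _ _ _ \<xi>(2), where C = M])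
           (auto simp: Lp_on_measurable scaleR_diff_left[symmetric] mult.commute[of M] intro!: mult_left_mono)
    qed (use L L\<xi> L1 L2 in auto)
  qed
qed

text \<open>Multiply by the uniform approximants \<open>\<phi> n\<close> of \<open>a\<close>. The
  errors are at most 1, so \<open>u\<close> and \<open>norm (G x) + norm (u x)\<close> dominate the
  errors of the product and of its gradient.\<close>

lemma sobolev_pair_mult_C1_limit:
  assumes a: "C1_limit a a'" and u: "pair u G"
  shows "pair (\<lambda>x. a x * u x) (\<lambda>x. a x *\<^sub>R G x + u x *\<^sub>R a' x)"
proof -
  obtain \<phi> where \<phi>: "\<And>n::nat. \<phi> n \<in> \<D>"
    "\<And>n x. \<bar>\<phi> n x - a x\<bar> \<le> 1 / real (Suc n)" "\<And>n x. norm (grad (\<phi> n) x - a' x) \<le> 1 / real (Suc n)"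
    using a by (rule C1_limit_sequence) blast
  note L = sobolev_pair_Lp[OF u]
  note [measurable] = L[THEN Lp_on_measurable]
  have m[measurable]: "a \<in> borel_measurable \<Lambda>" "a' \<in> borel_measurable \<Lambda>"
    using a by (auto simp: C1_limit_def)
  have \<phi>m[measurable]: "\<phi> n \<in> borel_measurable \<Lambda>" "grad (\<phi> n) \<in> borel_measurable \<Lambda>" for n
    using test_functions_measurable[OF \<phi>(1)] by auto
  note l = order_trans[OF \<phi>(2) one_over_Suc_le_1] order_trans[OF \<phi>(3) one_over_Suc_le_1]
  have ta: "(\<lambda>n. \<phi> n x) \<longlonglongrightarrow> a x" for x
    using \<phi>(2) by (intro tendsto_of_le_inverse_Suc) simp
  have ta': "(\<lambda>n. grad (\<phi> n) x) \<longlonglongrightarrow> a' x" for x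
    using \<phi>(3) by (intro tendsto_of_le_inverse_Suc) simp
  have d1: "norm (\<phi> n x * u x - a x * u x) \<le> 1 * norm (u x)" for n x
    using mult_right_mono[OF l(1)[of n x], of "\<bar>u x\<bar>"] by (simp add: left_diff_distrib[symmetric] abs_mult)
  have Lg: "Lp (\<lambda>x. norm (G x) + norm (u x))"
    using L by (intro Lp_on_add Lp_on_norm)
  have d2: "norm ((\<phi> n x *\<^sub>R G x + u x *\<^sub>R grad (\<phi> n) x) - (a x *\<^sub>R G x + u x *\<^sub>R a' x)) \<le> 1 * norm (norm (G x) + norm (u x))" for n x
  proof -
    have "(\<phi> n x *\<^sub>R G x + u x *\<^sub>R grad (\<phi> n) x) - (a x *\<^sub>R G x + u x *\<^sub>R a' x)
        = (\<phi> n x - a x) *\<^sub>R G x + u x *\<^sub>R (grad (\<phi> n) x - a' x)"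
      by (simp add: algebra_simps)
    also have "norm \<dots> \<le> \<bar>\<phi> n x - a x\<bar> * norm (G x) + \<bar>u x\<bar> * norm (grad (\<phi> n) x - a' x)"
      by (metis norm_scaleR norm_triangle_ineq)
    also have "\<dots> \<le> 1 * norm (G x) + \<bar>u x\<bar> * 1"
      using l by (intro add_mono mult_right_mono mult_left_mono) auto
    finally show ?thesis by simp
  qed
  note pr = sobolev_pair_mult_test_function[OF \<phi>(1) u]
  show ?thesis
  proof (rule sobolev_pair_tendsto[OF _ _ pr])
    \<comment> \<open>The approximant with index 0 is within 1 of \<open>a\<close>, so this
      difference is bounded by \<open>u\<close>; integrability of \<open>a x * u x\<close> follows
      from that of \<open>\<phi> 0 x * u x\<close>.\<close>
    have "Lp (\<lambda>x. a x * u x - \<phi> 0 x * u x)"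
      by (rule Lp_on_bound[OF L(1), of _ 1]) (use d1[of 0] in \<open>auto simp: abs_minus_commute\<close>)
    from Lp_on_add[OF this sobolev_pair_Lp(1)[OF pr[of 0]]] show "Lp (\<lambda>x. a x * u x)" by simp
    have "Lp (\<lambda>x. (a x *\<^sub>R G x + u x *\<^sub>R a' x) - (\<phi> 0 x *\<^sub>R G x + u x *\<^sub>R grad (\<phi> 0) x))"
    proof (rule Lp_on_bound[OF Lg, of _ 1])
      show "AE x in \<Lambda>. norm ((a x *\<^sub>R G x + u x *\<^sub>R a' x) - (\<phi> 0 x *\<^sub>R G x + u x *\<^sub>R grad (\<phi> 0) x)) \<le> 1 * norm (norm (G x) + norm (u x))"
        using d2[of 0] by (subst norm_minus_commute) (rule AE_I2)
    qed measurable
    from Lp_on_add[OF this sobolev_pair_Lp(2)[OF pr[of 0]]] show "Lp (\<lambda>x. a x *\<^sub>R G x + u x *\<^sub>R a' x)" by simp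
    show "(\<lambda>n. dist_Lp (\<lambda>x. \<phi> n x * u x) (\<lambda>x. a x * u x)) \<longlonglongrightarrow> 0"
    proof (rule Lp_dist_dominated[OF _ _ L(1), where C = 1])
      show "AE x in \<Lambda>. (\<lambda>n. \<phi> n x * u x) \<longlonglongrightarrow> a x * u x"
        by (intro AE_I2 tendsto_intros ta)
    qed (use d1 in auto)
    show "(\<lambda>n. dist_Lp (\<lambda>x. \<phi> n x *\<^sub>R G x + u x *\<^sub>R grad (\<phi> n) x) (\<lambda>x. a x *\<^sub>R G x + u x *\<^sub>R a' x)) \<longlonglongrightarrow> 0"
    proof (rule Lp_dist_dominated[OF _ _ Lg, where C = 1])
      show "AE x in \<Lambda>. (\<lambda>n. \<phi> n x *\<^sub>R G x + u x *\<^sub>R grad (\<phi> n) x) \<longlonglongrightarrow> a x *\<^sub>R G x + u x *\<^sub>R a' x"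
        by (intro AE_I2 tendsto_intros ta ta')
      show "AE x in \<Lambda>. norm ((\<phi> n x *\<^sub>R G x + u x *\<^sub>R grad (\<phi> n) x) - (a x *\<^sub>R G x + u x *\<^sub>R a' x)) \<le> 1 * norm (norm (G x) + norm (u x))" for n
        by (rule AE_I2) (rule d2)
    qed measurable
  qed
qed

text \<open>Approximate \<open>F'\<close> uniformly by a polynomial: the compositions of \<open>\<phi>\<close> with its primitive are again
  test functions.\<close>

lemma C1_limit_compose:
  assumes \<phi>: "\<phi> \<in> \<D>"
    and F: "\<And>t. (F has_real_derivative F' t) (at t)" "continuous_on UNIV F'" "F 0 = 0"
  shows "C1_limit (\<lambda>x. F (\<phi> x)) (\<lambda>x. F' (\<phi> x) *\<^sub>R grad \<phi> x)"
  unfolding C1_limit_def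
proof (intro conjI allI impI)
  have "continuous_on UNIV F"
    using F(1) by (meson DERIV_isCont continuous_at_imp_continuous_on)
  then have [measurable]: "F \<in> borel_measurable borel" "F' \<in> borel_measurable borel"
    using F(2) by (auto intro: borel_measurable_continuous_onI)
  have [measurable]: "\<phi> \<in> borel_measurable \<Lambda>" "grad \<phi> \<in> borel_measurable \<Lambda>"
    using test_functions_measurable[OF \<phi>] by auto
  show "(\<lambda>x. F (\<phi> x)) \<in> borel_measurable \<Lambda>"
    "(\<lambda>x. F' (\<phi> x) *\<^sub>R grad \<phi> x) \<in> borel_measurable \<Lambda>"
    by measurable
  obtain M where M: "M > 0" "\<And>x. \<bar>\<phi> x\<bar> \<le> M" "\<And>x. norm (grad \<phi> x) \<le> M"
    using grad_test_function(3)[OF \<phi>] by blast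
  fix e :: real assume e: "e > 0"
  \<comment> \<open>Both errors come out as \<open>\<eta> * M\<close>: for the values by the mean
    value inequality between 0 and \<open>\<phi> x\<close>, for the gradients through the factor
    \<open>norm (grad \<phi> x) \<le> M\<close>.\<close>
  define \<eta> where "\<eta> = e / M"
  have \<eta>: "\<eta> > 0" "\<eta> * M = e" using e M(1) by (auto simp: \<eta>_def)
  obtain g where g: "real_polynomial_function g" "\<And>t. t \<in> {-M..M} \<Longrightarrow> \<bar>F' t - g t\<bar> < \<eta>"
    using Stone_Weierstrass_real_polynomial_function[of "{-M..M}" F' \<eta>] \<eta>(1) F(2)
    by (auto intro: continuous_on_subset)
  obtain a n where a: "g = (\<lambda>t. \<Sum>i\<le>n. a i * t ^ i)"
    using g(1) by (auto simp: real_polynomial_function_iff_sum)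
  \<comment> \<open>The primitive without constant term: the powers start at \<open>Suc i\<close>,
    so composing with \<open>\<phi>\<close> preserves the compact support.\<close>
  define P where "P t = (\<Sum>i\<le>n. a i / real (Suc i) * t ^ Suc i)" for t
  have P: "(P has_real_derivative g t) (at t)" for t
  proof -
    have "((\<lambda>t. a i / real (Suc i) * t ^ Suc i) has_real_derivative a i * t ^ i) (at t)" for i
      by (rule DERIV_cong[OF DERIV_cmult[OF DERIV_power[OF DERIV_ident]]]) (simp del: of_nat_Suc)
    then show ?thesis
      unfolding P_def a by (intro DERIV_sum) auto
  qed
  define \<psi> where "\<psi> x = P (\<phi> x)" for x
  have "\<psi> \<in> \<D>"
    unfolding \<psi>_def P_def by (intro test_functions_sum test_functions_cmult test_functions_power \<phi>)
  moreover have "\<bar>\<psi> x - F (\<phi> x)\<bar> \<le> e" for x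
  proof -
    have "norm ((P (\<phi> x) - F (\<phi> x)) - (P 0 - F 0)) \<le> \<eta> * norm (\<phi> x - 0)"
    proof (rule field_differentiable_bound[of "{-M..M}"])
      show "((\<lambda>t. P t - F t) has_real_derivative g t - F' t) (at t within {-M..M})" for t
        by (intro DERIV_diff has_field_derivative_at_within[OF P] has_field_derivative_at_within[OF F(1)])
      show "norm (g t - F' t) \<le> \<eta>" if "t \<in> {-M..M}" for t
        using g(2)[OF that] by (simp add: abs_minus_commute)
    qed (use M(1) M(2)[of x] in auto)
    also have "\<dots> \<le> \<eta> * M"
      using M(2)[of x] \<eta>(1) by simp
    finally show ?thesis
      using F(3) \<eta>(2) by (simp add: \<psi>_def P_def)
  qed
  moreover have "norm (grad \<psi> x - F' (\<phi> x) *\<^sub>R grad \<phi> x) \<le> e" for x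
  proof -
    have "grad \<psi> x = g (\<phi> x) *\<^sub>R grad \<phi> x"
      unfolding \<psi>_def using DERIV_compose_FDERIV[OF P test_functions_has_derivative[OF \<phi>]]
      by (intro grad_eqI) (simp add: mult.commute)
    then have "norm (grad \<psi> x - F' (\<phi> x) *\<^sub>R grad \<phi> x) = \<bar>g (\<phi> x) - F' (\<phi> x)\<bar> * norm (grad \<phi> x)"
      by (simp add: scaleR_diff_left[symmetric])
    also have "\<dots> \<le> \<eta> * M"
      using g(2)[of "\<phi> x"] M(2)[of x] M(3)[of x] \<eta>(1)
      by (intro mult_mono) (auto simp: abs_le_iff abs_minus_commute)
    finally show ?thesis using \<eta>(2) by simp
  qed
  ultimately show "\<exists>\<psi>\<in>\<D>. \<forall>x. \<bar>\<psi> x - F (\<phi> x)\<bar> \<le> e \<and> norm (grad \<psi> x - F' (\<phi> x) *\<^sub>R grad \<phi> x) \<le> e"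
    by blast
qed

text \<open>The gradient error splits in two: \<open>F' (\<phi> n x)\<close> times the gradient
  difference is controlled by \<open>L\<close>, while the change of \<open>F'\<close> along the
  sequence, multiplied by the fixed \<open>G\<close>, tends to 0 by dominated convergence, using
  a.e. convergence and continuity of \<open>F'\<close>.\<close>

lemma sobolev_pair_compose:
  assumes u: "pair u G"
    and F: "\<And>t. (F has_real_derivative F' t) (at t)" "continuous_on UNIV F'" "F 0 = 0"
    and L: "\<And>t. \<bar>F' t\<bar> \<le> L"
  shows "pair (\<lambda>x. F (u x)) (\<lambda>x. F' (u x) *\<^sub>R G x)"
proof -
  have "continuous_on UNIV F"
    using F(1) by (meson DERIV_isCont continuous_at_imp_continuous_on)
  then have Fm[measurable]: "F \<in> borel_measurable borel" "F' \<in> borel_measurable borel"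
    using F(2) by (auto intro: borel_measurable_continuous_onI)
  note Lp = sobolev_pair_Lp[OF u]
  note [measurable] = Lp[THEN Lp_on_measurable]
  have L0: "0 \<le> L" using L[of 0] by linarith
  have lip: "norm (F s - F t) \<le> L * norm (s - t)" for s t
    by (rule field_differentiable_bound[of UNIV F F']) (use F(1) L in auto)
  obtain \<phi> where \<phi>: "\<And>n::nat. \<phi> n \<in> \<D>"
    "(\<lambda>n. dist_Lp (\<phi> n) u) \<longlonglongrightarrow> 0" "(\<lambda>n. dist_Lp (grad (\<phi> n)) G) \<longlonglongrightarrow> 0"
    "AE x in \<Lambda>. (\<lambda>n. \<phi> n x) \<longlonglongrightarrow> u x"
    using u by (rule sobolev_pair_sequence) blast
  note L\<phi> = Lp_on_test_function[OF \<phi>(1)]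
  note [measurable] = L\<phi>[THEN Lp_on_measurable]
  note pr = C1_limit_sobolev_pair[OF C1_limit_compose[OF \<phi>(1) F]]
  have LF: "Lp (\<lambda>x. F' (w x) *\<^sub>R H x)" if "Lp H" "w \<in> borel_measurable \<Lambda>" for w :: "'a \<Rightarrow> real" and H :: "'a \<Rightarrow> 'a"
    by (rule Lp_on_bound[OF that(1), of _ L])
       (use that L Lp_on_measurable[OF that(1)] in \<open>auto intro!: AE_I2 mult_right_mono borel_measurable_scaleR measurable_compose[OF _ Fm(2)]\<close>)
  show ?thesis
  proof (rule sobolev_pair_tendsto[OF _ _ pr])
    show "Lp (\<lambda>x. F (u x))"
      using lip[of _ 0] F(3) by (intro Lp_on_bound[OF Lp(1), of _ L]) auto
    show LG: "Lp (\<lambda>x. F' (u x) *\<^sub>R G x)"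
      using Lp by (intro LF) auto
    show "(\<lambda>n. dist_Lp (\<lambda>x. F (\<phi> n x)) (\<lambda>x. F (u x))) \<longlonglongrightarrow> 0"
      by (rule Lp_dist_tendsto_bound[OF L\<phi>(1) Lp(1) _ _ L0 _ \<phi>(2)]) (use lip in auto)
    show "(\<lambda>n. dist_Lp (\<lambda>x. F' (\<phi> n x) *\<^sub>R grad (\<phi> n) x) (\<lambda>x. F' (u x) *\<^sub>R G x)) \<longlonglongrightarrow> 0"
    proof (rule Lp_dist_tendsto_trans)
      show "(\<lambda>n. dist_Lp (\<lambda>x. F' (\<phi> n x) *\<^sub>R grad (\<phi> n) x) (\<lambda>x. F' (\<phi> n x) *\<^sub>R G x)) \<longlonglongrightarrow> 0"
        by (rule Lp_dist_tendsto_bound[OF L\<phi>(2) Lp(2) _ _ L0 _ \<phi>(3)])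
           (auto simp: scaleR_diff_right[symmetric] intro!: mult_right_mono L)
      show "(\<lambda>n. dist_Lp (\<lambda>x. F' (\<phi> n x) *\<^sub>R G x) (\<lambda>x. F' (u x) *\<^sub>R G x)) \<longlonglongrightarrow> 0"
      proof (rule Lp_dist_dominated[OF _ _ Lp(2), where C = "2 * L"])
        show "AE x in \<Lambda>. (\<lambda>n. F' (\<phi> n x) *\<^sub>R G x) \<longlonglongrightarrow> F' (u x) *\<^sub>R G x"
          using \<phi>(4)
        proof eventually_elim
          case (elim x)
          have "isCont F' (u x)" using F(2) by (simp add: continuous_on_eq_continuous_at)
          from isCont_tendsto_compose[OF this elim] show ?case by (intro tendsto_intros)
        qed
        show "AE x in \<Lambda>. norm (F' (\<phi> n x) *\<^sub>R G x - F' (u x) *\<^sub>R G x) \<le> 2 * L * norm (G x)" for n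
        proof (rule AE_I2)
          fix x
          have "\<bar>F' (\<phi> n x) - F' (u x)\<bar> \<le> 2 * L"
            using L[of "\<phi> n x"] L[of "u x"] by linarith
          then show "norm (F' (\<phi> n x) *\<^sub>R G x - F' (u x) *\<^sub>R G x) \<le> 2 * L * norm (G x)"
            by (simp add: scaleR_diff_left[symmetric] mult_right_mono)
        qed
      qed measurable
    qed (use Lp L\<phi> LG in \<open>auto intro!: LF Lp_on_measurable[OF L\<phi>(1)]\<close>)
  qed
qed

end

text \<open>Prepares the chain rule for functions such as \<open>ln (1 + t / \<epsilon>)\<close>,
  which are well behaved only for \<open>t \<ge> 0\<close>: continuing along the tangent at 0 gives
  a C^1 function on the whole line, if \<open>F'\<close> is continuous, with the same bound on the
  derivative.\<close>

lemma DERIV_extend_linear: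
  fixes F F' :: "real \<Rightarrow> real"
  assumes "\<And>t. 0 \<le> t \<Longrightarrow> (F has_real_derivative F' t) (at t)"
  shows "((\<lambda>t. F (max 0 t) + F' 0 * min 0 t) has_real_derivative F' (max 0 t)) (at t)"
proof -
  let ?E = "\<lambda>t. F (max 0 t) + F' 0 * min 0 t"
  consider "t > 0" | "t < 0" | "t = 0" by linarith
  then show ?thesis
  proof cases
    case 1
    then have "\<forall>\<^sub>F s in nhds t. ?E s = F s"
      using eventually_nhds_in_open[of "{0<..}" t] by (auto elim!: eventually_mono)
    then show ?thesis
      using 1 assms[of t] by (subst DERIV_cong_ev[OF refl _ refl]) auto
  next
    case 2
    then have "\<forall>\<^sub>F s in nhds t. ?E s = F 0 + F' 0 * s"
      using eventually_nhds_in_open[of "{..<0}" t] by (auto elim!: eventually_mono)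
    then show ?thesis
      using 2 by (subst DERIV_cong_ev[OF refl _ refl]) (auto intro!: derivative_eq_intros)
  next
    case 3
    have "((\<lambda>h. (F (0 + h) - F 0) / h) \<longlongrightarrow> F' 0) (at 0)"
      using assms[of 0] by (simp add: DERIV_def)
    then have "((\<lambda>h. (F (0 + h) - F 0) / h) \<longlongrightarrow> F' 0) (at_right 0)"
      by (simp add: filterlim_at_split)
    then have "((\<lambda>h. (?E (0 + h) - ?E 0) / h) \<longlongrightarrow> F' 0) (at_right 0)"
      by (rule Lim_transform_eventually) (auto intro!: eventually_at_rightI[of 0 1])
    moreover have "((\<lambda>h. (?E (0 + h) - ?E 0) / h) \<longlongrightarrow> F' 0) (at_left 0)"
      by (rule Lim_transform_eventually[of "\<lambda>_. F' 0"]) (auto intro!: eventually_at_leftI[of "-1" 0])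
    ultimately show ?thesis
      using 3 by (simp add: DERIV_def filterlim_split_at)
  qed
qed

context sobolev_domain
begin

lemma sobolev_pair_compose_nonneg:
  assumes u: "pair u G"
    and F: "\<And>t. 0 \<le> t \<Longrightarrow> (F has_real_derivative F' t) (at t)" "continuous_on {0..} F'" "F 0 = 0"
    and L: "\<And>t. 0 \<le> t \<Longrightarrow> \<bar>F' t\<bar> \<le> L"
  shows "pair (\<lambda>x. F (max 0 (u x)) + F' 0 * min 0 (u x)) (\<lambda>x. F' (max 0 (u x)) *\<^sub>R G x)"
proof (rule sobolev_pair_compose[OF u DERIV_extend_linear[OF F(1)]])
  show "continuous_on UNIV (\<lambda>t. F' (max 0 t))"
    by (rule continuous_on_compose2[OF F(2)]) (auto intro!: continuous_intros)
  show "\<bar>F' (max 0 t)\<bar> \<le> L" for t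
    using L by simp
qed (use F(3) in auto)

text \<open>Approximate by \<open>sqrt (t\<^sup>2 + \<delta>\<^sup>2) - \<delta>\<close> for
  \<open>t \<ge> 0\<close>. Its slope at 0 is 0, so the tangent continuation vanishes for negative
  arguments. As \<open>\<delta>\<close> tends to 0, the slope tends to 1 for \<open>t > 0\<close>
  and stays 0 at 0, which selects the gradient of the positive part.\<close>

lemma sobolev_pair_pos_part:
  assumes u: "pair u G"
  shows "pair (pos_part u) (\<lambda>x. if 0 < u x then G x else 0)"
proof -
  define \<delta> where "\<delta> n = 1 / real (Suc n)" for n
  have \<delta>: "\<delta> n > 0" for n by (simp add: \<delta>_def)
  have \<delta>0: "\<delta> \<longlonglongrightarrow> 0" unfolding \<delta>_def by (rule LIMSEQ_Suc[OF lim_1_over_n])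
  define F where "F n t = sqrt (t\<^sup>2 + (\<delta> n)\<^sup>2) - \<delta> n" for n t
  define F' where "F' n t = t / sqrt (t\<^sup>2 + (\<delta> n)\<^sup>2)" for n t
  have pos: "0 < t\<^sup>2 + (\<delta> n)\<^sup>2" for t n
    using \<delta>[of n] by (intro add_nonneg_pos) auto
  have F'1: "\<bar>F' n t\<bar> \<le> 1" for n t
    using pos[of t n] real_sqrt_le_mono[of "t\<^sup>2" "t\<^sup>2 + (\<delta> n)\<^sup>2"] by (simp add: F'_def field_simps)
  have d: "(F n has_real_derivative F' n t) (at t)" for n t
    unfolding F_def F'_def using pos[of t n]
    by (auto intro!: derivative_eq_intros simp: field_simps)
  have c: "continuous_on {0..} (F' n)" for n
    unfolding F'_def using \<delta>[of n] by (intro continuous_intros) (auto simp: sum_power2_eq_zero_iff)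
  have F0: "F n 0 = 0" "F' n 0 = 0" for n
    using \<delta>[of n] by (auto simp: F_def F'_def)
  have Fb: "0 \<le> F n t" "F n t \<le> t" if "t \<ge> 0" for n t
  proof -
    have "\<delta> n \<le> sqrt (t\<^sup>2 + (\<delta> n)\<^sup>2)"
      using \<delta>[of n] by (intro real_le_rsqrt) auto
    then show "0 \<le> F n t" by (simp add: F_def)
    have "sqrt (t\<^sup>2 + (\<delta> n)\<^sup>2) \<le> t + \<delta> n"
      using that \<delta>[of n] by (intro real_le_lsqrt) (auto simp: power2_sum)
    then show "F n t \<le> t" by (simp add: F_def)
  qed
  have Flim: "(\<lambda>n. F n t) \<longlonglongrightarrow> t" if "t \<ge> 0" for t
  proof -
    have "(\<lambda>n. F n t) \<longlonglongrightarrow> sqrt (t\<^sup>2 + 0\<^sup>2) - 0"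
      unfolding F_def by (intro tendsto_intros \<delta>0)
    then show ?thesis using that by simp
  qed
  have F'lim: "(\<lambda>n. F' n t) \<longlonglongrightarrow> 1" if "t > 0" for t
  proof -
    have "(\<lambda>n. F' n t) \<longlonglongrightarrow> t / sqrt (t\<^sup>2 + 0\<^sup>2)"
      unfolding F'_def using that by (intro tendsto_intros \<delta>0) auto
    then show ?thesis using that by simp
  qed
  note Lp = sobolev_pair_Lp[OF u]
  note m[measurable] = Lp[THEN Lp_on_measurable]
  have pr: "pair (\<lambda>x. F n (max 0 (u x))) (\<lambda>x. F' n (max 0 (u x)) *\<^sub>R G x)" for n
    using sobolev_pair_compose_nonneg[OF u d c F0(1) F'1] by (simp add: F0)
  show ?thesis
  proof (rule sobolev_pair_tendsto[OF _ _ pr])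
    show Lu: "Lp (pos_part u)"
      by (rule Lp_on_bound[OF Lp(1), of _ 1]) (auto simp: pos_part_def)
    show LG: "Lp (\<lambda>x. if 0 < u x then G x else 0)"
      by (rule Lp_on_bound[OF Lp(2), of _ 1]) auto
    show "(\<lambda>n. dist_Lp (\<lambda>x. F n (max 0 (u x))) (pos_part u)) \<longlonglongrightarrow> 0"
    proof (rule Lp_dist_dominated[OF _ _ Lp(1), where C = 1])
      show "AE x in \<Lambda>. (\<lambda>n. F n (max 0 (u x))) \<longlonglongrightarrow> pos_part u x"
        by (auto intro!: AE_I2 Flim simp: pos_part_def)
      show "AE x in \<Lambda>. norm (F n (max 0 (u x)) - pos_part u x) \<le> 1 * norm (u x)" for n
      proof (rule AE_I2)
        fix x
        have "0 \<le> F n (max 0 (u x))" "F n (max 0 (u x)) \<le> max 0 (u x)"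
          by (auto intro!: Fb)
        then show "norm (F n (max 0 (u x)) - pos_part u x) \<le> 1 * norm (u x)"
          unfolding pos_part_def real_norm_def by linarith
      qed
    qed (use Lp_on_measurable[OF sobolev_pair_Lp(1)[OF pr]] Lp_on_measurable[OF Lu] in auto)
    show "(\<lambda>n. dist_Lp (\<lambda>x. F' n (max 0 (u x)) *\<^sub>R G x) (\<lambda>x. if 0 < u x then G x else 0)) \<longlonglongrightarrow> 0"
    proof (rule Lp_dist_dominated[OF _ _ Lp(2), where C = 2])
      show "AE x in \<Lambda>. (\<lambda>n. F' n (max 0 (u x)) *\<^sub>R G x) \<longlonglongrightarrow> (if 0 < u x then G x else 0)"
      proof (rule AE_I2)
        fix x
        show "(\<lambda>n. F' n (max 0 (u x)) *\<^sub>R G x) \<longlonglongrightarrow> (if 0 < u x then G x else 0)"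
        proof (cases "0 < u x")
          case True
          have "(\<lambda>n. F' n (max 0 (u x)) *\<^sub>R G x) \<longlonglongrightarrow> 1 *\<^sub>R G x"
            using True by (intro tendsto_intros F'lim) auto
          then show ?thesis using True by simp
        qed (simp add: max_def F0)
      qed
      show "AE x in \<Lambda>. norm (F' n (max 0 (u x)) *\<^sub>R G x - (if 0 < u x then G x else 0)) \<le> 2 * norm (G x)" for n
      proof (rule AE_I2)
        fix x
        have "norm (F' n (max 0 (u x)) *\<^sub>R G x) \<le> norm (G x)"
          using F'1[of n "max 0 (u x)"] by (simp add: mult_left_le_one_le)
        moreover have "norm (if 0 < u x then G x else 0) \<le> norm (G x)" by simp
        ultimately show "norm (F' n (max 0 (u x)) *\<^sub>R G x - (if 0 < u x then G x else 0)) \<le> 2 * norm (G x)"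
          using norm_triangle_ineq4[of "F' n (max 0 (u x)) *\<^sub>R G x" "if 0 < u x then G x else 0"] by linarith
      qed
    qed (use Lp_on_measurable[OF sobolev_pair_Lp(2)[OF pr]] Lp_on_measurable[OF LG] in auto)
  qed
qed

lemma sobolev_pair_neg_part:
  assumes u: "pair u G"
  shows "pair (neg_part u) (\<lambda>x. if u x < 0 then - G x else 0)"
  using sobolev_pair_pos_part[OF sobolev_pair_cmult[OF u, of "-1"]]
  by (simp add: pos_part_def neg_part_def cong: if_cong)

end

section \<open>A Poincare inequality on convex sets\<close>

lemma nn_integral_affine_le:
  fixes g :: "'a::euclidean_space \<Rightarrow> ennreal"
  assumes g[measurable]: "g \<in> borel_measurable borel" and c: "1 / 2 \<le> c"
  shows "(\<integral>\<^sup>+y. g (a + c *\<^sub>R y) \<partial>lborel) \<le> 2 ^ DIM('a) * (\<integral>\<^sup>+y. g y \<partial>lborel)"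
proof -
  have "(\<integral>\<^sup>+y. g y \<partial>lborel) = (\<integral>\<^sup>+y. g y \<partial>density (distr lborel borel (\<lambda>x. a + c *\<^sub>R x)) (\<lambda>_. \<bar>c\<bar> ^ DIM('a)))"
    using c by (subst lborel_affine[of c a]) auto
  also have "\<dots> = ennreal (c ^ DIM('a)) * (\<integral>\<^sup>+y. g (a + c *\<^sub>R y) \<partial>lborel)"
    using c by (simp add: nn_integral_density nn_integral_distr nn_integral_cmult)
  finally have "2 ^ DIM('a) * (\<integral>\<^sup>+y. g y \<partial>lborel)
      = (2 ^ DIM('a) * ennreal (c ^ DIM('a))) * (\<integral>\<^sup>+y. g (a + c *\<^sub>R y) \<partial>lborel)"
    by (simp add: mult.assoc)
  also have "2 ^ DIM('a) * ennreal (c ^ DIM('a)) = ennreal ((2 * c) ^ DIM('a))"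
    using c by (simp add: power_mult_distrib ennreal_mult ennreal_power[symmetric])
  finally have "2 ^ DIM('a) * (\<integral>\<^sup>+y. g y \<partial>lborel)
      = ennreal ((2 * c) ^ DIM('a)) * (\<integral>\<^sup>+y. g (a + c *\<^sub>R y) \<partial>lborel)" .
  moreover have "1 \<le> ennreal ((2 * c) ^ DIM('a))"
    using one_le_power[of "2 * c" "DIM('a)"] c by (simp add: ennreal_leI[of 1, simplified] del: power_mult_distrib)
  ultimately show ?thesis
    using mult_right_mono[of 1 "ennreal ((2 * c) ^ DIM('a))" "\<integral>\<^sup>+y. g (a + c *\<^sub>R y) \<partial>lborel"] by simp
qed

lemma test_function_diff_le_segment_integral:
  fixes \<phi> :: "'a::euclidean_space \<Rightarrow> real"
  assumes \<phi>: "\<phi> \<in> test_functions \<Omega>"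
  shows "ennreal \<bar>\<phi> x - \<phi> y\<bar> \<le> (\<integral>\<^sup>+t. indicator {0..1} t * ennreal (norm (x - y) * norm (grad \<phi> ((1 - t) *\<^sub>R x + t *\<^sub>R y))) \<partial>lborel)"
proof -
  define h where "h t = grad \<phi> ((1 - t) *\<^sub>R x + t *\<^sub>R y) \<bullet> (y - x)" for t
  have c: "continuous_on {0..1} h"
    unfolding h_def
    by (intro continuous_intros continuous_on_compose2[OF grad_test_function(1)[OF \<phi>]]) auto
  have d: "((\<lambda>t. \<phi> ((1 - t) *\<^sub>R x + t *\<^sub>R y)) has_vector_derivative h t) (at t within {0..1})" for t
  proof -
    have "((\<lambda>t. (1 - t) *\<^sub>R x + t *\<^sub>R y) has_derivative (\<lambda>s. s *\<^sub>R (y - x))) (at t within {0..1})"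
      by (auto intro!: derivative_eq_intros simp: algebra_simps)
    from has_derivative_compose[OF this test_functions_has_derivative[OF \<phi>]]
    show ?thesis
      by (simp add: has_vector_derivative_def h_def)
  qed
  have i: "integrable lborel (\<lambda>t. indicator {0..1} t *\<^sub>R h t)"
    by (rule borel_integrable_compact) (auto intro: c)
  have "(\<integral>t. indicator {0..1} t *\<^sub>R h t \<partial>lborel) = \<phi> ((1 - 1) *\<^sub>R x + 1 *\<^sub>R y) - \<phi> ((1 - 0) *\<^sub>R x + 0 *\<^sub>R y)"
    by (rule integral_FTC_Icc[OF _ d c]) simp
  then have "ennreal \<bar>\<phi> x - \<phi> y\<bar> = ennreal (norm (\<integral>t. indicator {0..1} t *\<^sub>R h t \<partial>lborel))"
    by (simp add: abs_minus_commute)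
  also have "\<dots> \<le> (\<integral>\<^sup>+t. norm (indicator {0..1} t *\<^sub>R h t) \<partial>lborel)"
    by (rule integral_norm_bound_ennreal[OF i])
  also have "\<dots> \<le> (\<integral>\<^sup>+t. indicator {0..1} t * ennreal (norm (x - y) * norm (grad \<phi> ((1 - t) *\<^sub>R x + t *\<^sub>R y))) \<partial>lborel)"
  proof (rule nn_integral_mono)
    fix t
    have "\<bar>h t\<bar> \<le> norm (x - y) * norm (grad \<phi> ((1 - t) *\<^sub>R x + t *\<^sub>R y))"
      unfolding h_def using Cauchy_Schwarz_ineq2[of "grad \<phi> ((1 - t) *\<^sub>R x + t *\<^sub>R y)" "y - x"]
      by (simp add: mult.commute norm_minus_commute)
    then show "ennreal (norm (indicator {0..1} t *\<^sub>R h t)) \<le> indicator {0..1} t * ennreal (norm (x - y) * norm (grad \<phi> ((1 - t) *\<^sub>R x + t *\<^sub>R y)))"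
      by (auto simp: indicator_def intro!: ennreal_leI)
  qed
  finally show ?thesis .
qed

text \<open>Substitute for the variable whose weight is at least \<open>1 / 2\<close>, which bounds the Jacobian by
  \<open>2 ^ DIM('a)\<close>.\<close>

lemma segment_double_integral_le:
  fixes g :: "'a::euclidean_space \<Rightarrow> ennreal"
  assumes g[measurable]: "g \<in> borel_measurable borel" and Q[measurable]: "Q \<in> sets borel" and t: "0 \<le> t" "t \<le> 1"
  shows "(\<integral>\<^sup>+x. \<integral>\<^sup>+y. indicator Q x * indicator Q y * g ((1 - t) *\<^sub>R x + t *\<^sub>R y) \<partial>lborel \<partial>lborel)
    \<le> 2 ^ DIM('a) * emeasure lborel Q * (\<integral>\<^sup>+z. g z \<partial>lborel)"
proof -
  have *: "(\<integral>\<^sup>+x. \<integral>\<^sup>+y. indicator Q x * g (s *\<^sub>R x + r *\<^sub>R y) \<partial>lborel \<partial>lborel)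
      \<le> 2 ^ DIM('a) * emeasure lborel Q * (\<integral>\<^sup>+z. g z \<partial>lborel)" if "1 / 2 \<le> r" for s r :: real
  proof -
    have "(\<integral>\<^sup>+x. \<integral>\<^sup>+y. indicator Q x * g (s *\<^sub>R x + r *\<^sub>R y) \<partial>lborel \<partial>lborel)
        \<le> (\<integral>\<^sup>+x. indicator Q x * (2 ^ DIM('a) * (\<integral>\<^sup>+z. g z \<partial>lborel)) \<partial>lborel)"
      using nn_integral_affine_le[OF g that]
      by (intro nn_integral_mono) (simp add: nn_integral_cmult mult_left_mono)
    also have "\<dots> = 2 ^ DIM('a) * emeasure lborel Q * (\<integral>\<^sup>+z. g z \<partial>lborel)"
      by (simp add: nn_integral_multc mult_ac)
    finally show ?thesis .
  qed
  show ?thesis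
  proof (cases "1 / 2 \<le> t")
    case True
    have "(\<integral>\<^sup>+x. \<integral>\<^sup>+y. indicator Q x * indicator Q y * g ((1 - t) *\<^sub>R x + t *\<^sub>R y) \<partial>lborel \<partial>lborel)
        \<le> (\<integral>\<^sup>+x. \<integral>\<^sup>+y. indicator Q x * g ((1 - t) *\<^sub>R x + t *\<^sub>R y) \<partial>lborel \<partial>lborel)"
      by (intro nn_integral_mono) (auto simp: indicator_def)
    also have "\<dots> \<le> 2 ^ DIM('a) * emeasure lborel Q * (\<integral>\<^sup>+z. g z \<partial>lborel)"
      by (rule *[OF True])
    finally show ?thesis .
  next
    case False
    have "(\<integral>\<^sup>+x. \<integral>\<^sup>+y. indicator Q x * indicator Q y * g ((1 - t) *\<^sub>R x + t *\<^sub>R y) \<partial>lborel \<partial>lborel)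
        = (\<integral>\<^sup>+y. \<integral>\<^sup>+x. indicator Q x * indicator Q y * g ((1 - t) *\<^sub>R x + t *\<^sub>R y) \<partial>lborel \<partial>lborel)"
      by (rule lborel_pair.Fubini'[symmetric]) measurable
    also have "\<dots> \<le> (\<integral>\<^sup>+y. \<integral>\<^sup>+x. indicator Q y * g (t *\<^sub>R y + (1 - t) *\<^sub>R x) \<partial>lborel \<partial>lborel)"
      by (intro nn_integral_mono) (auto simp: indicator_def add.commute)
    also have "\<dots> \<le> 2 ^ DIM('a) * emeasure lborel Q * (\<integral>\<^sup>+z. g z \<partial>lborel)"
      using False by (intro *) auto
    finally show ?thesis .
  qed
qed

text \<open>Convexity keeps the segments inside \<open>Q\<close>, so only values of the gradient on
  \<open>Q\<close> enter. Tonelli's theorem moves the segment parameter \<open>t\<close> outside,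
  and each fixed \<open>t\<close> is handled by \<open>segment_double_integral_le\<close>.\<close>

lemma test_function_double_integral_le:
  fixes \<phi> :: "'a::euclidean_space \<Rightarrow> real"
  assumes \<phi>: "\<phi> \<in> test_functions \<Omega>" and Q[measurable]: "Q \<in> sets borel" and "convex Q"
    and diam: "\<And>x y. x \<in> Q \<Longrightarrow> y \<in> Q \<Longrightarrow> norm (x - y) \<le> d"
  shows "(\<integral>\<^sup>+x. \<integral>\<^sup>+y. indicator Q x * indicator Q y * ennreal \<bar>\<phi> x - \<phi> y\<bar> \<partial>lborel \<partial>lborel)
    \<le> ennreal d * 2 ^ DIM('a) * emeasure lborel Q * (\<integral>\<^sup>+z. indicator Q z * ennreal (norm (grad \<phi> z)) \<partial>lborel)"
proof -
  have [measurable]: "grad \<phi> \<in> borel_measurable borel"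
    by (rule borel_measurable_continuous_onI[OF grad_test_function(1)[OF \<phi>]])
  define g where "g z = indicator Q z * ennreal (norm (grad \<phi> z))" for z
  have g[measurable]: "g \<in> borel_measurable borel"
    unfolding g_def by measurable
  define F where "F x y t = indicator Q x * indicator Q y * (indicator {0..1} t * (ennreal d * g ((1 - t) *\<^sub>R x + t *\<^sub>R y)))" for x y and t :: real
  have le: "indicator Q x * indicator Q y * ennreal \<bar>\<phi> x - \<phi> y\<bar> \<le> (\<integral>\<^sup>+t. F x y t \<partial>lborel)" for x y
  proof (cases "x \<in> Q \<and> y \<in> Q")
    case True
    have "ennreal \<bar>\<phi> x - \<phi> y\<bar> \<le> (\<integral>\<^sup>+t. indicator {0..1} t * ennreal (norm (x - y) * norm (grad \<phi> ((1 - t) *\<^sub>R x + t *\<^sub>R y))) \<partial>lborel)"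
      by (rule test_function_diff_le_segment_integral[OF \<phi>])
    also have "\<dots> \<le> (\<integral>\<^sup>+t. F x y t \<partial>lborel)"
    proof (rule nn_integral_mono)
      fix t :: real
      show "indicator {0..1} t * ennreal (norm (x - y) * norm (grad \<phi> ((1 - t) *\<^sub>R x + t *\<^sub>R y))) \<le> F x y t"
      proof (cases "t \<in> {0..1}")
        case t: True
        then have "(1 - t) *\<^sub>R x + t *\<^sub>R y \<in> Q"
          using True \<open>convex Q\<close> by (auto simp: convex_alt)
        moreover have "0 \<le> d" using diam[of x x] True by simp
        moreover have "ennreal (norm (x - y) * norm (grad \<phi> ((1 - t) *\<^sub>R x + t *\<^sub>R y))) \<le> ennreal (d * norm (grad \<phi> ((1 - t) *\<^sub>R x + t *\<^sub>R y)))"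
          using diam True by (intro ennreal_leI mult_right_mono) auto
        ultimately show ?thesis
          using True t by (simp add: F_def g_def ennreal_mult)
      qed simp
    qed
    finally show ?thesis using True by simp
  qed auto
  have Fm: "(\<lambda>(x, y, t). F x y t) \<in> borel_measurable (lborel \<Otimes>\<^sub>M lborel \<Otimes>\<^sub>M lborel)"
    unfolding F_def by measurable
  have "(\<integral>\<^sup>+x. \<integral>\<^sup>+y. indicator Q x * indicator Q y * ennreal \<bar>\<phi> x - \<phi> y\<bar> \<partial>lborel \<partial>lborel)
      \<le> (\<integral>\<^sup>+x. \<integral>\<^sup>+y. \<integral>\<^sup>+t. F x y t \<partial>lborel \<partial>lborel \<partial>lborel)"
    by (intro nn_integral_mono le)
  also have "\<dots> = (\<integral>\<^sup>+x. \<integral>\<^sup>+t. \<integral>\<^sup>+y. F x y t \<partial>lborel \<partial>lborel \<partial>lborel)"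
    unfolding F_def by (intro nn_integral_cong lborel_pair.Fubini') measurable
  also have "\<dots> = (\<integral>\<^sup>+t. \<integral>\<^sup>+x. \<integral>\<^sup>+y. F x y t \<partial>lborel \<partial>lborel \<partial>lborel)"
    unfolding F_def by (intro lborel_pair.Fubini') measurable
  also have "\<dots> \<le> (\<integral>\<^sup>+t. indicator {0..1::real} t * (ennreal d * (2 ^ DIM('a) * emeasure lborel Q * (\<integral>\<^sup>+z. g z \<partial>lborel))) \<partial>lborel)"
  proof (rule nn_integral_mono)
    fix t :: real
    show "(\<integral>\<^sup>+x. \<integral>\<^sup>+y. F x y t \<partial>lborel \<partial>lborel) \<le> indicator {0..1} t * (ennreal d * (2 ^ DIM('a) * emeasure lborel Q * (\<integral>\<^sup>+z. g z \<partial>lborel)))"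
    proof (cases "t \<in> {0..1}")
      case True
      then have "(\<integral>\<^sup>+x. \<integral>\<^sup>+y. F x y t \<partial>lborel \<partial>lborel)
        = (\<integral>\<^sup>+x. \<integral>\<^sup>+y. ennreal d * (indicator Q x * indicator Q y * g ((1 - t) *\<^sub>R x + t *\<^sub>R y)) \<partial>lborel \<partial>lborel)"
        by (simp add: F_def mult_ac)
      also have "\<dots> = ennreal d * (\<integral>\<^sup>+x. \<integral>\<^sup>+y. indicator Q x * indicator Q y * g ((1 - t) *\<^sub>R x + t *\<^sub>R y) \<partial>lborel \<partial>lborel)"
        by (simp add: nn_integral_cmult)
      also have "\<dots> \<le> ennreal d * (2 ^ DIM('a) * emeasure lborel Q * (\<integral>\<^sup>+z. g z \<partial>lborel))"
        using True by (intro mult_left_mono segment_double_integral_le[OF g Q]) auto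
      finally show ?thesis using True by simp
    qed (simp add: F_def)
  qed
  also have "\<dots> = ennreal d * 2 ^ DIM('a) * emeasure lborel Q * (\<integral>\<^sup>+z. g z \<partial>lborel)"
    by (subst nn_integral_multc) (auto simp: mult_ac)
  finally show ?thesis by (simp add: g_def)
qed

text \<open>Integrate the triangle inequality for \<open>\<phi> x\<close>, \<open>\<phi> y\<close>
  over \<open>x \<in> Q\<close> and \<open>y \<in> Z\<close>, enlarging \<open>Z\<close> to
  \<open>Q\<close> in the difference term. In the application \<open>Z\<close> is a set of zeros, so
  the first term on the right disappears and the gradient controls the function.\<close>

lemma test_function_poincare:
  fixes \<phi> :: "'a::euclidean_space \<Rightarrow> real"
  assumes \<phi>: "\<phi> \<in> test_functions \<Omega>" and Q[measurable]: "Q \<in> sets borel" and "convex Q"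
    and diam: "\<And>x y. x \<in> Q \<Longrightarrow> y \<in> Q \<Longrightarrow> norm (x - y) \<le> d"
    and Z[measurable]: "Z \<in> sets borel" and "Z \<subseteq> Q"
  shows "emeasure lborel Z * (\<integral>\<^sup>+x. indicator Q x * ennreal \<bar>\<phi> x\<bar> \<partial>lborel)
    \<le> emeasure lborel Q * (\<integral>\<^sup>+x. indicator Z x * ennreal \<bar>\<phi> x\<bar> \<partial>lborel)
      + ennreal d * 2 ^ DIM('a) * emeasure lborel Q * (\<integral>\<^sup>+z. indicator Q z * ennreal (norm (grad \<phi> z)) \<partial>lborel)"
proof -
  have [measurable]: "\<phi> \<in> borel_measurable borel"
    by (rule borel_measurable_continuous_onI[OF test_functions_continuous[OF \<phi>]])
  have le: "indicator Q x * indicator Z y * ennreal \<bar>\<phi> x\<bar>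
      \<le> indicator Q x * indicator Z y * ennreal \<bar>\<phi> y\<bar> + indicator Q x * indicator Q y * ennreal \<bar>\<phi> x - \<phi> y\<bar>" for x y
  proof -
    have "ennreal \<bar>\<phi> x\<bar> \<le> ennreal (\<bar>\<phi> y\<bar> + \<bar>\<phi> x - \<phi> y\<bar>)"
      by (intro ennreal_leI) auto
    also have "\<dots> = ennreal \<bar>\<phi> y\<bar> + ennreal \<bar>\<phi> x - \<phi> y\<bar>"
      by (rule ennreal_plus) auto
    finally show ?thesis
      using \<open>Z \<subseteq> Q\<close> by (auto simp: indicator_def)
  qed
  have "emeasure lborel Z * (\<integral>\<^sup>+x. indicator Q x * ennreal \<bar>\<phi> x\<bar> \<partial>lborel)
      = (\<integral>\<^sup>+x. \<integral>\<^sup>+y. indicator Q x * indicator Z y * ennreal \<bar>\<phi> x\<bar> \<partial>lborel \<partial>lborel)"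
  proof -
    have "(\<integral>\<^sup>+y. indicator Q x * indicator Z y * ennreal \<bar>\<phi> x\<bar> \<partial>lborel) = (indicator Q x * ennreal \<bar>\<phi> x\<bar>) * emeasure lborel Z" for x
      by (subst mult.assoc, subst mult.commute[of "indicator Z _"], subst mult.assoc[symmetric]) (simp add: nn_integral_cmult)
    then show ?thesis
      by (simp add: nn_integral_multc) (simp add: mult.commute)
  qed
  also have "\<dots> \<le> (\<integral>\<^sup>+x. \<integral>\<^sup>+y. indicator Q x * indicator Z y * ennreal \<bar>\<phi> y\<bar> + indicator Q x * indicator Q y * ennreal \<bar>\<phi> x - \<phi> y\<bar> \<partial>lborel \<partial>lborel)"
    by (intro nn_integral_mono le)
  also have "\<dots> = (\<integral>\<^sup>+x. \<integral>\<^sup>+y. indicator Q x * (indicator Z y * ennreal \<bar>\<phi> y\<bar>) \<partial>lborel \<partial>lborel)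
      + (\<integral>\<^sup>+x. \<integral>\<^sup>+y. indicator Q x * indicator Q y * ennreal \<bar>\<phi> x - \<phi> y\<bar> \<partial>lborel \<partial>lborel)"
    by (subst nn_integral_add[symmetric]; (measurable)?) (simp add: nn_integral_add mult.assoc)
  also have "(\<integral>\<^sup>+x. \<integral>\<^sup>+y. indicator Q x * (indicator Z y * ennreal \<bar>\<phi> y\<bar>) \<partial>lborel \<partial>lborel)
      = emeasure lborel Q * (\<integral>\<^sup>+x. indicator Z x * ennreal \<bar>\<phi> x\<bar> \<partial>lborel)"
    by (simp add: nn_integral_cmult nn_integral_multc)
  finally show ?thesis
    using test_function_double_integral_le[OF \<phi> Q \<open>convex Q\<close> diam]
    by (meson add_left_mono order_trans)
qed

lemma nn_integral_lborel_eq_integral_lebesgue_on: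
  fixes h :: "'a::euclidean_space \<Rightarrow> real"
  assumes "\<Omega> \<in> sets lebesgue" and h: "h \<in> borel_measurable borel" "\<And>x. 0 \<le> h x" "\<And>x. x \<notin> \<Omega> \<Longrightarrow> h x = 0"
    and i: "integrable (lebesgue_on \<Omega>) h"
  shows "(\<integral>\<^sup>+x. ennreal (h x) \<partial>lborel) = ennreal (\<integral>x. h x \<partial>lebesgue_on \<Omega>)"
proof -
  have i': "integrable lebesgue h"
    using assms integrable_lebesgue_on_support[of \<Omega> h] by auto
  have "(\<integral>\<^sup>+x. ennreal (h x) \<partial>lborel) = (\<integral>\<^sup>+x. ennreal (h x) \<partial>lebesgue)"
    by (rule nn_integral_completion[symmetric])
  also have "\<dots> = ennreal (\<integral>x. h x \<partial>lebesgue)"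
    using i' h by (intro nn_integral_eq_integral) auto
  finally show ?thesis
    using assms integral_lebesgue_on_support[of \<Omega> h] by auto
qed

context sobolev_domain
begin

text \<open>Only L^1 quantities occur in the inequality for test functions, and these are continuous
  along the approximating sequence.\<close>

lemma sobolev_pair_poincare:
  assumes w: "pair w G" and Q: "Q \<in> sets borel" "convex Q" "Q \<subseteq> \<Omega>"
    and diam: "\<And>x y. x \<in> Q \<Longrightarrow> y \<in> Q \<Longrightarrow> norm (x - y) \<le> d" "0 \<le> d"
    and Z: "Z \<in> sets borel" "Z \<subseteq> Q"
  shows "measure lborel Z * (\<integral>x. indicator Q x * \<bar>w x\<bar> \<partial>\<Lambda>)
    \<le> measure lborel Q * (\<integral>x. indicator Z x * \<bar>w x\<bar> \<partial>\<Lambda>)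
      + d * 2 ^ DIM('a) * measure lborel Q * (\<integral>x. indicator Q x * norm (G x) \<partial>\<Lambda>)"
proof -
  have fin: "emeasure lborel A < \<infinity>" if "A \<in> sets borel" "A \<subseteq> \<Omega>" for A
  proof -
    have "emeasure lborel A = emeasure lebesgue A" using that by simp
    also have "\<dots> \<le> emeasure lebesgue \<Omega>" using that \<Omega>_sets by (intro emeasure_mono) auto
    finally show ?thesis using finite_\<Omega> by (simp add: order_le_less_trans)
  qed
  have em: "emeasure lborel A = ennreal (measure lborel A)" if "A \<in> sets borel" "A \<subseteq> \<Omega>" for A
    using fin[OF that] by (intro emeasure_eq_ennreal_measure) auto
  have ind: "integrable \<Lambda> (\<lambda>x. indicator A x * norm (f x))"
    if "A \<in> sets borel" "A \<subseteq> \<Omega>" "Lp f" for A and f :: "'a \<Rightarrow> 'c::euclidean_space"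
  proof -
    have "integrable \<Lambda> (\<lambda>x. indicator A x *\<^sub>R norm (f x))"
      using that \<Omega>_sets Lp_on_integrable[OF that(3)]
      by (intro integrable_mult_indicator integrable_norm) (auto simp: sets_restrict_space_iff)
    then show ?thesis by simp
  qed
  obtain \<phi> where \<phi>: "\<And>n::nat. \<phi> n \<in> \<D>"
    "(\<lambda>n. dist_Lp (\<phi> n) w) \<longlonglongrightarrow> 0" "(\<lambda>n. dist_Lp (grad (\<phi> n)) G) \<longlonglongrightarrow> 0"
    using sobolev_pair_sequence[OF w] by blast
  note L = sobolev_pair_Lp[OF w] and L\<phi> = Lp_on_test_function[OF \<phi>(1)]
  have nn: "(\<integral>\<^sup>+x. indicator A x * ennreal (norm (f x)) \<partial>lborel) = ennreal (\<integral>x. indicator A x * norm (f x) \<partial>\<Lambda>)"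
    if A: "A \<in> sets borel" "A \<subseteq> \<Omega>" and f: "Lp f" "f \<in> borel_measurable borel" for A and f :: "'a \<Rightarrow> 'c::euclidean_space"
  proof -
    have "(\<integral>\<^sup>+x. indicator A x * ennreal (norm (f x)) \<partial>lborel) = (\<integral>\<^sup>+x. ennreal (indicator A x * norm (f x)) \<partial>lborel)"
      by (intro nn_integral_cong) (simp add: indicator_def)
    also have "\<dots> = ennreal (\<integral>x. indicator A x * norm (f x) \<partial>\<Lambda>)"
      using A f by (intro nn_integral_lborel_eq_integral_lebesgue_on[OF \<Omega>_sets] ind) (auto simp: indicator_def)
    finally show ?thesis .
  qed
  have ge0: "0 \<le> (\<integral>x. indicator A x * norm (f x) \<partial>\<Lambda>)" for A and f :: "'a \<Rightarrow> 'c::euclidean_space"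
    by simp
  have Z\<Omega>: "Z \<subseteq> \<Omega>" using Z Q by auto
  have le: "measure lborel Z * (\<integral>x. indicator Q x * norm (\<phi> n x) \<partial>\<Lambda>)
    \<le> measure lborel Q * (\<integral>x. indicator Z x * norm (\<phi> n x) \<partial>\<Lambda>)
      + d * 2 ^ DIM('a) * measure lborel Q * (\<integral>x. indicator Q x * norm (grad (\<phi> n) x) \<partial>\<Lambda>)" for n
  proof -
    have m: "\<phi> n \<in> borel_measurable borel" "grad (\<phi> n) \<in> borel_measurable borel"
      using borel_measurable_continuous_onI[OF test_functions_continuous[OF \<phi>(1)]]
        borel_measurable_continuous_onI[OF grad_test_function(1)[OF \<phi>(1)]] by auto
    note nn' = nn[OF Q(1,3) L\<phi>(1) m(1)] nn[OF Z(1) Z\<Omega> L\<phi>(1) m(1)] nn[OF Q(1,3) L\<phi>(2) m(2)]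
    have "emeasure lborel Z * (\<integral>\<^sup>+x. indicator Q x * ennreal (norm (\<phi> n x)) \<partial>lborel)
      \<le> emeasure lborel Q * (\<integral>\<^sup>+x. indicator Z x * ennreal (norm (\<phi> n x)) \<partial>lborel)
      + ennreal d * 2 ^ DIM('a) * emeasure lborel Q * (\<integral>\<^sup>+z. indicator Q z * ennreal (norm (grad (\<phi> n) z)) \<partial>lborel)"
      using test_function_poincare[OF \<phi>(1)[of n] Q(1,2) diam(1) Z] by simp
    then have "ennreal (measure lborel Z * (\<integral>x. indicator Q x * norm (\<phi> n x) \<partial>\<Lambda>))
      \<le> ennreal (measure lborel Q * (\<integral>x. indicator Z x * norm (\<phi> n x) \<partial>\<Lambda>)
      + d * 2 ^ DIM('a) * measure lborel Q * (\<integral>x. indicator Q x * norm (grad (\<phi> n) x) \<partial>\<Lambda>))"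
      unfolding nn' em[OF Q(1,3)] em[OF Z(1) Z\<Omega>]
      using ge0 diam(2) by (simp add: ennreal_mult ennreal_plus ennreal_power[symmetric] del: real_norm_def)
    then show ?thesis
      using ge0 diam(2) by (subst (asm) ennreal_le_iff) (auto intro!: add_nonneg_nonneg mult_nonneg_nonneg)
  qed
  have lim: "(\<lambda>n. \<integral>x. indicator A x * norm (f n x) \<partial>\<Lambda>) \<longlonglongrightarrow> (\<integral>x. indicator A x * norm (h x) \<partial>\<Lambda>)"
    if A: "A \<in> sets borel" "A \<subseteq> \<Omega>" and f: "\<And>n. Lp (f n)" "Lp h" "(\<lambda>n. dist_Lp (f n) h) \<longlonglongrightarrow> 0"
    for A and f :: "nat \<Rightarrow> 'a \<Rightarrow> 'c::euclidean_space" and h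
  proof (rule LIMSEQ_I)
    fix e :: real assume "e > 0"
    then obtain \<delta> where \<delta>: "\<delta> > 0" "\<And>f g :: 'a \<Rightarrow> 'c. Lp f \<Longrightarrow> Lp g \<Longrightarrow> dist_Lp f g < \<delta>
        \<Longrightarrow> (\<integral>x. norm (f x - g x) \<partial>\<Lambda>) < e"
      by (rule L1_dist_small[where 'b='c]) blast
    obtain N where N: "\<And>n. n \<ge> N \<Longrightarrow> dist_Lp (f n) h < \<delta>"
      using order_tendstoD(2)[OF f(3) \<delta>(1)] by (auto simp: eventually_sequentially)
    show "\<exists>N. \<forall>n\<ge>N. norm ((\<integral>x. indicator A x * norm (f n x) \<partial>\<Lambda>) - (\<integral>x. indicator A x * norm (h x) \<partial>\<Lambda>)) < e"
    proof (intro exI allI impI)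
      fix n assume n: "n \<ge> N"
      have "norm ((\<integral>x. indicator A x * norm (f n x) \<partial>\<Lambda>) - (\<integral>x. indicator A x * norm (h x) \<partial>\<Lambda>))
        = norm (\<integral>x. indicator A x * norm (f n x) - indicator A x * norm (h x) \<partial>\<Lambda>)"
        using ind[OF A f(1)] ind[OF A f(2)] by simp
      also have "\<dots> \<le> (\<integral>x. norm (f n x - h x) \<partial>\<Lambda>)"
      proof (rule Bochner_Integration.integral_norm_bound_integral)
        show "integrable \<Lambda> (\<lambda>x. norm (f n x - h x))"
          using Lp_on_integrable[OF Lp_on_diff[OF f(1,2)]] by simp
        show "norm (indicator A x * norm (f n x) - indicator A x * norm (h x)) \<le> norm (f n x - h x)" for x
          using norm_triangle_ineq3[of "f n x" "h x"] by (simp add: indicator_def)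
      qed (use ind[OF A f(1)] ind[OF A f(2)] in simp)
      also have "\<dots> < e"
        using \<delta>(2)[OF f(1,2) N[OF n]] .
      finally show "norm ((\<integral>x. indicator A x * norm (f n x) \<partial>\<Lambda>) - (\<integral>x. indicator A x * norm (h x) \<partial>\<Lambda>)) < e" .
    qed
  qed
  have "measure lborel Z * (\<integral>x. indicator Q x * norm (w x) \<partial>\<Lambda>)
    \<le> measure lborel Q * (\<integral>x. indicator Z x * norm (w x) \<partial>\<Lambda>)
      + d * 2 ^ DIM('a) * measure lborel Q * (\<integral>x. indicator Q x * norm (G x) \<partial>\<Lambda>)"
    by (rule LIMSEQ_le[OF tendsto_mult_left tendsto_add[OF tendsto_mult_left tendsto_mult_left]];
        (rule lim[OF Q(1,3) L\<phi>(1) L(1) \<phi>(2)] lim[OF Z(1) Z\<Omega> L\<phi>(1) L(1) \<phi>(2)] lim[OF Q(1,3) L\<phi>(2) L(2) \<phi>(3)])?)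
       (use le in blast)
  then show ?thesis by simp
qed

end

section \<open>Picone's inequality\<close>

text \<open>The convention \<open>0 powr x = 0\<close> makes this true at \<open>r = 0\<close> as
  well; hence the factor \<open>norm (G x) powr (p - 2)\<close> causes no trouble at zeros of the
  gradient when \<open>p < 2\<close>.\<close>

lemma powr_minus_two_mult: "0 \<le> r \<Longrightarrow> r powr (p - 2) * r = r powr (p - 1)" for r :: real
  using powr_mult_base[of r "p - 2"] by (cases "r = 0") (auto simp: mult.commute)

lemma powr_minus_one_mult: "0 \<le> r \<Longrightarrow> r powr (p - 1) * r = r powr p" for r :: real
  using powr_mult_base[of r "p - 1"] by (cases "r = 0") (auto simp: mult.commute)

text \<open>Strict convexity of \<open>r powr p\<close>: its graph lies above the tangent at
  \<open>s\<close>, which the mean value theorem shows for positive \<open>s\<close> and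
  \<open>t\<close>. The strictness yields the equality case of Hoelder's inequality.\<close>

lemma young_powr_strict:
  fixes s t p :: real
  assumes p: "1 < p" and st: "0 \<le> s" "0 \<le> t" "s \<noteq> t"
  shows "p * (s powr (p - 1) * t) < (p - 1) * s powr p + t powr p"
proof -
  consider "s = 0" | "t = 0" | "0 < s" "0 < t" using st by fastforce
  then show ?thesis
  proof cases
    case 3
    have d: "((\<lambda>r. r powr p) has_real_derivative p * r powr (p - 1)) (at r)" if "0 < r" for r
      using that by (auto intro!: derivative_eq_intros)
    have "p * s powr (p - 1) * (t - s) < t powr p - s powr p"
    proof (cases "s < t")
      case True
      obtain z where z: "s < z" "z < t" "t powr p - s powr p = (t - s) * (p * z powr (p - 1))"
        using MVT2[OF True, of "\<lambda>r. r powr p" "\<lambda>r. p * r powr (p - 1)"] d 3 by auto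
      have "s powr (p - 1) < z powr (p - 1)"
        using z 3 p by (intro powr_less_mono2) auto
      then show ?thesis using z(3) True p by (simp add: mult.commute)
    next
      case False
      then have ts: "t < s" using st by simp
      obtain z where z: "t < z" "z < s" "s powr p - t powr p = (s - t) * (p * z powr (p - 1))"
        using MVT2[OF ts, of "\<lambda>r. r powr p" "\<lambda>r. p * r powr (p - 1)"] d 3 by auto
      have "z powr (p - 1) < s powr (p - 1)"
        using z 3 p by (intro powr_less_mono2) auto
      then have "(s - t) * (p * z powr (p - 1)) < (s - t) * (p * s powr (p - 1))"
        using ts p by simp
      then show ?thesis using z(3) by (simp add: algebra_simps)
    qed
    moreover have "s powr (p - 1) * s = s powr p"
      using 3 by (intro powr_minus_one_mult) simp
    ultimately show ?thesis by (simp add: algebra_simps)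
  qed (use p st in \<open>auto simp: order_less_le\<close>)
qed

lemma young_powr:
  fixes s t p :: real
  assumes "1 < p" "0 \<le> s" "0 \<le> t"
  shows "p * (s powr (p - 1) * t) \<le> (p - 1) * s powr p + t powr p"
proof (cases "s = t")
  case True
  then have "s powr (p - 1) * t = s powr p"
    using assms by (auto intro: powr_minus_one_mult)
  then show ?thesis using True by (simp add: algebra_simps)
qed (use young_powr_strict[OF assms] in auto)

lemma powr_mult_le_add:
  fixes s t p :: real
  assumes "1 < p" "0 \<le> s" "0 \<le> t"
  shows "s powr (p - 1) * t \<le> s powr p + t powr p"
proof -
  have "s powr (p - 1) * t \<le> max s t powr (p - 1) * max s t"
    using assms by (intro mult_mono powr_mono2) auto
  also have "\<dots> = max s t powr p"
    using assms by (intro powr_minus_one_mult) auto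
  also have "\<dots> \<le> s powr p + t powr p"
    by (auto simp: max_def)
  finally show ?thesis .
qed

text \<open>For \<open>c = \<phi> x\<close> and \<open>m = v x + \<epsilon>\<close> the vector on
  the right of the inner product is the gradient of
  \<open>\<bar>\<phi>\<bar> powr p * (v + \<epsilon>) powr (1 - p)\<close>. With
  \<open>X = \<bar>c\<bar> * norm g / m\<close>, Cauchy-Schwarz gives the first term and the second
  one is exact. The bound is left in this form so that Young's inequality can be applied to it with
  different weights.\<close>

lemma picone_pointwise:
  fixes g h :: "'a::real_inner" and c m p :: real
  assumes p: "1 < p" and m: "0 < m"
  shows "norm g powr (p - 2) * (g \<bullet> ((m powr (1 - p) * (p * (\<bar>c\<bar> powr (p - 1) * sgn c))) *\<^sub>R h
        - ((p - 1) * (\<bar>c\<bar> powr p * m powr (- p))) *\<^sub>R g))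
    \<le> p * ((\<bar>c\<bar> * norm g / m) powr (p - 1) * norm h) - (p - 1) * (\<bar>c\<bar> * norm g / m) powr p"
proof -
  have X1: "(\<bar>c\<bar> * norm g / m) powr (p - 1) = \<bar>c\<bar> powr (p - 1) * norm g powr (p - 1) * m powr (1 - p)"
    using m by (simp add: powr_divide powr_mult powr_diff field_simps)
  have X2: "(\<bar>c\<bar> * norm g / m) powr p = \<bar>c\<bar> powr p * norm g powr p * m powr (- p)"
    using m by (simp add: powr_divide powr_mult powr_minus field_simps)
  have g1: "norm g powr (p - 2) * norm g = norm g powr (p - 1)"
    by (simp add: powr_minus_two_mult)
  have g2: "norm g powr (p - 2) * (g \<bullet> g) = norm g powr p"
    using g1 powr_minus_one_mult[of "norm g" p] by (simp add: power2_norm_eq_inner[symmetric] power2_eq_square mult.assoc[symmetric])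
  have "sgn c * (g \<bullet> h) \<le> norm g * norm h"
  proof -
    have "sgn c * (g \<bullet> h) \<le> \<bar>sgn c\<bar> * \<bar>g \<bullet> h\<bar>"
      by (metis abs_ge_self abs_mult)
    also have "\<dots> \<le> 1 * (norm g * norm h)"
      by (intro mult_mono Cauchy_Schwarz_ineq2) (auto simp: sgn_if)
    finally show ?thesis by simp
  qed
  then have "(norm g powr (p - 2) * m powr (1 - p) * p * \<bar>c\<bar> powr (p - 1)) * (sgn c * (g \<bullet> h))
    \<le> (norm g powr (p - 2) * m powr (1 - p) * p * \<bar>c\<bar> powr (p - 1)) * (norm g * norm h)"
    using p by (intro mult_left_mono) auto
  also have "\<dots> = p * ((norm g powr (p - 2) * norm g) * m powr (1 - p) * \<bar>c\<bar> powr (p - 1) * norm h)"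
    by (simp add: mult_ac)
  also have "\<dots> = p * ((\<bar>c\<bar> * norm g / m) powr (p - 1) * norm h)"
    unfolding g1 X1 by (simp add: mult_ac)
  finally have 1: "(norm g powr (p - 2) * m powr (1 - p) * p * \<bar>c\<bar> powr (p - 1)) * (sgn c * (g \<bullet> h))
    \<le> p * ((\<bar>c\<bar> * norm g / m) powr (p - 1) * norm h)" .
  have "norm g powr (p - 2) * (g \<bullet> ((m powr (1 - p) * (p * (\<bar>c\<bar> powr (p - 1) * sgn c))) *\<^sub>R h
        - ((p - 1) * (\<bar>c\<bar> powr p * m powr (- p))) *\<^sub>R g))
    = (norm g powr (p - 2) * m powr (1 - p) * p * \<bar>c\<bar> powr (p - 1)) * (sgn c * (g \<bullet> h))
      - (p - 1) * (\<bar>c\<bar> powr p * (norm g powr (p - 2) * (g \<bullet> g)) * m powr (- p))"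
    by (simp add: inner_diff_right right_diff_distrib mult_ac)
  also have "\<dots> \<le> p * ((\<bar>c\<bar> * norm g / m) powr (p - 1) * norm h) - (p - 1) * (\<bar>c\<bar> * norm g / m) powr p"
    using 1 unfolding g2 X2 by simp
  finally show ?thesis .
qed

lemma DERIV_abs_powr:
  fixes t p :: real
  assumes p: "1 < p"
  shows "((\<lambda>t. \<bar>t\<bar> powr p) has_real_derivative p * (\<bar>t\<bar> powr (p - 1) * sgn t)) (at t)"
proof -
  consider "t > 0" | "t < 0" | "t = 0" by linarith
  then show ?thesis
  proof cases
    case 1
    have "((\<lambda>t. t powr p) has_real_derivative p * (\<bar>t\<bar> powr (p - 1) * sgn t)) (at t)"
      using 1 by (auto intro!: derivative_eq_intros)
    moreover have "\<forall>\<^sub>F s in nhds t. \<bar>s\<bar> powr p = s powr p"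
      using eventually_nhds_in_open[of "{0<..}" t] 1 by (auto elim!: eventually_mono)
    ultimately show ?thesis by (subst DERIV_cong_ev) auto
  next
    case 2
    have "((\<lambda>t. (- t) powr p) has_real_derivative p * (\<bar>t\<bar> powr (p - 1) * sgn t)) (at t)"
      using 2 by (auto intro!: derivative_eq_intros)
    moreover have "\<forall>\<^sub>F s in nhds t. \<bar>s\<bar> powr p = (- s) powr p"
      using eventually_nhds_in_open[of "{..<0}" t] 2 by (auto elim!: eventually_mono)
    ultimately show ?thesis by (subst DERIV_cong_ev) auto
  next
    case 3
    \<comment> \<open>This is the modulus of the difference quotient at 0; it tends to 0 because
      \<open>p > 1\<close>.\<close>
    have "((\<lambda>h::real. \<bar>h\<bar> powr (p - 1)) \<longlongrightarrow> 0 powr (p - 1)) (at 0)"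
      using p by (intro tendsto_powr') (auto intro!: tendsto_eq_intros)
    then have "((\<lambda>h::real. \<bar>h\<bar> powr (p - 1)) \<longlongrightarrow> 0) (at 0)" by simp
    then have "((\<lambda>h::real. \<bar>h\<bar> powr p / h) \<longlongrightarrow> 0) (at 0)"
    proof (rule tendsto_rabs_zero_cancel[OF Lim_transform_eventually])
      show "\<forall>\<^sub>F h in at 0. \<bar>h\<bar> powr (p - 1) = \<bar>\<bar>h\<bar> powr p / h\<bar>"
        by (auto simp: eventually_at_filter powr_diff)
    qed
    then show ?thesis using 3 by (simp add: DERIV_def)
  qed
qed

lemma continuous_on_powr_sgn:
  fixes p :: real
  assumes "1 < p"
  shows "continuous_on UNIV (\<lambda>t::real. p * (\<bar>t\<bar> powr (p - 1) * sgn t))"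
proof -
  have "(\<lambda>t::real. p * (\<bar>t\<bar> powr (p - 1) * sgn t)) = (\<lambda>t. p * (max 0 t powr (p - 1) - max 0 (- t) powr (p - 1)))"
    by (auto simp: fun_eq_iff sgn_if)
  moreover have "continuous_on UNIV (\<lambda>t::real. p * (max 0 t powr (p - 1) - max 0 (- t) powr (p - 1)))"
    using assms by (intro continuous_intros continuous_on_powr') auto
  ultimately show ?thesis by (simp only:)
qed

context sobolev_domain
begin

lemma plap_integrand_integrable:
  assumes G: "Lp G" and H: "Lp H"
  shows "integrable \<Lambda> (\<lambda>x. norm (G x) powr (p - 2) * (G x \<bullet> H x))"
proof (rule Bochner_Integration.integrable_bound)
  show "integrable \<Lambda> (\<lambda>x. norm (G x) powr p + norm (H x) powr p)"
    using assms by (auto simp: Lp_on_def)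
  have [measurable]: "G \<in> borel_measurable \<Lambda>" "H \<in> borel_measurable \<Lambda>"
    using assms by (auto simp: Lp_on_def)
  show "(\<lambda>x. norm (G x) powr (p - 2) * (G x \<bullet> H x)) \<in> borel_measurable \<Lambda>"
    by measurable
  show "AE x in \<Lambda>. norm (norm (G x) powr (p - 2) * (G x \<bullet> H x)) \<le> norm (norm (G x) powr p + norm (H x) powr p)"
  proof (rule AE_I2)
    fix x
    have "norm (norm (G x) powr (p - 2) * (G x \<bullet> H x)) \<le> norm (G x) powr (p - 2) * (norm (G x) * norm (H x))"
      by (simp add: abs_mult mult_left_mono Cauchy_Schwarz_ineq2)
    also have "\<dots> = norm (G x) powr (p - 1) * norm (H x)"
      using powr_minus_two_mult[of "norm (G x)" p] by (simp add: mult.assoc[symmetric])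
    also have "\<dots> \<le> norm (G x) powr p + norm (H x) powr p"
      using p by (intro powr_mult_le_add) auto
    finally show "norm (norm (G x) powr (p - 2) * (G x \<bullet> H x)) \<le> norm (norm (G x) powr p + norm (H x) powr p)"
      by simp
  qed
qed

text \<open>Positivity of \<open>\<epsilon>\<close> bounds the derivative of
  \<open>(t + \<epsilon>) powr (1 - p)\<close> on the half line. The chain rule demands
  \<open>F 0 = 0\<close>, so the value at 0 is subtracted in \<open>F\<close> and its product with
  \<open>\<bar>\<phi> x\<bar> powr p\<close> is added back afterwards.\<close>

lemma picone_test_pair:
  assumes v: "pair v G" "AE x in \<Lambda>. 0 \<le> v x"
    and \<phi>: "\<phi> \<in> \<D>" and \<epsilon>: "0 < \<epsilon>"
  shows "pair (\<lambda>x. \<bar>\<phi> x\<bar> powr p * (v x + \<epsilon>) powr (1 - p))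
    (\<lambda>x. ((v x + \<epsilon>) powr (1 - p) * (p * (\<bar>\<phi> x\<bar> powr (p - 1) * sgn (\<phi> x)))) *\<^sub>R grad \<phi> x
        - ((p - 1) * (\<bar>\<phi> x\<bar> powr p * (v x + \<epsilon>) powr (- p))) *\<^sub>R G x)"
proof -
  note Lp = sobolev_pair_Lp[OF v(1)]
  have [measurable]: "v \<in> borel_measurable \<Lambda>" "G \<in> borel_measurable \<Lambda>"
    "\<phi> \<in> borel_measurable \<Lambda>" "grad \<phi> \<in> borel_measurable \<Lambda>"
    using Lp[THEN Lp_on_measurable] test_functions_measurable[OF \<phi>] by auto
  define F F' where "F t = (t + \<epsilon>) powr (1 - p) - \<epsilon> powr (1 - p)" and "F' t = (1 - p) * (t + \<epsilon>) powr (- p)" for t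
  have dF: "(F has_real_derivative F' t) (at t)" if "0 \<le> t" for t
    unfolding F_def F'_def using that \<epsilon> by (auto intro!: derivative_eq_intros)
  have cF: "continuous_on {0..} F'"
    unfolding F'_def using \<epsilon> by (auto intro!: continuous_intros)
  have bF: "\<bar>F' t\<bar> \<le> (p - 1) * \<epsilon> powr (- p)" if "0 \<le> t" for t
    unfolding F'_def using that p \<epsilon> powr_mono2'[of "- p" \<epsilon> "t + \<epsilon>"]
    by (simp add: abs_mult)
  have F0: "F 0 = 0" by (simp add: F_def)
  note w = sobolev_pair_compose_nonneg[OF v(1) dF cF F0 bF]
  have a: "C1_limit (\<lambda>x. \<bar>\<phi> x\<bar> powr p) (\<lambda>x. (p * (\<bar>\<phi> x\<bar> powr (p - 1) * sgn (\<phi> x))) *\<^sub>R grad \<phi> x)"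
    by (rule C1_limit_compose[OF \<phi> DERIV_abs_powr[OF p] continuous_on_powr_sgn[OF p]]) simp
  show ?thesis
  proof (rule sobolev_pair_cong_AE[OF sobolev_pair_add[OF sobolev_pair_mult_C1_limit[OF a w]
          sobolev_pair_cmult[OF C1_limit_sobolev_pair[OF a], of "\<epsilon> powr (1 - p)"]]])
    show "AE x in \<Lambda>. \<bar>\<phi> x\<bar> powr p * (F (max 0 (v x)) + F' 0 * min 0 (v x)) + \<epsilon> powr (1 - p) * \<bar>\<phi> x\<bar> powr p
        = \<bar>\<phi> x\<bar> powr p * (v x + \<epsilon>) powr (1 - p)"
      using v(2)
    proof eventually_elim
      case (elim x)
      then show ?case by (simp add: F_def algebra_simps)
    qed
    show "AE x in \<Lambda>. \<bar>\<phi> x\<bar> powr p *\<^sub>R F' (max 0 (v x)) *\<^sub>R G x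
          + (F (max 0 (v x)) + F' 0 * min 0 (v x)) *\<^sub>R (p * (\<bar>\<phi> x\<bar> powr (p - 1) * sgn (\<phi> x))) *\<^sub>R grad \<phi> x
          + \<epsilon> powr (1 - p) *\<^sub>R (p * (\<bar>\<phi> x\<bar> powr (p - 1) * sgn (\<phi> x))) *\<^sub>R grad \<phi> x
        = ((v x + \<epsilon>) powr (1 - p) * (p * (\<bar>\<phi> x\<bar> powr (p - 1) * sgn (\<phi> x)))) *\<^sub>R grad \<phi> x
        - ((p - 1) * (\<bar>\<phi> x\<bar> powr p * (v x + \<epsilon>) powr (- p))) *\<^sub>R G x"
      using v(2)
    proof eventually_elim
      case (elim x)
      have 1: "F (max 0 (v x)) + F' 0 * min 0 (v x) = (v x + \<epsilon>) powr (1 - p) - \<epsilon> powr (1 - p)"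
        using elim by (simp add: F_def)
      have 2: "\<bar>\<phi> x\<bar> powr p * F' (max 0 (v x)) = - ((p - 1) * (\<bar>\<phi> x\<bar> powr p * (v x + \<epsilon>) powr (- p)))"
        using elim by (simp add: F'_def algebra_simps)
      show ?case
        unfolding 1 scaleR_scaleR 2 by (simp add: scaleR_left_diff_distrib left_diff_distrib)
    qed
  qed measurable
qed

text \<open>The functional \<open>I\<close> stands for any lower bound of the flux on nonnegative
  test functions: it is 0 for the logarithmic estimate and the eigenvalue term for the Rayleigh
  bound. The second conclusion spends the whole negative term of Picone's inequality; the third
  keeps half of it.\<close>

lemma picone_integral:
  assumes v: "pair v G" "AE x in \<Lambda>. 0 \<le> v x"
    and super: "\<And>\<psi> H. pair \<psi> H \<Longrightarrow> (AE x in \<Lambda>. 0 \<le> \<psi> x) \<Longrightarrow>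
      I \<psi> \<le> flux G H"
    and \<phi>: "\<phi> \<in> \<D>" and \<epsilon>: "0 < \<epsilon>"
  shows "integrable \<Lambda> (\<lambda>x. (\<bar>\<phi> x\<bar> * norm (G x) / (v x + \<epsilon>)) powr p)"
    and "I (\<lambda>x. \<bar>\<phi> x\<bar> powr p * (v x + \<epsilon>) powr (1 - p)) \<le> energy (grad \<phi>)"
    and "2 * I (\<lambda>x. \<bar>\<phi> x\<bar> powr p * (v x + \<epsilon>) powr (1 - p))
      + (p - 1) * (\<integral>x. (\<bar>\<phi> x\<bar> * norm (G x) / (v x + \<epsilon>)) powr p \<partial>\<Lambda>)
      \<le> 2 powr p * energy (grad \<phi>)"
proof -
  note Lp = sobolev_pair_Lp[OF v(1)]
  have [measurable]: "v \<in> borel_measurable \<Lambda>" "G \<in> borel_measurable \<Lambda>"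
    "\<phi> \<in> borel_measurable \<Lambda>" "grad \<phi> \<in> borel_measurable \<Lambda>"
    using Lp[THEN Lp_on_measurable] test_functions_measurable[OF \<phi>] by auto
  let ?X = "\<lambda>x. \<bar>\<phi> x\<bar> * norm (G x) / (v x + \<epsilon>)"
  let ?\<psi> = "\<lambda>x. \<bar>\<phi> x\<bar> powr p * (v x + \<epsilon>) powr (1 - p)"
  define H where "H x = ((v x + \<epsilon>) powr (1 - p) * (p * (\<bar>\<phi> x\<bar> powr (p - 1) * sgn (\<phi> x)))) *\<^sub>R grad \<phi> x
        - ((p - 1) * (\<bar>\<phi> x\<bar> powr p * (v x + \<epsilon>) powr (- p))) *\<^sub>R G x" for x
  have \<psi>: "pair ?\<psi> H"
    unfolding H_def by (rule picone_test_pair[OF v \<phi> \<epsilon>])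
  have I: "I ?\<psi> \<le> flux G H"
    by (rule super[OF \<psi>]) simp
  have iGH: "integrable \<Lambda> (\<lambda>x. norm (G x) powr (p - 2) * (G x \<bullet> H x))"
    by (rule plap_integrand_integrable[OF Lp(2) sobolev_pair_Lp(2)[OF \<psi>]])
  have i\<phi>: "integrable \<Lambda> (\<lambda>x. norm (grad \<phi> x) powr p)"
    using Lp_on_test_function(2)[OF \<phi>] by (simp add: Lp_on_def)
  obtain M where M: "M > 0" "\<And>x. \<bar>\<phi> x\<bar> \<le> M"
    using grad_test_function(3)[OF \<phi>] by blast
  have LX: "Lp ?X"
  proof (rule Lp_on_bound[OF Lp(2), where C = "M / \<epsilon>"])
    show "AE x in \<Lambda>. norm (?X x) \<le> M / \<epsilon> * norm (G x)"
      using v(2)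
    proof eventually_elim
      case (elim x)
      have "\<bar>\<phi> x\<bar> / (v x + \<epsilon>) \<le> M / \<epsilon>"
        using elim M \<epsilon> by (intro frac_le) auto
      from mult_right_mono[OF this, of "norm (G x)"] show ?case
        using elim \<epsilon> by (simp add: abs_mult)
    qed
  qed measurable
  have "AE x in \<Lambda>. norm (?X x) powr p = ?X x powr p"
    using v(2) \<epsilon> by (auto elim!: eventually_mono)
  then show iX: "integrable \<Lambda> (\<lambda>x. ?X x powr p)"
    using LX by (intro integrable_cong_AE_imp[OF Lp_on_integrable_powr[OF LX]]) measurable
  have pw: "AE x in \<Lambda>. norm (G x) powr (p - 2) * (G x \<bullet> H x)
      \<le> p * (?X x powr (p - 1) * norm (grad \<phi> x)) - (p - 1) * ?X x powr p \<and> 0 \<le> ?X x"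
    using v(2)
  proof eventually_elim
    case (elim x)
    then show ?case
      unfolding H_def using picone_pointwise[OF p, of "v x + \<epsilon>" "G x" "\<phi> x" "grad \<phi> x"] \<epsilon> by simp
  qed
  have "flux G H \<le> energy (grad \<phi>)"
  proof (rule integral_mono_AE[OF iGH i\<phi>])
    show "AE x in \<Lambda>. norm (G x) powr (p - 2) * (G x \<bullet> H x) \<le> norm (grad \<phi> x) powr p"
      using pw
    proof eventually_elim
      case (elim x)
      then show ?case using young_powr[OF p, of "?X x" "norm (grad \<phi> x)"] by simp
    qed
  qed
  with I show "I ?\<psi> \<le> energy (grad \<phi>)" by linarith
  have "flux G H
      \<le> (\<integral>x. 2 powr p / 2 * norm (grad \<phi> x) powr p - (p - 1) / 2 * ?X x powr p \<partial>\<Lambda>)"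
  proof (rule integral_mono_AE[OF iGH])
    show "integrable \<Lambda> (\<lambda>x. 2 powr p / 2 * norm (grad \<phi> x) powr p - (p - 1) / 2 * ?X x powr p)"
      using i\<phi> iX by (intro Bochner_Integration.integrable_diff integrable_mult_right)
    show "AE x in \<Lambda>. norm (G x) powr (p - 2) * (G x \<bullet> H x) \<le> 2 powr p / 2 * norm (grad \<phi> x) powr p - (p - 1) / 2 * ?X x powr p"
      using pw
    proof eventually_elim
      case (elim x)
      \<comment> \<open>Young's inequality with the gradient doubled: after halving, it consumes
        only \<open>(p - 1) / 2 * ?X x powr p\<close>, and the remaining half stays on the good
        side. The factor \<open>2 powr p\<close> in the claim is the price.\<close>
      have "p * (?X x powr (p - 1) * (2 * norm (grad \<phi> x))) \<le> (p - 1) * ?X x powr p + (2 * norm (grad \<phi> x)) powr p"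
        using elim by (intro young_powr[OF p]) auto
      then have "2 * (p * (?X x powr (p - 1) * norm (grad \<phi> x))) \<le> (p - 1) * ?X x powr p + 2 powr p * norm (grad \<phi> x) powr p"
        by (simp add: powr_mult mult_ac)
      with elim show ?case by (simp add: field_simps)
    qed
  qed
  also have "\<dots> = 2 powr p / 2 * energy (grad \<phi>) - (p - 1) / 2 * (\<integral>x. ?X x powr p \<partial>\<Lambda>)"
    using i\<phi> iX by simp
  finally show "2 * I ?\<psi> + (p - 1) * (\<integral>x. ?X x powr p \<partial>\<Lambda>) \<le> 2 powr p * energy (grad \<phi>)"
    using I by (simp add: field_simps)
qed

end

section \<open>The strong maximum principle\<close>

text \<open>The bump of the larger box has a positive minimum on the compact smaller one; divide by
  it.\<close>

lemma test_function_ge_1_on_box: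
  fixes l u l' u' :: "'a::euclidean_space"
  assumes "cbox l u \<subseteq> box l' u'" "cbox l' u' \<subseteq> \<Omega>"
  obtains \<phi> where "\<phi> \<in> test_functions \<Omega>" "\<And>x. x \<in> cbox l u \<Longrightarrow> 1 \<le> \<phi> x"
proof (cases "cbox l u = {}")
  case True
  then show ?thesis using that test_functions_zero by blast
next
  case False
  have t: "box_bump l' u' \<in> test_functions \<Omega>"
    using assms(2) by (rule box_bump_test_function)
  have "continuous_on (cbox l u) (box_bump l' u')"
    using test_functions_continuous[OF t] by (rule continuous_on_subset) simp
  from continuous_attains_inf[OF compact_cbox False this]
  obtain y where y: "y \<in> cbox l u" "\<And>x. x \<in> cbox l u \<Longrightarrow> box_bump l' u' y \<le> box_bump l' u' x"
    by blast
  have pos: "0 < box_bump l' u' y"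
    using y(1) assms(1) by (intro box_bump_pos) auto
  show ?thesis
  proof (rule that)
    show "(\<lambda>x. 1 / box_bump l' u' y * box_bump l' u' x) \<in> test_functions \<Omega>"
      by (rule test_functions_cmult[OF t])
    show "1 \<le> 1 / box_bump l' u' y * box_bump l' u' x" if "x \<in> cbox l u" for x
      using y(2)[OF that] pos by simp
  qed
qed

text \<open>Convexity of \<open>r powr p\<close> at
  \<open>(1 - \<tau>) * (a / (1 - \<tau>)) + \<tau> * (b / \<tau>)\<close>, derived from Young's
  inequality. In contrast to \<open>norm_add_powr_le\<close>, the factor of \<open>a powr p\<close>
  tends to 1 as \<open>\<tau>\<close> tends to 0, so sharp constants survive a limit.\<close>

lemma add_powr_le:
  fixes a b p \<tau> :: real
  assumes p: "1 < p" and "0 \<le> a" "0 \<le> b" and \<tau>: "0 < \<tau>" "\<tau> < 1"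
  shows "(a + b) powr p \<le> (1 - \<tau>) powr (1 - p) * a powr p + \<tau> powr (1 - p) * b powr p"
proof -
  have *: "p * ((a + b) powr (p - 1) * c) \<le> r * ((p - 1) * (a + b) powr p) + r powr (1 - p) * c powr p"
    if "0 \<le> c" "0 < r" for c r
  proof -
    have "r * (p * ((a + b) powr (p - 1) * (c / r))) \<le> r * ((p - 1) * (a + b) powr p + (c / r) powr p)"
      using young_powr[OF p, of "a + b" "c / r"] that assms by (intro mult_left_mono) auto
    moreover have "r * (c / r) powr p = r powr (1 - p) * c powr p"
      using that by (simp add: powr_divide powr_diff)
    ultimately show ?thesis using that by (simp add: distrib_left)
  qed
  have "p * (a + b) powr p = p * ((a + b) powr (p - 1) * a) + p * ((a + b) powr (p - 1) * b)"
    using powr_minus_one_mult[of "a + b" p] assms by (simp add: distrib_left[symmetric])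
  also have "\<dots> \<le> (1 - \<tau>) * ((p - 1) * (a + b) powr p) + (1 - \<tau>) powr (1 - p) * a powr p
      + (\<tau> * ((p - 1) * (a + b) powr p) + \<tau> powr (1 - p) * b powr p)"
    using assms by (intro add_mono *) auto
  finally show ?thesis by (simp add: algebra_simps)
qed

context sobolev_domain
begin

section \<open>Extension of a Rayleigh bound by density\<close>

lemma integral_powr_le:
  assumes f: "Lp f" and g: "Lp g" and \<tau>: "0 < \<tau>" "\<tau> < 1"
  shows "energy f
    \<le> (1 - \<tau>) powr (1 - p) * energy g + \<tau> powr (1 - p) * dist_Lp f g"
proof -
  have "energy f
    \<le> (\<integral>x. (1 - \<tau>) powr (1 - p) * norm (g x) powr p + \<tau> powr (1 - p) * norm (f x - g x) powr p \<partial>\<Lambda>)"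
  proof (rule integral_mono)
    fix x
    have "norm (f x) powr p \<le> (norm (g x) + norm (f x - g x)) powr p"
      using p norm_triangle_ineq[of "g x" "f x - g x"] by (intro powr_mono2) auto
    also have "\<dots> \<le> (1 - \<tau>) powr (1 - p) * norm (g x) powr p + \<tau> powr (1 - p) * norm (f x - g x) powr p"
      using \<tau> by (intro add_powr_le p) auto
    finally show "norm (f x) powr p \<le> (1 - \<tau>) powr (1 - p) * norm (g x) powr p + \<tau> powr (1 - p) * norm (f x - g x) powr p" .
  qed (use f g in \<open>auto simp: Lp_on_integrable_powr integrable_Lp_dist\<close>)
  also have "\<dots> = (1 - \<tau>) powr (1 - p) * energy g + \<tau> powr (1 - p) * dist_Lp f g"
    using f g by (simp add: Lp_dist_def Lp_on_integrable_powr integrable_Lp_dist)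
  finally show ?thesis .
qed

text \<open>The constant \<open>\<mu>\<close> must not deteriorate. So the approximation error is
  removed first, for a fixed \<open>\<tau>\<close>, and only then does \<open>\<tau>\<close> tend to
  0, which removes the factors \<open>(1 - \<tau>) powr (1 - p)\<close>.\<close>

lemma rayleigh_bound_dense:
  assumes test: "\<And>\<phi>. \<phi> \<in> \<D> \<Longrightarrow>
      \<mu> * energy \<phi> \<le> energy (grad \<phi>)"
    and u: "pair u F" and \<mu>: "0 \<le> \<mu>"
  shows "\<mu> * energy u \<le> energy F"
proof -
  note L = sobolev_pair_Lp[OF u]
  let ?A = "\<mu> * energy u" and ?B = "\<integral>x. norm (F x) powr p \<partial>\<Lambda>"
  obtain \<phi> where \<phi>: "\<And>n::nat. \<phi> n \<in> \<D>"
    "(\<lambda>n. dist_Lp (\<phi> n) u) \<longlonglongrightarrow> 0" "(\<lambda>n. dist_Lp (grad (\<phi> n)) F) \<longlonglongrightarrow> 0"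
    using sobolev_pair_sequence[OF u] by blast
  note L\<phi> = Lp_on_test_function[OF \<phi>(1)]
  have 1: "?A \<le> (1 - \<tau>) powr (1 - p) * ((1 - \<tau>) powr (1 - p) * ?B)" if \<tau>: "0 < \<tau>" "\<tau> < 1" for \<tau>
  proof -
    define c e where "c = (1 - \<tau>) powr (1 - p)" and "e = \<tau> powr (1 - p)"
    have ce: "0 \<le> c" "0 \<le> e" by (auto simp: c_def e_def)
    have le: "?A \<le> c * (c * ?B + e * dist_Lp (grad (\<phi> n)) F) + \<mu> * (e * dist_Lp (\<phi> n) u)" for n
    proof -
      have "?A \<le> \<mu> * (c * (\<integral>x. norm (\<phi> n x) powr p \<partial>\<Lambda>) + e * dist_Lp (\<phi> n) u)"
        using integral_powr_le[OF L(1) L\<phi>(1) \<tau>] \<mu> unfolding c_def e_def Lp_dist_commute[of \<Omega> p "\<phi> n"]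
        by (intro mult_left_mono) auto
      also have "\<dots> = c * (\<mu> * (\<integral>x. norm (\<phi> n x) powr p \<partial>\<Lambda>)) + \<mu> * (e * dist_Lp (\<phi> n) u)"
        by (simp add: algebra_simps)
      also have "c * (\<mu> * (\<integral>x. norm (\<phi> n x) powr p \<partial>\<Lambda>)) \<le> c * (c * ?B + e * dist_Lp (grad (\<phi> n)) F)"
        using order_trans[OF test[OF \<phi>(1)] integral_powr_le[OF L\<phi>(2) L(2) \<tau>]] ce(1)
        unfolding c_def e_def by (intro mult_left_mono) auto
      finally show ?thesis by simp
    qed
    have "(\<lambda>n. c * (c * ?B + e * dist_Lp (grad (\<phi> n)) F) + \<mu> * (e * dist_Lp (\<phi> n) u))
      \<longlonglongrightarrow> c * (c * ?B + e * 0) + \<mu> * (e * 0)"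
      by (intro tendsto_intros \<phi>(2,3))
    then show ?thesis
      using le unfolding c_def by (intro LIMSEQ_le_const) (auto simp: c_def)
  qed
  \<comment> \<open>The double successor keeps \<open>\<tau>\<close> strictly below 1 from the index
    0 on.\<close>
  have "(\<lambda>n. 1 / real (Suc (Suc n))) \<longlonglongrightarrow> 0"
    by (rule LIMSEQ_Suc[OF LIMSEQ_Suc[OF lim_1_over_n]])
  then have "(\<lambda>n. (1 - 1 / real (Suc (Suc n))) powr (1 - p) * ((1 - 1 / real (Suc (Suc n))) powr (1 - p) * ?B))
      \<longlonglongrightarrow> (1 - 0) powr (1 - p) * ((1 - 0) powr (1 - p) * ?B)"
    by (intro tendsto_intros) auto
  then have "?A \<le> (1 - 0) powr (1 - p) * ((1 - 0) powr (1 - p) * ?B)"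
    by (rule LIMSEQ_le_const) (intro exI[of _ 0] allI impI 1, simp_all)
  then show ?thesis by simp
qed

section \<open>Logarithmic estimate and positivity of supersolutions\<close>

lemma measurable_superlevel:
  assumes "Lp v" "Q \<in> sets lebesgue" "Q \<subseteq> \<Omega>" "Measurable.pred borel P"
  shows "{x \<in> Q. P (v x)} \<in> sets lebesgue"
proof -
  have [measurable]: "v \<in> borel_measurable \<Lambda>" "Measurable.pred borel P"
    using assms by (auto simp: Lp_on_def)
  have "{x \<in> space \<Lambda>. P (v x)} \<in> sets \<Lambda>"
    by measurable
  then have "{x \<in> \<Omega>. P (v x)} \<in> sets lebesgue"
    using \<Omega>_sets by (simp add: sets_restrict_space_iff space_restrict_space)
  then have "Q \<inter> {x \<in> \<Omega>. P (v x)} \<in> sets lebesgue"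
    using assms(2) by blast
  also have "Q \<inter> {x \<in> \<Omega>. P (v x)} = {x \<in> Q. P (v x)}"
    using assms(3) by auto
  finally show ?thesis .
qed

text \<open>The integrand is a.e. the norm of the gradient of \<open>ln (v + \<epsilon>)\<close> on
  \<open>Q\<close>. Since \<open>\<phi> \<ge> 1\<close> there, it is at most the Picone quantity
  \<open>X\<close>, and \<open>X \<le> 1 + X powr p\<close>; the surviving half in
  \<open>picone_integral\<close> bounds the integral of the power. The right-hand side is free of
  \<open>\<epsilon>\<close>.\<close>

lemma log_gradient_bound:
  assumes v: "pair v G" "AE x in \<Lambda>. 0 \<le> v x"
    and super: "\<And>\<psi> H. pair \<psi> H \<Longrightarrow> (AE x in \<Lambda>. 0 \<le> \<psi> x) \<Longrightarrow>
      0 \<le> flux G H"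
    and Q: "Q \<in> sets lebesgue" "Q \<subseteq> \<Omega>" and \<phi>: "\<phi> \<in> \<D>" "\<And>x. x \<in> Q \<Longrightarrow> 1 \<le> \<phi> x" and \<epsilon>: "0 < \<epsilon>"
  shows "(\<integral>x. indicator Q x * norm ((1 / (max 0 (v x) + \<epsilon>)) *\<^sub>R G x) \<partial>\<Lambda>)
    \<le> measure \<Lambda> \<Omega> + 2 powr p / (p - 1) * energy (grad \<phi>)"
proof -
  note pi = picone_integral[OF v, of "\<lambda>_. 0", OF super \<phi>(1) \<epsilon>]
  let ?X = "\<lambda>x. \<bar>\<phi> x\<bar> * norm (G x) / (v x + \<epsilon>)"
  have [measurable]: "v \<in> borel_measurable \<Lambda>" "G \<in> borel_measurable \<Lambda>"
    using sobolev_pair_Lp[OF v(1), THEN Lp_on_measurable] by auto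
  have [measurable]: "Q \<in> sets \<Lambda>"
    using Q \<Omega>_sets by (simp add: sets_restrict_space_iff)
  have i: "integrable \<Lambda> (\<lambda>x. 1 + ?X x powr p)"
    using pi(1) by simp
  have le: "AE x in \<Lambda>. indicator Q x * norm ((1 / (max 0 (v x) + \<epsilon>)) *\<^sub>R G x) \<le> 1 + ?X x powr p"
    using v(2)
  proof eventually_elim
    case (elim x)
    show ?case
    proof (cases "x \<in> Q")
      case True
      have "1 * norm (G x) \<le> \<bar>\<phi> x\<bar> * norm (G x)"
        using \<phi>(2)[OF True] by (intro mult_right_mono) auto
      then have "norm ((1 / (max 0 (v x) + \<epsilon>)) *\<^sub>R G x) \<le> ?X x"
        using elim \<epsilon> by (simp add: divide_right_mono)
      also have "?X x \<le> 1 + ?X x powr p"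
        using powr_mult_le_add[OF p, of 1 "?X x"] elim \<epsilon> by simp
      finally show ?thesis using True by simp
    next
      case False
      then show ?thesis by simp
    qed
  qed
  have "(\<integral>x. indicator Q x * norm ((1 / (max 0 (v x) + \<epsilon>)) *\<^sub>R G x) \<partial>\<Lambda>)
    \<le> (\<integral>x. 1 + ?X x powr p \<partial>\<Lambda>)"
  proof (rule integral_mono_AE[OF _ i le])
    show "integrable \<Lambda> (\<lambda>x. indicator Q x * norm ((1 / (max 0 (v x) + \<epsilon>)) *\<^sub>R G x))"
    proof (rule Bochner_Integration.integrable_bound[OF i])
      show "(\<lambda>x. indicator Q x * norm ((1 / (max 0 (v x) + \<epsilon>)) *\<^sub>R G x)) \<in> borel_measurable \<Lambda>"
        by measurable
      show "AE x in \<Lambda>. norm (indicator Q x * norm ((1 / (max 0 (v x) + \<epsilon>)) *\<^sub>R G x)) \<le> norm (1 + ?X x powr p)"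
        using le
      proof eventually_elim
        case (elim x)
        moreover have "0 \<le> indicator Q x * norm ((1 / (max 0 (v x) + \<epsilon>)) *\<^sub>R G x)"
          by (intro mult_nonneg_nonneg) auto
        ultimately show ?case
          unfolding real_norm_def by linarith
      qed
    qed
  qed
  also have "\<dots> = measure \<Lambda> \<Omega> + (\<integral>x. ?X x powr p \<partial>\<Lambda>)"
    using pi(1) by (simp add: space_restrict_space)
  also have "(\<integral>x. ?X x powr p \<partial>\<Lambda>) \<le> 2 powr p / (p - 1) * energy (grad \<phi>)"
    using pi(3) p by (simp add: field_simps)
  finally show ?thesis by simp
qed

text \<open>Apply the Poincare inequality to \<open>ln (1 + v / \<epsilon>)\<close>, which vanishes where \<open>v\<close> does: its gradient
  is bounded in \<open>L\<^sup>1\<close> independently of \<open>\<epsilon>\<close>, whereas the function itself tends to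
  infinity where \<open>v\<close> is positive.\<close>

lemma supersolution_dichotomy:
  assumes v: "pair v G" "AE x in \<Lambda>. 0 \<le> v x"
    and super: "\<And>\<psi> H. pair \<psi> H \<Longrightarrow> (AE x in \<Lambda>. 0 \<le> \<psi> x) \<Longrightarrow>
      0 \<le> flux G H"
    and sub: "cbox l u \<subseteq> box l' u'" "cbox l' u' \<subseteq> \<Omega>"
  shows "negligible {x \<in> box l u. v x \<noteq> 0} \<or> negligible {x \<in> box l u. v x = 0}"
proof (rule disjCI)
  assume nz: "\<not> negligible {x \<in> box l u. v x = 0}"
  define Q where "Q = box l u"
  have Q: "Q \<in> sets borel" "convex Q" "Q \<subseteq> \<Omega>" "Q \<in> sets lebesgue"
    using sub box_subset_cbox[of l u] box_subset_cbox[of l' u'] by (auto simp: Q_def convex_box)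
  note L = sobolev_pair_Lp[OF v(1)]
  have [measurable]: "v \<in> borel_measurable \<Lambda>"
    using L(1) by (rule Lp_on_measurable)
  \<comment> \<open>The zero set of \<open>v\<close> is only Lebesgue measurable, while the Poincare
    inequality is stated for Borel sets; \<open>main_part\<close> supplies a Borel subset of the
    same measure.\<close>
  define Z where "Z = main_part lborel {x \<in> Q. v x = 0}"
  have Z0: "{x \<in> Q. v x = 0} \<in> sets lebesgue"
    by (rule measurable_superlevel[OF L(1) Q(4,3)]) measurable
  have Z: "Z \<in> sets borel" "Z \<subseteq> {x \<in> Q. v x = 0}" "emeasure lebesgue {x \<in> Q. v x = 0} = emeasure lborel Z"
    using main_part_sets[OF Z0] main_part_null_part_Un[OF Z0] emeasure_completion[OF Z0]
    by (auto simp: Z_def)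
  have ZQ: "Z \<subseteq> Q" using Z(2) by auto
  define z where "z = measure lborel Z"
  have z: "z > 0"
  proof -
    have "emeasure lborel Z \<noteq> 0"
      using nz Z(3) Z0 by (auto simp: negligible_iff_emeasure0 Q_def)
    moreover have "emeasure lborel Z < \<infinity>"
      by (rule emeasure_bounded_finite[OF bounded_subset[OF bounded_box ZQ[unfolded Q_def]]])
    ultimately have "ennreal z \<noteq> 0"
      unfolding z_def using emeasure_eq_ennreal_measure[of lborel Z] by simp
    then show ?thesis
      by (simp add: z_def order_less_le)
  qed
  obtain B where B: "\<And>x. x \<in> Q \<Longrightarrow> norm x \<le> B"
    using bounded_box[of l u] by (auto simp: Q_def bounded_iff)
  have diam: "norm (x - y) \<le> 2 * \<bar>B\<bar>" if "x \<in> Q" "y \<in> Q" for x y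
    using B[OF that(1)] B[OF that(2)] norm_triangle_ineq4[of x y] by linarith
  obtain \<phi> where \<phi>: "\<phi> \<in> \<D>" "\<And>x. x \<in> Q \<Longrightarrow> 1 \<le> \<phi> x"
    by (rule test_function_ge_1_on_box[OF sub]) (use box_subset_cbox[of l u] in \<open>auto simp: Q_def\<close>)
  define K where "K = 2 * \<bar>B\<bar> * 2 ^ DIM('a) * measure lborel Q *
    (measure \<Lambda> \<Omega> + 2 powr p / (p - 1) * energy (grad \<phi>))"
  have bound: "z * (ln (1 + s / \<epsilon>) * measure \<Lambda> {x \<in> Q. s \<le> v x}) \<le> K" if s: "0 < s" and \<epsilon>: "0 < \<epsilon>" for s \<epsilon>
  proof -
    define F F' where "F t = ln (1 + t / \<epsilon>)" and "F' t = 1 / (t + \<epsilon>)" for t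
    have dF: "(F has_real_derivative F' t) (at t)" if "0 \<le> t" for t
      unfolding F_def F'_def using that \<epsilon> by (auto intro!: derivative_eq_intros simp: field_simps)
    have cF: "continuous_on {0..} F'"
      unfolding F'_def using \<epsilon> by (auto intro!: continuous_intros)
    have bF: "\<bar>F' t\<bar> \<le> 1 / \<epsilon>" if "0 \<le> t" for t
      unfolding F'_def using that \<epsilon> by (auto intro!: divide_left_mono)
    have F0: "F 0 = 0" by (simp add: F_def)
    define w where "w x = F (max 0 (v x)) + F' 0 * min 0 (v x)" for x
    have w: "pair w (\<lambda>x. (1 / (max 0 (v x) + \<epsilon>)) *\<^sub>R G x)"
      using sobolev_pair_compose_nonneg[OF v(1) dF cF F0 bF] by (simp add: w_def[abs_def] F'_def)
    have wi: "integrable \<Lambda> w"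
      by (rule Lp_on_integrable[OF sobolev_pair_Lp(1)[OF w]])
    let ?T = "{x \<in> Q. s \<le> v x}"
    have T: "?T \<in> sets \<Lambda>"
      using measurable_superlevel[OF L(1) Q(4,3), of "\<lambda>t. s \<le> t"] Q(3) \<Omega>_sets
      by (auto simp: sets_restrict_space_iff)
    have Q': "Q \<in> sets \<Lambda>"
      using Q \<Omega>_sets by (simp add: sets_restrict_space_iff)
    have "ln (1 + s / \<epsilon>) * measure \<Lambda> ?T = (\<integral>x. ln (1 + s / \<epsilon>) * indicator ?T x \<partial>\<Lambda>)"
    proof -
      have "?T \<inter> \<Omega> = ?T" using Q(3) by auto
      then show ?thesis using T by (simp add: space_restrict_space)
    qed
    also have "\<dots> \<le> (\<integral>x. indicator Q x * \<bar>w x\<bar> \<partial>\<Lambda>)"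
    proof (rule integral_mono)
      show "integrable \<Lambda> (\<lambda>x. ln (1 + s / \<epsilon>) * indicator ?T x)"
        using T by (simp add: less_top[symmetric] emeasure_finite)
      show "integrable \<Lambda> (\<lambda>x. indicator Q x * \<bar>w x\<bar>)"
        using integrable_mult_indicator[OF Q' integrable_abs[OF wi]] by simp
      show "ln (1 + s / \<epsilon>) * indicator ?T x \<le> indicator Q x * \<bar>w x\<bar>" for x
      proof (cases "x \<in> ?T")
        case True
        have "ln (1 + s / \<epsilon>) \<le> ln (1 + v x / \<epsilon>)"
          using True s \<epsilon> by (intro ln_mono) (auto simp: divide_right_mono add_pos_pos)
        also have "\<dots> = w x" using True s by (simp add: w_def F_def)
        finally show ?thesis using True by simp
      qed simp
    qed
    finally have "z * (ln (1 + s / \<epsilon>) * measure \<Lambda> ?T) \<le> z * (\<integral>x. indicator Q x * \<bar>w x\<bar> \<partial>\<Lambda>)"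
      using z by (intro mult_left_mono) auto
    also have "\<dots> \<le> measure lborel Q * (\<integral>x. indicator Z x * \<bar>w x\<bar> \<partial>\<Lambda>)
      + 2 * \<bar>B\<bar> * 2 ^ DIM('a) * measure lborel Q * (\<integral>x. indicator Q x * norm ((1 / (max 0 (v x) + \<epsilon>)) *\<^sub>R G x) \<partial>\<Lambda>)"
      unfolding z_def by (rule sobolev_pair_poincare[OF w Q(1-3) diam _ Z(1) ZQ]) auto
    also have "(\<integral>x. indicator Z x * \<bar>w x\<bar> \<partial>\<Lambda>) = 0"
    proof -
      have "(\<lambda>x. indicator Z x * \<bar>w x\<bar>) = (\<lambda>x. 0)"
      proof
        show "indicator Z x * \<bar>w x\<bar> = 0" for x
          using Z(2) by (cases "x \<in> Z") (auto simp: w_def F_def)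
      qed
      then show ?thesis by (simp only: Bochner_Integration.integral_zero)
    qed
    also have "2 * \<bar>B\<bar> * 2 ^ DIM('a) * measure lborel Q * (\<integral>x. indicator Q x * norm ((1 / (max 0 (v x) + \<epsilon>)) *\<^sub>R G x) \<partial>\<Lambda>) \<le> K"
      unfolding K_def by (intro mult_left_mono log_gradient_bound[OF v super Q(4,3) \<phi> \<epsilon>]) auto
    finally show ?thesis by simp
  qed
  have null: "negligible {x \<in> Q. s \<le> v x}" if s: "0 < s" for s
  proof -
    define m where "m = measure \<Lambda> {x \<in> Q. s \<le> v x}"
    have "m = 0"
    proof (rule ccontr)
      assume "m \<noteq> 0"
      then have m: "m > 0" by (simp add: m_def order_less_le)
      \<comment> \<open>Apply the bound with \<open>\<epsilon> = s / exp a\<close>: the logarithm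
        becomes \<open>ln (1 + exp a)\<close>, which exceeds \<open>a\<close>, although by the
        choice of \<open>a\<close> the bound says that it is at most \<open>a\<close>.\<close>
      define a where "a = K / (z * m)"
      have "a < ln (1 + exp a)"
        using ln_less_cancel_iff[of "exp a" "1 + exp a"] by (simp add: add_pos_pos)
      moreover have "ln (1 + exp a) \<le> a"
        using bound[OF s, of "s / exp a"] s m z by (simp add: m_def[symmetric] a_def field_simps)
      ultimately show False by simp
    qed
    moreover have T: "{x \<in> Q. s \<le> v x} \<in> sets lebesgue"
      by (rule measurable_superlevel[OF L(1) Q(4,3)]) measurable
    moreover have "emeasure \<Lambda> {x \<in> Q. s \<le> v x} = emeasure lebesgue {x \<in> Q. s \<le> v x}"
      using Q(3) \<Omega>_sets by (intro emeasure_restrict_space) auto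
    moreover have "emeasure \<Lambda> {x \<in> Q. s \<le> v x} = ennreal m"
      unfolding m_def by (rule emeasure_eq_measure)
    ultimately show ?thesis
      by (simp add: negligible_iff_emeasure0)
  qed
  have "negligible ({x \<in> \<Omega>. \<not> 0 \<le> v x} \<union> (\<Union>n. {x \<in> Q. 1 / real (Suc n) \<le> v x}))"
    using v(2) null \<Omega>_sets by (intro negligible_Un negligible_countable_Union) (auto simp: AE_lebesgue_on_iff_negligible)
  moreover have "{x \<in> box l u. v x \<noteq> 0} \<subseteq> {x \<in> \<Omega>. \<not> 0 \<le> v x} \<union> (\<Union>n. {x \<in> Q. 1 / real (Suc n) \<le> v x})"
  proof
    fix x assume x: "x \<in> {x \<in> box l u. v x \<noteq> 0}"
    then have xQ: "x \<in> Q" by (simp add: Q_def)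
    show "x \<in> {x \<in> \<Omega>. \<not> 0 \<le> v x} \<union> (\<Union>n. {x \<in> Q. 1 / real (Suc n) \<le> v x})"
    proof (cases "0 < v x")
      case True
      then obtain n where "1 / real (Suc n) < v x"
        using reals_Archimedean[of "v x"] by (auto simp: inverse_eq_divide)
      then show ?thesis using xQ by (auto intro!: exI[of _ n] less_imp_le simp del: of_nat_Suc)
    qed (use x xQ Q(3) in auto)
  qed
  ultimately show "negligible {x \<in> box l u. v x \<noteq> 0}"
    by (rule negligible_subset)
qed

text \<open>Let \<open>U\<close> and \<open>V\<close> consist of the points near which
  \<open>v\<close> is a.e. zero, respectively a.e. nonzero. Both are open, the dichotomy on small
  boxes makes them cover \<open>\<Omega>\<close>, and they are disjoint since a nonempty open set is
  not negligible. A connected \<open>\<Omega>\<close> therefore lies in one of them.\<close>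

lemma strong_maximum_principle:
  assumes v: "pair v G" "AE x in \<Lambda>. 0 \<le> v x" "\<not> (AE x in \<Lambda>. v x = 0)"
    and super: "\<And>\<psi> H. pair \<psi> H \<Longrightarrow> (AE x in \<Lambda>. 0 \<le> \<psi> x) \<Longrightarrow>
      0 \<le> flux G H"
    and conn: "connected \<Omega>"
  shows "AE x in \<Lambda>. 0 < v x"
proof -
  define U where "U = {x \<in> \<Omega>. \<exists>W. open W \<and> x \<in> W \<and> negligible {y \<in> \<Omega> \<inter> W. v y \<noteq> 0}}"
  define V where "V = {x \<in> \<Omega>. \<exists>W. open W \<and> x \<in> W \<and> negligible {y \<in> \<Omega> \<inter> W. v y = 0}}"
  have opn: "open {x \<in> \<Omega>. \<exists>W. open W \<and> x \<in> W \<and> negligible {y \<in> \<Omega> \<inter> W. P y}}" for P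
  proof -
    have "{x \<in> \<Omega>. \<exists>W. open W \<and> x \<in> W \<and> negligible {y \<in> \<Omega> \<inter> W. P y}}
        = \<Omega> \<inter> \<Union> {W. open W \<and> negligible {y \<in> \<Omega> \<inter> W. P y}}"
      by auto
    then show ?thesis using open_\<Omega> by auto
  qed
  have oUV: "open U" "open V"
    unfolding U_def V_def by (rule opn)+
  have "\<Omega> \<subseteq> U \<union> V"
  proof
    fix x assume x: "x \<in> \<Omega>"
    obtain l' u' where 1: "cbox l' u' \<subseteq> \<Omega>" "x \<in> box l' u'"
      by (rule open_contains_cbox[OF open_\<Omega> x])
    obtain l u where 2: "cbox l u \<subseteq> box l' u'" "x \<in> box l u"
      by (rule open_contains_cbox[OF open_box 1(2)])
    have *: "\<Omega> \<inter> box l u = box l u"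
      using 1 2 box_subset_cbox by blast
    have "negligible {x \<in> box l u. v x \<noteq> 0} \<or> negligible {x \<in> box l u. v x = 0}"
      by (rule supersolution_dichotomy[OF v(1,2) _ 2(1) 1(1)]) (rule super)
    then show "x \<in> U \<union> V"
    proof
      assume "negligible {x \<in> box l u. v x \<noteq> 0}"
      then have "x \<in> U"
        unfolding U_def by (intro CollectI conjI x exI[of _ "box l u"] open_box 2(2)) (simp only: *)
      then show ?thesis ..
    next
      assume "negligible {x \<in> box l u. v x = 0}"
      then have "x \<in> V"
        unfolding V_def by (intro CollectI conjI x exI[of _ "box l u"] open_box 2(2)) (simp only: *)
      then show ?thesis ..
    qed
  qed
  moreover have "U \<inter> V \<inter> \<Omega> = {}"
  proof (rule equals0I)
    fix x assume "x \<in> U \<inter> V \<inter> \<Omega>"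
    then obtain W1 W2 where W: "open W1" "x \<in> W1" "negligible {y \<in> \<Omega> \<inter> W1. v y \<noteq> 0}"
      "open W2" "x \<in> W2" "negligible {y \<in> \<Omega> \<inter> W2. v y = 0}" and x: "x \<in> \<Omega>"
      by (auto simp: U_def V_def)
    have "negligible (\<Omega> \<inter> W1 \<inter> W2)"
      by (rule negligible_subset[OF negligible_Un[OF W(3) W(6)]]) auto
    moreover have "open (\<Omega> \<inter> W1 \<inter> W2)" "\<Omega> \<inter> W1 \<inter> W2 \<noteq> {}"
      using W x open_\<Omega> by auto
    ultimately show False using open_not_negligible by blast
  qed
  ultimately have "U \<inter> \<Omega> = {} \<or> V \<inter> \<Omega> = {}"
    using connectedD[OF conn oUV] by blast
  then show ?thesis
  proof
    assume "U \<inter> \<Omega> = {}"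
    have "AE x in \<Lambda>. v x \<noteq> 0"
    proof (rule AE_lebesgue_onI_cover[OF open_\<Omega>])
      fix x assume "x \<in> \<Omega>"
      then have "x \<in> V" using \<open>\<Omega> \<subseteq> U \<union> V\<close> \<open>U \<inter> \<Omega> = {}\<close> by blast
      then show "\<exists>W. open W \<and> x \<in> W \<and> negligible {y \<in> \<Omega> \<inter> W. \<not> v y \<noteq> 0}"
        by (simp add: V_def)
    qed
    then show ?thesis
      using v(2) by eventually_elim auto
  next
    assume "V \<inter> \<Omega> = {}"
    have "AE x in \<Lambda>. v x = 0"
    proof (rule AE_lebesgue_onI_cover[OF open_\<Omega>])
      fix x assume "x \<in> \<Omega>"
      then have "x \<in> U" using \<open>\<Omega> \<subseteq> U \<union> V\<close> \<open>V \<inter> \<Omega> = {}\<close> by blast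
      then show "\<exists>W. open W \<and> x \<in> W \<and> negligible {y \<in> \<Omega> \<inter> W. \<not> v y = 0}"
        by (simp add: U_def)
    qed
    then show ?thesis using v(3) by simp
  qed
qed

section \<open>Comparison of Rayleigh quotients\<close>


text \<open>Integrate Young's inequality for the normalised functions \<open>s / \<alpha>\<close>
  and \<open>t / \<beta>\<close>. The deficit \<open>h\<close> is nonnegative and its integral
  measures the gap in Hoelder's inequality; equality forces \<open>h = 0\<close> a.e., and
  strictness in Young's inequality then identifies the two normalised functions.\<close>

lemma holder_powr:
  assumes s: "Lp s" "\<And>x. 0 \<le> s x" and t: "Lp t" "\<And>x. 0 \<le> t x"
    and \<alpha>: "0 < \<alpha>" "(\<integral>x. s x powr p \<partial>\<Lambda>) = \<alpha> powr p"
    and \<beta>: "0 < \<beta>" "(\<integral>x. t x powr p \<partial>\<Lambda>) = \<beta> powr p"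
  shows "integrable \<Lambda> (\<lambda>x. s x powr (p - 1) * t x)"
    and "(\<integral>x. s x powr (p - 1) * t x \<partial>\<Lambda>) \<le> \<alpha> powr (p - 1) * \<beta>"
    and "(\<integral>x. s x powr (p - 1) * t x \<partial>\<Lambda>) = \<alpha> powr (p - 1) * \<beta> \<Longrightarrow>
      AE x in \<Lambda>. s x / \<alpha> = t x / \<beta>"
proof -
  have [measurable]: "s \<in> borel_measurable \<Lambda>" "t \<in> borel_measurable \<Lambda>"
    using s t by (auto simp: Lp_on_def)
  have js: "integrable \<Lambda> (\<lambda>x. s x powr p)" and jt: "integrable \<Lambda> (\<lambda>x. t x powr p)"
    using Lp_on_integrable_powr[OF s(1)] Lp_on_integrable_powr[OF t(1)] s(2) t(2) by auto
  show i: "integrable \<Lambda> (\<lambda>x. s x powr (p - 1) * t x)"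
  proof (rule Bochner_Integration.integrable_bound)
    show "integrable \<Lambda> (\<lambda>x. s x powr p + t x powr p)"
      using js jt by simp
    show "AE x in \<Lambda>. norm (s x powr (p - 1) * t x) \<le> norm (s x powr p + t x powr p)"
      using s(2) t(2) powr_mult_le_add[OF p] by (intro AE_I2) (auto simp: abs_mult)
  qed measurable
  define c where "c = \<alpha> powr (p - 1) * \<beta>"
  have c: "c > 0" using \<alpha> \<beta> by (simp add: c_def)
  define h where "h x = (p - 1) * (s x / \<alpha>) powr p + (t x / \<beta>) powr p - p * ((s x / \<alpha>) powr (p - 1) * (t x / \<beta>))" for x
  have h_eq: "h x = (p - 1) / \<alpha> powr p * s x powr p + 1 / \<beta> powr p * t x powr p - p / c * (s x powr (p - 1) * t x)" for x
    using \<alpha> \<beta> s(2) t(2) by (simp add: h_def c_def powr_divide)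
  have h0: "0 \<le> h x" for x
    using young_powr[OF p, of "s x / \<alpha>" "t x / \<beta>"] \<alpha>(1) \<beta>(1) s(2) t(2) by (simp add: h_def)
  have hi: "integrable \<Lambda> h"
    unfolding h_eq[abs_def] using js jt i by auto
  have int: "(\<integral>x. h x \<partial>\<Lambda>) = p - p / c * (\<integral>x. s x powr (p - 1) * t x \<partial>\<Lambda>)"
    unfolding h_eq using js jt i \<alpha> \<beta> by simp
  have "0 \<le> (\<integral>x. h x \<partial>\<Lambda>)"
    using h0 by simp
  then have "p * (\<integral>x. s x powr (p - 1) * t x \<partial>\<Lambda>) \<le> p * c"
    unfolding int using c by (simp add: field_simps)
  then show "(\<integral>x. s x powr (p - 1) * t x \<partial>\<Lambda>) \<le> \<alpha> powr (p - 1) * \<beta>"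
    using p by (simp add: c_def)
  assume "(\<integral>x. s x powr (p - 1) * t x \<partial>\<Lambda>) = \<alpha> powr (p - 1) * \<beta>"
  then have "(\<integral>x. h x \<partial>\<Lambda>) = 0"
    unfolding int using c by (simp add: c_def[symmetric])
  then have "AE x in \<Lambda>. h x = 0"
    using integral_nonneg_eq_0_iff_AE[OF hi] h0 by simp
  then show "AE x in \<Lambda>. s x / \<alpha> = t x / \<beta>"
  proof eventually_elim
    case (elim x)
    then show ?case
      using young_powr_strict[OF p, of "s x / \<alpha>" "t x / \<beta>"] \<alpha>(1) \<beta>(1) s(2)[of x] t(2)[of x]
      by (force simp: h_def)
  qed
qed

lemma powr_integral_pos:
  fixes u :: "'a \<Rightarrow> 'b::euclidean_space"
  assumes u: "Lp u" and "\<not> (AE x in \<Lambda>. u x = 0)"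
  shows "0 < energy u"
proof -
  have "energy u \<noteq> 0"
    using integral_nonneg_eq_0_iff_AE[OF Lp_on_integrable_powr[OF u]] assms(2) by simp
  then show ?thesis by (simp add: order_less_le)
qed

section \<open>Rayleigh quotients and the p-Laplacian form in terms of pairs\<close>

lemma rayleigh_eq:
  assumes "pair u F"
  shows "rayleigh \<Omega> p u = energy F / (\<integral>x. \<bar>u x\<bar> powr p \<partial>\<Lambda>)"
  unfolding rayleigh_def
  using weak_grad_integral[OF sobolev_pair_has_weak_gradient[OF assms] sobolev_pair_Lp(2)[OF assms]] by simp

lemma rayleigh_cmult_AE:
  assumes u: "pair u F" and w: "pair w H"
    and k: "k \<noteq> 0" and eq: "AE x in \<Lambda>. w x = k * u x"
  shows "rayleigh \<Omega> p w = rayleigh \<Omega> p u"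
proof -
  have Hk: "AE x in \<Lambda>. H x = k *\<^sub>R F x"
    by (rule sobolev_pair_unique[OF w sobolev_pair_cmult[OF u] eq])
  note m = sobolev_pair_Lp[OF u, THEN Lp_on_measurable] sobolev_pair_Lp[OF w, THEN Lp_on_measurable]
  note [measurable] = m
  have "energy H = (\<integral>x. \<bar>k\<bar> powr p * norm (F x) powr p \<partial>\<Lambda>)"
    using Hk by (intro integral_cong_AE) (measurable, auto elim!: eventually_mono simp: powr_mult)
  moreover have "(\<integral>x. \<bar>w x\<bar> powr p \<partial>\<Lambda>) = (\<integral>x. \<bar>k\<bar> powr p * \<bar>u x\<bar> powr p \<partial>\<Lambda>)"
    using eq by (intro integral_cong_AE) (measurable, auto elim!: eventually_mono simp: powr_mult abs_mult)
  ultimately show ?thesis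
    unfolding rayleigh_eq[OF u] rayleigh_eq[OF w] using k by simp
qed

lemma plap_form_eq:
  assumes v: "pair v G" and \<psi>: "pair \<psi> H"
  shows "plap_form \<Omega> p v \<psi> = flux G H"
  unfolding plap_form_def
proof (rule integral_cong_AE)
  note [measurable] = sobolev_pair_Lp(2)[OF v, THEN Lp_on_measurable] sobolev_pair_Lp(2)[OF \<psi>, THEN Lp_on_measurable]
    weak_grad_measurable[OF sobolev_pair_has_weak_gradient[OF v] sobolev_pair_Lp(2)[OF v]]
    weak_grad_measurable[OF sobolev_pair_has_weak_gradient[OF \<psi>] sobolev_pair_Lp(2)[OF \<psi>]]
  show "(\<lambda>x. norm (weak_grad \<Omega> v x) powr (p - 2) * (weak_grad \<Omega> v x \<bullet> weak_grad \<Omega> \<psi> x)) \<in> borel_measurable \<Lambda>"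
    "(\<lambda>x. norm (G x) powr (p - 2) * (G x \<bullet> H x)) \<in> borel_measurable \<Lambda>"
    by measurable
  show "AE x in \<Lambda>. norm (weak_grad \<Omega> v x) powr (p - 2) * (weak_grad \<Omega> v x \<bullet> weak_grad \<Omega> \<psi> x) = norm (G x) powr (p - 2) * (G x \<bullet> H x)"
    using weak_grad_AE[OF sobolev_pair_has_weak_gradient[OF v]] weak_grad_AE[OF sobolev_pair_has_weak_gradient[OF \<psi>]]
    by eventually_elim simp
qed

text \<open>For a test function, Picone's inequality bounds \<open>\<mu>\<close> times the integral
  of \<open>J n\<close>. As \<open>\<epsilon> n\<close> tends to 0, \<open>J n\<close> tends to
  \<open>norm (\<phi> x) powr p\<close> wherever \<open>v x > 0\<close>, which is a.e., and it never
  exceeds this limit, so dominated convergence applies. Density then covers all of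
  \<open>W01p\<close>.\<close>

lemma positive_eigenfunction_bound:
  assumes v: "pair v G" "AE x in \<Lambda>. 0 < v x" and \<mu>: "0 \<le> \<mu>"
    and eig: "\<And>\<psi> H. pair \<psi> H \<Longrightarrow>
      flux G H = \<mu> * (\<integral>x. v x powr (p - 1) * \<psi> x \<partial>\<Lambda>)"
    and u: "pair u F"
  shows "\<mu> * energy u \<le> energy F"
proof (rule rayleigh_bound_dense[OF _ u \<mu>])
  fix \<phi> assume \<phi>: "\<phi> \<in> \<D>"
  have v0: "AE x in \<Lambda>. 0 \<le> v x"
    using v(2) by eventually_elim simp
  note [measurable] = sobolev_pair_Lp(1)[OF v(1), THEN Lp_on_measurable] test_functions_measurable[OF \<phi>]
  define \<epsilon> where "\<epsilon> n = 1 / real (Suc n)" for n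
  have \<epsilon>: "0 < \<epsilon> n" for n by (simp add: \<epsilon>_def)
  have \<epsilon>0: "\<epsilon> \<longlonglongrightarrow> 0" unfolding \<epsilon>_def by (rule LIMSEQ_Suc[OF lim_1_over_n])
  define J where "J n x = v x powr (p - 1) * (\<bar>\<phi> x\<bar> powr p * (v x + \<epsilon> n) powr (1 - p))" for n x
  have le: "\<mu> * (\<integral>x. J n x \<partial>\<Lambda>) \<le> energy (grad \<phi>)" for n
    unfolding J_def
    by (rule picone_integral(2)[OF v(1) v0 _ \<phi> \<epsilon>, of "\<lambda>\<psi>. \<mu> * (\<integral>x. v x powr (p - 1) * \<psi> x \<partial>\<Lambda>)"])
       (simp add: eig)
  have "(\<lambda>n. \<integral>x. J n x \<partial>\<Lambda>) \<longlonglongrightarrow> energy \<phi>"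
  proof (rule integral_dominated_convergence)
    show "integrable \<Lambda> (\<lambda>x. norm (\<phi> x) powr p)"
      by (rule Lp_on_integrable_powr[OF Lp_on_test_function(1)[OF \<phi>]])
    show "J n \<in> borel_measurable \<Lambda>" for n
      unfolding J_def by measurable
    show "AE x in \<Lambda>. (\<lambda>n. J n x) \<longlonglongrightarrow> norm (\<phi> x) powr p"
      using v(2)
    proof eventually_elim
      case (elim x)
      have "(\<lambda>n. J n x) \<longlonglongrightarrow> v x powr (p - 1) * (\<bar>\<phi> x\<bar> powr p * (v x + 0) powr (1 - p))"
        unfolding J_def using elim by (intro tendsto_intros \<epsilon>0) auto
      also have "v x powr (p - 1) * (\<bar>\<phi> x\<bar> powr p * (v x + 0) powr (1 - p)) = norm (\<phi> x) powr p"
        using elim by (simp add: powr_diff)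
      finally show ?case .
    qed
    show "AE x in \<Lambda>. norm (J n x) \<le> norm (\<phi> x) powr p" for n
      using v(2)
    proof eventually_elim
      case (elim x)
      have "(v x + \<epsilon> n) powr (1 - p) \<le> v x powr (1 - p)"
        using elim \<epsilon>[of n] p by (intro powr_mono2') auto
      then have "J n x \<le> v x powr (p - 1) * (\<bar>\<phi> x\<bar> powr p * v x powr (1 - p))"
        unfolding J_def by (intro mult_left_mono) auto
      also have "\<dots> = norm (\<phi> x) powr p"
        using elim by (simp add: powr_diff)
      finally show ?case by (simp add: J_def)
    qed
  qed measurable
  then have "(\<lambda>n. \<mu> * (\<integral>x. J n x \<partial>\<Lambda>)) \<longlonglongrightarrow> \<mu> * energy \<phi>"
    by (rule tendsto_mult_left)
  then show "\<mu> * energy \<phi> \<le> energy (grad \<phi>)"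
    by (rule LIMSEQ_le_const2) (use le in blast)
qed

text \<open>The right-hand side of the equation is nonnegative on nonnegative test functions, so the
  strong maximum principle makes \<open>v\<close> positive. Testing with \<open>v\<close> itself
  gives the Rayleigh quotient \<open>\<mu>\<close>, and \<open>positive_eigenfunction_bound\<close>
  shows that no quotient is smaller: the infimum is attained at \<open>v\<close>.\<close>

lemma positive_eigenvalue_eq_first:
  assumes conn: "connected \<Omega>"
    and v: "pair v G" "AE x in \<Lambda>. 0 \<le> v x" "\<not> zero_on \<Omega> v" and \<mu>: "0 \<le> \<mu>"
    and eig: "\<And>\<psi> H. pair \<psi> H \<Longrightarrow>
      flux G H = \<mu> * (\<integral>x. v x powr (p - 1) * \<psi> x \<partial>\<Lambda>)"
  shows "first_eigenvalue \<Omega> p = \<mu>" "first_eigenfunction \<Omega> p v"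
proof -
  note Lp = sobolev_pair_Lp[OF v(1)]
  note [measurable] = Lp[THEN Lp_on_measurable]
  have "0 \<le> flux G H"
    if "pair \<psi> H" "AE x in \<Lambda>. 0 \<le> \<psi> x" for \<psi> H
    unfolding eig[OF that(1)] using that(2) \<mu>
    by (intro mult_nonneg_nonneg integral_nonneg_AE) (auto elim!: eventually_mono)
  then have pos: "AE x in \<Lambda>. 0 < v x"
    using strong_maximum_principle[OF v(1,2)] v(3) conn by (simp add: zero_on_def)
  have b: "0 < (\<integral>x. \<bar>v x\<bar> powr p \<partial>\<Lambda>)"
    using powr_integral_pos[OF Lp(1)] v(3) by (simp add: zero_on_def)
  have "energy G = flux G G"
    using powr_minus_two_mult[of "norm (G _)" p] powr_minus_one_mult[of "norm (G _)" p]
    by (simp add: power2_norm_eq_inner[symmetric] power2_eq_square mult.assoc[symmetric])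
  also have "\<dots> = \<mu> * (\<integral>x. v x powr (p - 1) * v x \<partial>\<Lambda>)"
    by (rule eig[OF v(1)])
  also have "(\<integral>x. v x powr (p - 1) * v x \<partial>\<Lambda>) = (\<integral>x. \<bar>v x\<bar> powr p \<partial>\<Lambda>)"
    using pos by (intro integral_cong_AE) (measurable, auto elim!: eventually_mono simp: powr_minus_one_mult)
  finally have Rv: "rayleigh \<Omega> p v = \<mu>"
    using b unfolding rayleigh_eq[OF v(1)] by simp
  show fe: "first_eigenvalue \<Omega> p = \<mu>"
    unfolding first_eigenvalue_def
  proof (rule cInf_eq_minimum)
    show "\<mu> \<in> {rayleigh \<Omega> p u |u. u \<in> W01p \<Omega> p \<and> \<not> zero_on \<Omega> u}"
      using Rv v W01p_iff by blast
    fix r assume "r \<in> {rayleigh \<Omega> p u |u. u \<in> W01p \<Omega> p \<and> \<not> zero_on \<Omega> u}"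
    then obtain u F where u: "r = rayleigh \<Omega> p u" "pair u F" "\<not> zero_on \<Omega> u"
      using W01p_iff by blast
    have "0 < (\<integral>x. \<bar>u x\<bar> powr p \<partial>\<Lambda>)"
      using powr_integral_pos[OF sobolev_pair_Lp(1)[OF u(2)]] u(3) by (simp add: zero_on_def)
    then show "\<mu> \<le> r"
      using positive_eigenfunction_bound[OF v(1) pos \<mu> eig u(2)]
      unfolding u(1) rayleigh_eq[OF u(2)] by (simp add: pos_le_divide_eq)
  qed
  show "first_eigenfunction \<Omega> p v"
    unfolding first_eigenfunction_def eigenfunction_def fe
  proof (intro conjI ballI)
    show "v \<in> W01p \<Omega> p" using v(1) W01p_iff by blast
    show "\<not> zero_on \<Omega> v" by (rule v(3))
    fix \<psi> assume "\<psi> \<in> W01p \<Omega> p"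
    then obtain H where \<psi>: "pair \<psi> H" using W01p_iff by blast
    note [measurable] = sobolev_pair_Lp(1)[OF \<psi>, THEN Lp_on_measurable]
    have "(\<integral>x. v x powr (p - 1) * \<psi> x \<partial>\<Lambda>) = (\<integral>x. \<bar>v x\<bar> powr (p - 2) * v x * \<psi> x \<partial>\<Lambda>)"
      using v(2) by (intro integral_cong_AE) (measurable, auto elim!: eventually_mono simp: powr_minus_two_mult)
    then show "plap_form \<Omega> p v \<psi> = \<mu> * (\<integral>x. \<bar>v x\<bar> powr (p - 2) * v x * \<psi> x \<partial>\<Lambda>)"
      unfolding plap_form_eq[OF v(1) \<psi>] eig[OF \<psi>] by simp
  qed
qed

section \<open>The comparison for nonnegative solutions\<close>

lemma pos_neg_part_powr_mult:
  shows "(pos_part f x powr (p - 1) - neg_part f x powr (p - 1)) * f x = \<bar>f x\<bar> powr p"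
    and "(pos_part f x powr (p - 1) - neg_part f x powr (p - 1)) * pos_part f x = pos_part f x powr p"
    and "(pos_part f x powr (p - 1) - neg_part f x powr (p - 1)) * neg_part f x = - (neg_part f x powr p)"
  using powr_minus_one_mult[of "f x" p] powr_minus_one_mult[of "- f x" p]
  by (cases "0 \<le> f x"; simp add: pos_part_def neg_part_def max_def; fail)+

text \<open>Everything reduces to algebra between four positive numbers: \<open>\<alpha>\<close>,
  \<open>\<beta>\<close>, \<open>\<gamma>\<close>, \<open>\<eta>\<close> are the L^p norms of
  \<open>P\<close>, \<open>v\<close>, \<open>G\<close> and \<open>FP\<close>. The equation is tested
  with \<open>f\<close>, \<open>v\<close>, \<open>P\<close> and, in the equality case, with
  \<open>N\<close>.\<close>

lemma rayleigh_le_nonneg: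
  assumes conn: "connected \<Omega>"
    and f: "f \<in> W01p \<Omega> p" "\<not> zero_on \<Omega> f"
    and v: "v \<in> W01p \<Omega> p" "\<not> zero_on \<Omega> v" "nonneg_on \<Omega> v"
    and eq: "\<And>\<psi>. \<psi> \<in> W01p \<Omega> p \<Longrightarrow> plap_form \<Omega> p v \<psi> =
      (\<integral>x. (pos_part f x powr (p - 1) - neg_part f x powr (p - 1)) * \<psi> x \<partial>\<Lambda>)"
  shows "\<not> zero_on \<Omega> (pos_part f)"
    and "rayleigh \<Omega> p v \<le> rayleigh \<Omega> p (pos_part f)"
    and "rayleigh \<Omega> p v = rayleigh \<Omega> p (pos_part f) \<longleftrightarrow>
      (AE x in \<Lambda>. v x = first_eigenvalue \<Omega> p powr (1 / (1 - p)) * f x) \<and> first_eigenfunction \<Omega> p v"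
proof -
  define P N where "P = pos_part f" and "N = neg_part f"
  obtain F G where F: "pair f F" and G: "pair v G"
    using f v W01p_iff by blast
  define FP FN where "FP x = (if 0 < f x then F x else 0)" and "FN x = (if f x < 0 then - F x else 0)" for x
  have FP: "pair P FP" and FN: "pair N FN"
    unfolding P_def N_def FP_def FN_def using F by (auto intro: sobolev_pair_pos_part sobolev_pair_neg_part)
  note L = sobolev_pair_Lp[OF G] sobolev_pair_Lp[OF F] sobolev_pair_Lp[OF FP] sobolev_pair_Lp[OF FN]
  note [measurable] = L[THEN Lp_on_measurable]
  have P0: "0 \<le> P x" and N0: "0 \<le> N x" for x by (auto simp: P_def N_def pos_part_def neg_part_def)
  have v0: "AE x in \<Lambda>. 0 \<le> v x" using v(3) by (simp add: nonneg_on_def)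
  have vabs: "AE x in \<Lambda>. \<bar>v x\<bar> = v x" using v0 by eventually_elim simp
  have eq': "flux G H
      = (\<integral>x. (P x powr (p - 1) - N x powr (p - 1)) * \<psi> x \<partial>\<Lambda>)" if "pair \<psi> H" for \<psi> H
    using eq[of \<psi>] that W01p_iff[of \<psi>] unfolding plap_form_eq[OF G that] P_def N_def by blast
  have GG: "norm (G x) powr (p - 2) * (G x \<bullet> G x) = norm (G x) powr p" for x
    using powr_minus_two_mult[of "norm (G x)" p] powr_minus_one_mult[of "norm (G x)" p]
    by (simp add: power2_norm_eq_inner[symmetric] power2_eq_square mult.assoc[symmetric])
  have vnz: "\<not> (AE x in \<Lambda>. v x = 0)" using v(2) by (simp add: zero_on_def)
  \<comment> \<open>Testing with \<open>f\<close> turns the right-hand side into the integral of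
    \<open>\<bar>f\<bar> powr p\<close>, which is positive; so the gradient of \<open>v\<close>
    cannot vanish a.e.\<close>
  have Gnz: "\<not> (AE x in \<Lambda>. G x = 0)"
  proof
    assume G0: "AE x in \<Lambda>. G x = 0"
    have "flux G F = 0"
      by (rule integral_eq_zero_AE) (use G0 in \<open>auto elim!: eventually_mono\<close>)
    then have "energy f = 0"
      unfolding eq'[OF F] by (simp add: P_def N_def pos_neg_part_powr_mult)
    then show False
      using powr_integral_pos[OF L(3)] f(2) by (simp add: zero_on_def)
  qed
  define \<beta> \<gamma> where "\<beta> = (\<integral>x. \<bar>v x\<bar> powr p \<partial>\<Lambda>) powr (1 / p)"
    and "\<gamma> = energy G powr (1 / p)"
  have \<beta>: "0 < \<beta>" "(\<integral>x. \<bar>v x\<bar> powr p \<partial>\<Lambda>) = \<beta> powr p"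
    using powr_integral_pos[OF L(1) vnz] p by (auto simp: \<beta>_def powr_powr)
  have \<gamma>: "0 < \<gamma>" "energy G = \<gamma> powr p"
    using powr_integral_pos[OF L(2) Gnz] p by (auto simp: \<gamma>_def powr_powr)
  have prod_int: "integrable \<Lambda> (\<lambda>x. s x powr (p - 1) * \<bar>v x\<bar>)"
    if "Lp s" "\<And>x. 0 \<le> s x" for s
  proof (rule Bochner_Integration.integrable_bound)
    note [measurable] = that(1)[THEN Lp_on_measurable]
    show "integrable \<Lambda> (\<lambda>x. norm (s x) powr p + norm (v x) powr p)"
      using that L(1) by (intro Bochner_Integration.integrable_add Lp_on_integrable_powr)
    show "(\<lambda>x. s x powr (p - 1) * \<bar>v x\<bar>) \<in> borel_measurable \<Lambda>"
      by measurable
    show "AE x in \<Lambda>. norm (s x powr (p - 1) * \<bar>v x\<bar>) \<le> norm (norm (s x) powr p + norm (v x) powr p)"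
      using that(2) powr_mult_le_add[OF p, of "s _" "\<bar>v _\<bar>"] by (intro AE_I2) (auto simp: abs_mult)
  qed
  define IP IN where "IP = (\<integral>x. P x powr (p - 1) * \<bar>v x\<bar> \<partial>\<Lambda>)" and "IN = (\<integral>x. N x powr (p - 1) * \<bar>v x\<bar> \<partial>\<Lambda>)"
  have "\<gamma> powr p = (\<integral>x. (P x powr (p - 1) - N x powr (p - 1)) * v x \<partial>\<Lambda>)"
    using eq'[OF G] \<gamma>(2) by (simp add: GG)
  also have "\<dots> = (\<integral>x. P x powr (p - 1) * \<bar>v x\<bar> - N x powr (p - 1) * \<bar>v x\<bar> \<partial>\<Lambda>)"
    using vabs by (intro integral_cong_AE) (measurable, auto elim!: eventually_mono simp: left_diff_distrib)
  also have "\<dots> = IP - IN"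
    unfolding IP_def IN_def using prod_int[OF L(5) P0] prod_int[OF L(7) N0] by simp
  finally have \<gamma>I: "\<gamma> powr p = IP - IN" .
  have IN0: "0 \<le> IN" unfolding IN_def by simp
  \<comment> \<open>Otherwise the positive number \<open>\<gamma> powr p\<close> would equal
    \<open>- IN\<close>, which is at most 0.\<close>
  have Pnz: "\<not> (AE x in \<Lambda>. P x = 0)"
  proof
    assume "AE x in \<Lambda>. P x = 0"
    then have "IP = 0"
      unfolding IP_def by (intro integral_eq_zero_AE) (auto elim!: eventually_mono)
    moreover have "0 < \<gamma> powr p" using \<gamma>(1) by simp
    ultimately show False using \<gamma>I IN0 by linarith
  qed
  then show "\<not> zero_on \<Omega> (pos_part f)" by (simp add: zero_on_def P_def)
  define \<alpha> where "\<alpha> = (\<integral>x. \<bar>P x\<bar> powr p \<partial>\<Lambda>) powr (1 / p)"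
  have \<alpha>: "0 < \<alpha>" "(\<integral>x. \<bar>P x\<bar> powr p \<partial>\<Lambda>) = \<alpha> powr p"
    using powr_integral_pos[OF L(5) Pnz] p by (auto simp: \<alpha>_def powr_powr)
  have \<alpha>': "(\<integral>x. P x powr p \<partial>\<Lambda>) = \<alpha> powr p"
    using \<alpha>(2) P0 by simp
  have a: "\<alpha> powr p = flux G FP"
    unfolding eq'[OF FP] \<alpha>'[symmetric] by (simp add: P_def N_def pos_neg_part_powr_mult)
  have FPnz: "\<not> (AE x in \<Lambda>. FP x = 0)"
  proof
    assume "AE x in \<Lambda>. FP x = 0"
    then have "\<alpha> powr p = 0"
      unfolding a by (intro integral_eq_zero_AE) (auto elim!: eventually_mono)
    then show False using \<alpha>(1) by simp
  qed
  define \<eta> where "\<eta> = energy FP powr (1 / p)"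
  have \<eta>: "0 < \<eta>" "energy FP = \<eta> powr p"
    using powr_integral_pos[OF L(6) FPnz] p by (auto simp: \<eta>_def powr_powr)
  note hold1 = holder_powr[OF L(5) P0 Lp_on_norm[OF L(1)] norm_ge_zero \<alpha>(1) \<alpha>' \<beta>(1) \<beta>(2)[folded real_norm_def], folded IP_def, unfolded real_norm_def, folded IP_def]
  note hold2 = holder_powr[OF Lp_on_norm[OF L(2)] norm_ge_zero Lp_on_norm[OF L(6)] norm_ge_zero \<gamma> \<eta>]
  have le1: "\<gamma> powr p \<le> \<alpha> powr (p - 1) * \<beta>"
    using \<gamma>I IN0 hold1(2) by linarith
  have "\<alpha> powr p \<le> (\<integral>x. norm (G x) powr (p - 1) * norm (FP x) \<partial>\<Lambda>)"
    unfolding a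
  proof (rule integral_mono[OF plap_integrand_integrable[OF L(2,6)] hold2(1)])
    fix x
    have "norm (G x) powr (p - 2) * (G x \<bullet> FP x) \<le> norm (G x) powr (p - 2) * (norm (G x) * norm (FP x))"
      by (intro mult_left_mono norm_cauchy_schwarz) auto
    also have "\<dots> = norm (G x) powr (p - 1) * norm (FP x)"
      using powr_minus_two_mult[of "norm (G x)" p] by (simp add: mult.assoc[symmetric])
    finally show "norm (G x) powr (p - 2) * (G x \<bullet> FP x) \<le> norm (G x) powr (p - 1) * norm (FP x)" .
  qed
  with hold2(2) have le2: "\<alpha> powr p \<le> \<gamma> powr (p - 1) * \<eta>" by linarith
  have Rv: "rayleigh \<Omega> p v = (\<gamma> / \<beta>) powr p"
    unfolding rayleigh_eq[OF G] \<beta>(2) \<gamma>(2) using \<beta>(1) \<gamma>(1) by (simp add: powr_divide)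
  have RP: "rayleigh \<Omega> p (pos_part f) = (\<eta> / \<alpha>) powr p"
    using rayleigh_eq[OF FP] \<alpha> \<eta> by (simp add: P_def powr_divide)
  \<comment> \<open>Rearranged, the two Hoelder estimates share the middle term
    \<open>(\<alpha> / \<gamma>) powr (p - 1)\<close>. Chaining them gives
    \<open>\<gamma> / \<beta> \<le> \<eta> / \<alpha>\<close>, the \<open>p\<close>-th root of the
    claim.\<close>
  have q1: "\<gamma> / \<beta> \<le> (\<alpha> / \<gamma>) powr (p - 1)"
    using le1 \<alpha>(1) \<beta>(1) \<gamma>(1) by (simp add: powr_divide powr_diff field_simps)
  have q2: "(\<alpha> / \<gamma>) powr (p - 1) \<le> \<eta> / \<alpha>"
    using le2 \<alpha>(1) \<gamma>(1) by (simp add: powr_divide powr_diff field_simps)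
  show "rayleigh \<Omega> p v \<le> rayleigh \<Omega> p (pos_part f)"
    unfolding Rv RP using order_trans[OF q1 q2] \<beta>(1) \<gamma>(1) p by (intro powr_mono2) auto
  show "rayleigh \<Omega> p v = rayleigh \<Omega> p (pos_part f) \<longleftrightarrow>
      (AE x in \<Lambda>. v x = first_eigenvalue \<Omega> p powr (1 / (1 - p)) * f x) \<and> first_eigenfunction \<Omega> p v"
  proof
    assume "rayleigh \<Omega> p v = rayleigh \<Omega> p (pos_part f)"
    then have "((\<gamma> / \<beta>) powr p) powr (1 / p) = ((\<eta> / \<alpha>) powr p) powr (1 / p)"
      unfolding Rv RP by simp
    then have "\<gamma> / \<beta> = \<eta> / \<alpha>"
      using p \<alpha>(1) \<beta>(1) \<gamma>(1) \<eta>(1) by (simp add: powr_powr)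
    \<comment> \<open>Equal ends make \<open>q1\<close> an equality. Since
      \<open>\<gamma> powr p = IP - IN\<close> with \<open>IN \<ge> 0\<close>, while
      \<open>IP\<close> is at most the Hoelder bound, \<open>IP\<close> attains this bound, and the
      equality case makes \<open>P\<close> and \<open>\<bar>v\<bar>\<close> proportional.\<close>
    with q1 q2 have "\<gamma> / \<beta> = (\<alpha> / \<gamma>) powr (p - 1)" by linarith
    then have e1: "\<gamma> powr p = \<alpha> powr (p - 1) * \<beta>"
      using \<alpha>(1) \<beta>(1) \<gamma>(1) by (simp add: powr_divide powr_diff field_simps)
    then have "IP = \<alpha> powr (p - 1) * \<beta>"
      using \<gamma>I IN0 hold1(2) by linarith
    then have "AE x in \<Lambda>. P x / \<alpha> = \<bar>v x\<bar> / \<beta>"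
      by (rule hold1(3))
    define \<kappa> where "\<kappa> = \<beta> / \<alpha>"
    have \<kappa>: "0 < \<kappa>" using \<alpha>(1) \<beta>(1) by (simp add: \<kappa>_def)
    have vP: "AE x in \<Lambda>. v x = \<kappa> * P x"
      using \<open>AE x in \<Lambda>. P x / \<alpha> = \<bar>v x\<bar> / \<beta>\<close> vabs
    proof eventually_elim
      case (elim x)
      then show ?case using \<alpha>(1) \<beta>(1) by (simp add: \<kappa>_def field_simps)
    qed
    have GP: "AE x in \<Lambda>. G x = \<kappa> *\<^sub>R FP x"
      by (rule sobolev_pair_unique[OF G sobolev_pair_cmult[OF FP] vP])
    \<comment> \<open>The gradient \<open>G\<close>, a multiple of \<open>FP\<close>, lives on
      \<open>f > 0\<close>, whereas \<open>FN\<close> lives on \<open>f < 0\<close>; the equation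
      tested with \<open>N\<close> has the right-hand side \<open>- energy N\<close>.\<close>
    have "flux G FN = 0"
      by (rule integral_eq_zero_AE) (use GP in \<open>auto elim!: eventually_mono simp: FP_def FN_def\<close>)
    then have "energy N = 0"
      unfolding eq'[OF FN] using N0 by (simp add: P_def N_def pos_neg_part_powr_mult)
    then have N_zero: "AE x in \<Lambda>. N x = 0"
      using powr_integral_pos[OF L(7)] by (metis less_irrefl)
    have vf: "AE x in \<Lambda>. v x = \<kappa> * f x"
      using vP N_zero by eventually_elim (auto simp: P_def N_def pos_part_def neg_part_def max_def split: if_splits)
    \<comment> \<open>From \<open>v = \<kappa> * P\<close> one gets
      \<open>P powr (p - 1) = \<kappa> powr (1 - p) * v powr (p - 1)\<close>, which is the
      eigenvalue equation. Solving for \<open>\<kappa>\<close> gives the factor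
      \<open>\<mu> powr (1 / (1 - p))\<close> of the claim.\<close>
    define \<mu> where "\<mu> = \<kappa> powr (1 - p)"
    have \<mu>: "0 \<le> \<mu>" by (simp add: \<mu>_def)
    have eig: "flux G H = \<mu> * (\<integral>x. v x powr (p - 1) * \<psi> x \<partial>\<Lambda>)"
      if \<psi>: "pair \<psi> H" for \<psi> H
    proof -
      note [measurable] = sobolev_pair_Lp(1)[OF \<psi>, THEN Lp_on_measurable]
      have "(\<integral>x. (P x powr (p - 1) - N x powr (p - 1)) * \<psi> x \<partial>\<Lambda>) = (\<integral>x. \<mu> * (v x powr (p - 1) * \<psi> x) \<partial>\<Lambda>)"
      proof (rule integral_cong_AE)
        show "AE x in \<Lambda>. (P x powr (p - 1) - N x powr (p - 1)) * \<psi> x = \<mu> * (v x powr (p - 1) * \<psi> x)"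
          using vP N_zero
        proof eventually_elim
          case (elim x)
          have "\<mu> * v x powr (p - 1) = P x powr (p - 1)"
            using elim \<kappa> P0[of x] by (simp add: \<mu>_def powr_mult powr_diff)
          then show ?case using elim p by (simp add: mult.assoc[symmetric])
        qed
      qed measurable
      then show ?thesis unfolding eq'[OF \<psi>] by simp
    qed
    have "first_eigenvalue \<Omega> p = \<mu>" "first_eigenfunction \<Omega> p v"
      by (rule positive_eigenvalue_eq_first[OF conn G v0 v(2) \<mu> eig]; assumption)+
    moreover have "\<mu> powr (1 / (1 - p)) = \<kappa>"
      using \<kappa> p by (simp add: \<mu>_def powr_powr)
    ultimately show "(AE x in \<Lambda>. v x = first_eigenvalue \<Omega> p powr (1 / (1 - p)) * f x) \<and> first_eigenfunction \<Omega> p v"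
      using vf by simp
  next
    define k where "k = first_eigenvalue \<Omega> p powr (1 / (1 - p))"
    assume "(AE x in \<Lambda>. v x = first_eigenvalue \<Omega> p powr (1 / (1 - p)) * f x) \<and> first_eigenfunction \<Omega> p v"
    then have vf: "AE x in \<Lambda>. v x = k * f x" by (simp add: k_def)
    \<comment> \<open>A value of \<open>powr\<close> is never negative, and \<open>k = 0\<close>
      would make \<open>v\<close> vanish a.e.; so positivity of \<open>k\<close> follows from
      \<open>v\<close> being nonzero.\<close>
    have "k \<noteq> 0"
    proof
      assume "k = 0"
      with vf have "AE x in \<Lambda>. v x = 0" by simp
      with vnz show False by contradiction
    qed
    then have k: "0 < k" by (simp add: k_def)
    have "AE x in \<Lambda>. P x = (1 / k) * v x"
      using vf v0
    proof eventually_elim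
      case (elim x)
      then have "0 \<le> f x" using k by (simp add: zero_le_mult_iff)
      then show ?case using elim k by (simp add: P_def pos_part_def)
    qed
    then have "rayleigh \<Omega> p P = rayleigh \<Omega> p v"
      using k by (intro rayleigh_cmult_AE[OF G FP, of "1 / k"]) auto
    then show "rayleigh \<Omega> p v = rayleigh \<Omega> p (pos_part f)" by (simp add: P_def)
  qed
qed

section \<open>Symmetry under change of sign\<close>

lemma sobolev_pair_uminus: "pair u G \<Longrightarrow> pair (\<lambda>x. - u x) (\<lambda>x. - G x)"
  using sobolev_pair_cmult[of u G "-1"] by simp

lemma W01p_uminus: "u \<in> W01p \<Omega> p \<Longrightarrow> (\<lambda>x. - u x) \<in> W01p \<Omega> p"
  using sobolev_pair_uminus W01p_iff by blast

lemma plap_form_uminus: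
  assumes "v \<in> W01p \<Omega> p" "\<psi> \<in> W01p \<Omega> p"
  shows "plap_form \<Omega> p (\<lambda>x. - v x) \<psi> = - plap_form \<Omega> p v \<psi>"
proof -
  obtain G H where G: "pair v G" and H: "pair \<psi> H"
    using assms W01p_iff by blast
  show ?thesis
    unfolding plap_form_eq[OF sobolev_pair_uminus[OF G] H] plap_form_eq[OF G H] by simp
qed

lemma rayleigh_uminus:
  assumes "v \<in> W01p \<Omega> p"
  shows "rayleigh \<Omega> p (\<lambda>x. - v x) = rayleigh \<Omega> p v"
proof -
  obtain G where G: "pair v G" using assms W01p_iff by blast
  show ?thesis
    by (rule rayleigh_cmult_AE[OF G sobolev_pair_uminus[OF G], of "-1"]) auto
qed

lemma first_eigenfunction_uminus:
  assumes "first_eigenfunction \<Omega> p v"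
  shows "first_eigenfunction \<Omega> p (\<lambda>x. - v x)"
  using assms unfolding first_eigenfunction_def eigenfunction_def
  by (auto simp: W01p_uminus plap_form_uminus zero_on_def)

lemma first_eigenfunction_uminus_iff:
  "first_eigenfunction \<Omega> p (\<lambda>x. - v x) \<longleftrightarrow> first_eigenfunction \<Omega> p v"
  using first_eigenfunction_uminus[of v] first_eigenfunction_uminus[of "\<lambda>x. - v x"] by auto

end

theorem proposition4p3:
  fixes \<Omega> :: "'a::euclidean_space set" and p :: real and f v :: "'a \<Rightarrow> real"
  assumes p: "1 < p"
    and \<Omega>: "open \<Omega>" "connected \<Omega>" "\<Omega> \<noteq> {}" "emeasure lebesgue \<Omega> < \<infinity>"
    and f: "f \<in> W01p \<Omega> p" "\<not> zero_on \<Omega> f"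
    and v: "v \<in> W01p \<Omega> p" "\<not> zero_on \<Omega> v"
    and eq: "\<And>\<psi>. \<psi> \<in> W01p \<Omega> p \<Longrightarrow> plap_form \<Omega> p v \<psi> =
      (\<integral>x. (pos_part f x powr (p - 1) - neg_part f x powr (p - 1)) * \<psi> x \<partial>lebesgue_on \<Omega>)"
    and sign: "sign_constant_on \<Omega> v"
  shows "(nonneg_on \<Omega> v \<longrightarrow>
            \<not> zero_on \<Omega> (pos_part f) \<and>
            rayleigh \<Omega> p v \<le> rayleigh \<Omega> p (pos_part f) \<and>
            (rayleigh \<Omega> p v = rayleigh \<Omega> p (pos_part f) \<longleftrightarrow>
               (AE x in lebesgue_on \<Omega>. v x = first_eigenvalue \<Omega> p powr (1 / (1 - p)) * f x) \<and>
               first_eigenfunction \<Omega> p v))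
       \<and> (nonpos_on \<Omega> v \<longrightarrow>
            \<not> zero_on \<Omega> (neg_part f) \<and>
            rayleigh \<Omega> p v \<le> rayleigh \<Omega> p (neg_part f) \<and>
            (rayleigh \<Omega> p v = rayleigh \<Omega> p (neg_part f) \<longleftrightarrow>
               (AE x in lebesgue_on \<Omega>. v x = first_eigenvalue \<Omega> p powr (1 / (1 - p)) * f x) \<and>
               first_eigenfunction \<Omega> p v))"
proof (intro conjI[of "_ \<longrightarrow> _"] impI)
  interpret sobolev_domain \<Omega> p
    using p \<Omega> by unfold_locales
  show "\<not> zero_on \<Omega> (pos_part f) \<and>
      rayleigh \<Omega> p v \<le> rayleigh \<Omega> p (pos_part f) \<and>
      (rayleigh \<Omega> p v = rayleigh \<Omega> p (pos_part f) \<longleftrightarrow>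
        (AE x in lebesgue_on \<Omega>. v x = first_eigenvalue \<Omega> p powr (1 / (1 - p)) * f x) \<and>
        first_eigenfunction \<Omega> p v)" if "nonneg_on \<Omega> v"
    using rayleigh_le_nonneg[OF \<Omega>(2) f v that eq] by blast
  show "\<not> zero_on \<Omega> (neg_part f) \<and>
      rayleigh \<Omega> p v \<le> rayleigh \<Omega> p (neg_part f) \<and>
      (rayleigh \<Omega> p v = rayleigh \<Omega> p (neg_part f) \<longleftrightarrow>
        (AE x in lebesgue_on \<Omega>. v x = first_eigenvalue \<Omega> p powr (1 / (1 - p)) * f x) \<and>
        first_eigenfunction \<Omega> p v)" if nonpos: "nonpos_on \<Omega> v"
  proof -
    have pn: "pos_part (\<lambda>x. - f x) = neg_part f" "neg_part (\<lambda>x. - f x) = pos_part f"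
      by (simp_all add: pos_part_def neg_part_def)
    have f': "(\<lambda>x. - f x) \<in> W01p \<Omega> p" "\<not> zero_on \<Omega> (\<lambda>x. - f x)"
      using f by (auto simp: W01p_uminus zero_on_def)
    have v': "(\<lambda>x. - v x) \<in> W01p \<Omega> p" "\<not> zero_on \<Omega> (\<lambda>x. - v x)" "nonneg_on \<Omega> (\<lambda>x. - v x)"
      using v nonpos by (auto simp: W01p_uminus zero_on_def nonneg_on_def nonpos_on_def)
    \<comment> \<open>Both sides of the equation are odd: the form in \<open>v\<close>, and the
      right-hand side in \<open>f\<close>, since negating \<open>f\<close> exchanges its positive
      and negative parts.\<close>
    have eq': "plap_form \<Omega> p (\<lambda>x. - v x) \<psi> = (\<integral>x. (pos_part (\<lambda>x. - f x) x powr (p - 1)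
        - neg_part (\<lambda>x. - f x) x powr (p - 1)) * \<psi> x \<partial>lebesgue_on \<Omega>)" if "\<psi> \<in> W01p \<Omega> p" for \<psi>
      unfolding plap_form_uminus[OF v(1) that] eq[OF that] pn
      by (simp add: left_diff_distrib flip: Bochner_Integration.integral_minus)
    show ?thesis
      using rayleigh_le_nonneg[OF \<Omega>(2) f' v' eq'] v(1)
      by (simp add: pn rayleigh_uminus first_eigenfunction_uminus_iff)
  qed
qed

end
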